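(* Let $\varepsilon>0$ and assume the following. (1) $\hat{\mathbb P}=\sum_{j\in[J]}p_j\delta_{\hat z_j}$ for some $J\in\mathbb N$, with $p_j>0$ and $\hat z_j\in\mathcal Z$. (2) $c(z,\hat z)$ is lower semicontinuous in $(z,\hat z)$ and convex in $z$; $\ell(\theta,z)=\max_{i\in[I]}\ell_i(\theta,z)$ for some $I\in\mathbb N$, where each $\ell_i(\theta,z)$ is proper, convex and lower semicontinuous in $\theta$ and each $-\ell_i(\theta,z)$ is proper, convex and lower semicontinuous in $z$; $\mathcal Z=\{z\in\mathbb R^d:f_k(z)\le0\ \forall k\in[K]\}$ and $\Theta=\{\theta\in\mathbb R^m:g_l(\theta)\le 0\ \forall l\in[L]\}$ with all $f_k$ and $g_l$ proper, convex and lower semicontinuous. (3) For every $j\in[J]$, $\hat z_j\in\mathrm{rint}(\mathrm{dom}(c(\cdot,\hat z_j)))$ and $\hat z_j$ is a Slater point of $\mathcal Z$; and $\Theta$ admits a Slater point. (4) For any $\mathbb Q\in\mathbb B_\varepsilon(\hat{\mathbb P})$ and $\bar\theta\in\Theta$ there is a neighborhood $\mathcal U$ of $\bar\theta$ such that the family $\ell^-(\theta,z)=-\min\{0,\ell(\theta,z)\}$, $\theta\in\mathcal U$, is uniformly $\mathbb Q$-integrable in $z$. (5) There exists $\theta\in\Theta$ with $\sup_{\mathbb Q\in\mathbb B_\varepsilon(\hat{\mathbb P})}\mathbb E_{Z\sim\mathbb Q}[\ell(\theta,Z)]<+\infty$. (6) At least one of the following holds: (a) $\mathbb E_{Z\sim\mathbb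 Q}[\ell(\theta,Z)]$ is inf-compact in $\theta\in\Theta$ for some $\mathbb Q\in\mathbb B_\varepsilon(\hat{\mathbb P})$ (all its sublevel sets in $\Theta$ are compact); (b) $\mathcal Z$ is compact; (c) $c(z,\hat z)$ grows superlinearly with $z$. Then the optimal values of the primal DRO problem $\inf_{\theta\in\Theta}\sup_{\mathbb Q\in\mathbb B_\varepsilon(\hat{\mathbb P})}\mathbb E_{Z\sim\mathbb Q}[\ell(\theta,Z)]$ and of the dual DRO problem $\sup_{\mathbb Q\in\mathbb B_\varepsilon(\hat{\mathbb P})}\inf_{\theta\in\Theta}\mathbb E_{Z\sim\mathbb Q}[\ell(\theta,Z)]$ match, and the following hold. (i) If $(\theta^\star,\lambda^\star,\{s_j^\star\}_j,\{\zeta^{\ell\star}_{ij},\zeta^{c\star}_{ij}\}_{i,j},\{\tau^\star_{ijk},\zeta^{f\star}_{ijk}\}_{i,j,k})$ solves program (P) of the context, then $\theta^\star$ solves the primal DRO problem. (ii) If $(\{\beta_l^\star\}_l,\{\nu_l^\star\}_l,\{q^\star_{ij}\}_{i,j},\{\xi^\star_{ij}\}_{i,j},\{\alpha^\star_{ij}\}_{i,j})$ solves program (D) of the context and $\mathcal I_j^\infty=\{i\in[I]:q_{ij}^\star=0,\ \xi_{ij}^\star\ne0\}=\emptyset$ for every $j\in[J]$, then, with $\mathcal I_j^+=\{i\in[I]:q^\star_{ij}>0\}$, the discrete distribution $$\mathbb Q^\star=\sum_{j\in[J]}\sum_{i\in\mathcal I_j^+}q^\star_{ij}\,\delta_{\hat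 z_j+\xi^\star_{ij}/q^\star_{ij}}$$ solves the dual DRO problem.
   Context: $[n]=\{1,\dots,n\}$. $\Theta\subseteq\mathbb R^m$ and $\mathcal Z\subseteq\mathbb R^d$ are non-empty and closed. $\mathcal P(\mathcal Z)$ is the set of probability distributions on $\mathcal Z$ and $\hat{\mathbb P}\in\mathcal P(\mathcal Z)$ the reference distribution; $\delta_z$ is the Dirac measure at $z$. The cost $c:\mathcal Z\times\mathcal Z\to[0,+\infty]$ satisfies $c(z,\hat z)=0$ iff $z=\hat z$; when conjugated or when its domain is taken, $c(\cdot,\hat z)$ is regarded as an extended-real-valued function on $\mathbb R^d$ (equal to $+\infty$ where it is not defined). $d_c(\mathbb Q,\hat{\mathbb P})=\inf_{\pi}\mathbb E_{(Z,\hat Z)\sim\pi}[c(Z,\hat Z)]$ over all couplings $\pi$ of $\mathbb Q$ and $\hat{\mathbb P}$, and $\mathbb B_\varepsilon(\hat{\mathbb P})=\{\mathbb Q\in\mathcal P(\mathcal Z):d_c(\mathbb Q,\hat{\mathbb P})\le\varepsilon\}$. "$c(z,\hat z)$ grows superlinearly with $z$" means $c(z,\hat z)/\|z\|\to\infty$ as $\|z\|\to\infty$ for fixed $\hat z$. Slater point: for a set $\mathcal X=\{x:h_m(x)\le0\ \forall m\in[M]\}$ given by such a representation, a Slater point is any $x^s\in\mathcal X$ with $x^s\in\mathrm{rint}(\mathrm{dom}(h_m))$ for all $m\in[M]$ and $h_m(x^s)<0$ for all $m$ such that $h_m$ is nonlinear. Here $\mathrm{dom}(h)=\{x:h(x)<\infty\}$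 and $\mathrm{rint}$ is the relative interior. Conjugates: $f^*(y)=\sup_x\langle y,x\rangle-f(x)$. $(-\ell_i)^{*2}(\theta,\zeta)$ is the conjugate of $-\ell_i(\theta,z)$ with respect to $z$ for fixed $\theta$; $c^{*1}(\zeta,\hat z)$ is the conjugate of $c(z,\hat z)$ with respect to $z$ for fixed $\hat z$; $\ell_i^{*1}(\alpha,z)$ is the conjugate of $\ell_i(\theta,z)$ with respect to $\theta$ for fixed $z$. Perspective convention: for proper convex lower semicontinuous $f$ and $\lambda\ge 0$, $\lambda f(x/\lambda)$ denotes the perspective function, equal to $\lambda f(x/\lambda)$ in the usual sense if $\lambda>0$ and to $\delta^*_{\mathrm{dom}(f^* )}(x)=\sup_{y\in\mathrm{dom}(f^* )}\langle x,y\rangle$ if $\lambda=0$. Accordingly $q f_k(\hat z_j+\xi/q)$, $q\,c(\hat z_j+\xi/q,\hat z_j)$ and $q\,\ell_i^{*1}(\alpha/q,\hat z_j+\xi/q)$ are the perspectives of $\xi\mapsto f_k(\hat z_j+\xi)$, $\xi\mapsto c(\hat z_j+\xi,\hat z_j)$ and $(\alpha,\xi)\mapsto \ell_i^{*1}(\alpha,\hat z_j+\xi)$, respectively. Program (P): $$\begin{array}{cll}\inf&\lambda\varepsilon+\sum_{j\in[J]}p_js_j\\ \text{s.t.}&\theta\in\Theta,\ \lambda,\tau_{ijk}\in\mathbb R_+,\ s_j\in\mathbb R,\ \zeta^\ell_{ij},\zeta^c_{ij},\zeta^f_{ijk}\in\mathbb R^d&\forall i\in[I],j\in[J],k\in[K]\\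 &(-\ell_i)^{*2}(\theta,\zeta^\ell_{ij})+\lambda c^{*1}(\zeta^c_{ij}/\lambda,\hat z_j)+\sum_{k\in[K]}\tau_{ijk}f_k^*(\zeta^f_{ijk}/\tau_{ijk})\le s_j&\forall i\in[I],j\in[J]\\ &\zeta^\ell_{ij}+\zeta^c_{ij}+\sum_{k\in[K]}\zeta^f_{ijk}=0&\forall i\in[I],j\in[J].\end{array}$$ Program (D): $$\begin{array}{cll}\max&-\sum_{i\in[I]}\sum_{j\in[J]}q_{ij}\,\ell_i^{*1}(\alpha_{ij}/q_{ij},\hat z_j+\xi_{ij}/q_{ij})-\sum_{l\in[L]}\nu_l\,g_l^*(\beta_l/\nu_l)\\ \text{s.t.}&q_{ij},\nu_l\in\mathbb R_+,\ \xi_{ij}\in\mathbb R^d,\ \alpha_{ij},\beta_l\in\mathbb R^m&\forall i\in[I],j\in[J],l\in[L]\\ &q_{ij}f_k(\hat z_j+\xi_{ij}/q_{ij})\le0&\forall i\in[I],j\in[J],k\in[K]\\ &\sum_{i\in[I]}q_{ij}=p_j&\forall j\in[J]\\ &\sum_{i\in[I]}\sum_{j\in[J]}\alpha_{ij}+\sum_{l\in[L]}\beta_l=0\\ &\sum_{i\in[I]}\sum_{j\in[J]}q_{ij}\,c(\hat z_j+\xi_{ij}/q_{ij},\hat z_j)\le\varepsilon.\end{array}$$ *)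

theory Defs
  imports "HOL-Probability.Probability"
begin

section \<open>Convex analysis for extended-real-valued functions\<close>

definition edom :: "('a \<Rightarrow> ereal) \<Rightarrow> 'a set" where
  "edom f = {x. f x < \<infinity>}"

definition lsc_on :: "'a::topological_space set \<Rightarrow> ('a \<Rightarrow> ereal) \<Rightarrow> bool" where
  "lsc_on S f \<longleftrightarrow> (\<forall>x\<in>S. f x \<le> Liminf (at x within S) f)"

definition econvex :: "('a::real_vector \<Rightarrow> ereal) \<Rightarrow> bool" where
  "econvex f \<longleftrightarrow> convex {(x, t::real). f x \<le> ereal t}"

definition proper :: "('a \<Rightarrow> ereal) \<Rightarrow> bool" where
  "proper f \<longleftrightarrow> edom f \<noteq> {} \<and> (\<forall>x. f x \<noteq> -\<infinity>)"

definition proper_convex_lsc :: "('a::real_normed_vector \<Rightarrow> ereal) \<Rightarrow> bool" where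
  "proper_convex_lsc f \<longleftrightarrow> proper f \<and> econvex f \<and> lsc_on UNIV f"

definition fenchel_conj :: "('a::real_inner \<Rightarrow> ereal) \<Rightarrow> 'a \<Rightarrow> ereal" where
  "fenchel_conj f y = (SUP x. ereal (y \<bullet> x) - f x)"

text \<open>For \<open>q \<ge> 0\<close>, \<open>persp f q x\<close> is the perspective \<open>q f(x/q)\<close>; at \<open>q = 0\<close> it is the support
  function of the domain of the conjugate of \<open>f\<close>.\<close>

definition persp :: "('a::real_inner \<Rightarrow> ereal) \<Rightarrow> real \<Rightarrow> 'a \<Rightarrow> ereal" where
  "persp f q x =
     (if q = 0 then (SUP y\<in>edom (fenchel_conj f). ereal (x \<bullet> y))
      else ereal q * f (x /\<^sub>R q))"

text \<open>A constraint function counts as linear if it is finite and affine on the whole space.\<close>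

definition affine_fun :: "('a::real_inner \<Rightarrow> ereal) \<Rightarrow> bool" where
  "affine_fun h \<longleftrightarrow> (\<exists>a b. \<forall>x. h x = ereal (a \<bullet> x + b))"

definition slater_point :: "'i set \<Rightarrow> ('i \<Rightarrow> 'a::euclidean_space \<Rightarrow> ereal) \<Rightarrow> 'a \<Rightarrow> bool" where
  "slater_point M h x \<longleftrightarrow>
     (\<forall>m\<in>M. h m x \<le> 0) \<and>
     (\<forall>m\<in>M. x \<in> rel_interior (edom (h m))) \<and>
     (\<forall>m\<in>M. \<not> affine_fun (h m) \<longrightarrow> h m x < 0)"

text \<open>The cost is only meaningful on \<open>Z \<times> Z\<close>; \<open>cost_ext Z c zh\<close> is \<open>c(\<cdot>, zh)\<close> as a function on
  the whole space.\<close>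

definition cost_ext :: "'a set \<Rightarrow> ('a \<Rightarrow> 'a \<Rightarrow> ennreal) \<Rightarrow> 'a \<Rightarrow> 'a \<Rightarrow> ereal" where
  "cost_ext Z c zh z = (if z \<in> Z then enn2ereal (c z zh) else \<infinity>)"


section \<open>Distributions, optimal transport and expectations\<close>

definition probs_on :: "'a::topological_space set \<Rightarrow> 'a measure set" where
  "probs_on Z = {Q. prob_space Q \<and> sets Q = sets borel \<and> emeasure Q Z = 1}"

text \<open>The distribution \<open>\<Sum>\<^sub>a\<^sub>\<in>\<^sub>A w(a) \<delta>\<^bsub>x(a)\<^esub>\<close>, for finite \<open>A\<close>.\<close>

definition discrete_dist :: "'i set \<Rightarrow> ('i \<Rightarrow> real) \<Rightarrow> ('i \<Rightarrow> 'a::topological_space) \<Rightarrow> 'a measure" where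
  "discrete_dist A w x = distr (point_measure A (\<lambda>a. ennreal (w a))) borel x"

lemma emeasure_discrete_dist:
  assumes "finite A" and B: "B \<in> sets borel"
  shows "emeasure (discrete_dist A w x) B = (\<Sum>a\<in>A. ennreal (w a) * indicator B (x a))"
proof -
  have "emeasure (discrete_dist A w x) B =
        emeasure (point_measure A (\<lambda>a. ennreal (w a))) (x -` B \<inter> A)"
    unfolding discrete_dist_def using B
    by (subst emeasure_distr) (auto simp: space_point_measure measurable_def sets_point_measure)
  also have "\<dots> = (\<Sum>a\<in>x -` B \<inter> A. ennreal (w a))"
    using assms by (subst emeasure_point_measure_finite) auto
  also have "\<dots> = (\<Sum>a\<in>A. ennreal (w a) * indicator B (x a))"
    using \<open>finite A\<close> by (intro sum.mono_neutral_cong_left) (auto simp: indicator_def)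
  finally show ?thesis .
qed

definition couplings :: "'a::second_countable_topology measure \<Rightarrow> 'a measure \<Rightarrow> ('a \<times> 'a) measure set" where
  "couplings Q P = {\<pi>. prob_space \<pi> \<and> sets \<pi> = sets borel \<and>
     distr \<pi> borel fst = Q \<and> distr \<pi> borel snd = P}"

definition transport_cost ::
  "('a \<Rightarrow> 'a \<Rightarrow> ennreal) \<Rightarrow> 'a::second_countable_topology measure \<Rightarrow> 'a measure \<Rightarrow> ennreal" where
  "transport_cost c Q P = (INF \<pi>\<in>couplings Q P. \<integral>\<^sup>+w. c (fst w) (snd w) \<partial>\<pi>)"

definition ot_ball ::
  "'a::second_countable_topology set \<Rightarrow> ('a \<Rightarrow> 'a \<Rightarrow> ennreal) \<Rightarrow> real \<Rightarrow> 'a measure \<Rightarrow> 'a measure set" where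
  "ot_ball Z c eps P = {Q \<in> probs_on Z. transport_cost c Q P \<le> ennreal eps}"

text \<open>Integral of the positive part minus integral of the negative part; only used when the
  latter is finite.\<close>

definition eexpect :: "'a measure \<Rightarrow> ('a \<Rightarrow> ereal) \<Rightarrow> ereal" where
  "eexpect Q f =
     enn2ereal (\<integral>\<^sup>+z. e2ennreal (max 0 (f z)) \<partial>Q) - enn2ereal (\<integral>\<^sup>+z. e2ennreal (max 0 (- f z)) \<partial>Q)"

definition unif_integrable :: "'a measure \<Rightarrow> ('a \<Rightarrow> ennreal) set \<Rightarrow> bool" where
  "unif_integrable Q F \<longleftrightarrow> F \<subseteq> borel_measurable Q \<and>
     ((\<lambda>t::real. SUP f\<in>F. \<integral>\<^sup>+z. f z * indicator {z. f z > ennreal t} z \<partial>Q) \<longlongrightarrow> 0) at_top"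

definition neg_part :: "('b \<Rightarrow> 'a \<Rightarrow> ereal) \<Rightarrow> 'b \<Rightarrow> 'a \<Rightarrow> ennreal" where
  "neg_part loss \<theta> z = e2ennreal (- min 0 (loss \<theta> z))"


section \<open>The distributionally robust problems\<close>

definition worst_risk :: "'a measure set \<Rightarrow> ('b \<Rightarrow> 'a \<Rightarrow> ereal) \<Rightarrow> 'b \<Rightarrow> ereal" where
  "worst_risk B loss \<theta> = (SUP Q\<in>B. eexpect Q (loss \<theta>))"

definition best_risk :: "'b set \<Rightarrow> ('b \<Rightarrow> 'a \<Rightarrow> ereal) \<Rightarrow> 'a measure \<Rightarrow> ereal" where
  "best_risk T loss Q = (INF \<theta>\<in>T. eexpect Q (loss \<theta>))"


section \<open>The finite convex programs\<close>

text \<open>Index families are functions on \<open>nat\<close>; only indices in the ranges \<open>{1..I}\<close>, \<open>{1..J}\<close>,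
  \<open>{1..K}\<close>, \<open>{1..L}\<close> matter.
  Variables of the primal program: \<open>\<theta>\<close>, \<open>\<lambda>\<close>, \<open>s\<close>, \<open>\<zeta>\<^sup>\<ell>\<close>, \<open>\<zeta>\<^sup>c\<close>, \<open>\<tau>\<close>, \<open>\<zeta>\<^sup>f\<close>.\<close>

type_synonym ('m, 'd) primal_var =
  "'m \<times> real \<times> (nat \<Rightarrow> real) \<times> (nat \<Rightarrow> nat \<Rightarrow> 'd) \<times> (nat \<Rightarrow> nat \<Rightarrow> 'd) \<times>
   (nat \<Rightarrow> nat \<Rightarrow> nat \<Rightarrow> real) \<times> (nat \<Rightarrow> nat \<Rightarrow> nat \<Rightarrow> 'd)"

definition primal_feasible ::
  "nat \<Rightarrow> nat \<Rightarrow> nat \<Rightarrow> 'm set \<Rightarrow> 'd::euclidean_space set \<Rightarrow> ('d \<Rightarrow> 'd \<Rightarrow> ennreal) \<Rightarrow>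
   (nat \<Rightarrow> 'm \<Rightarrow> 'd \<Rightarrow> ereal) \<Rightarrow> (nat \<Rightarrow> 'd \<Rightarrow> ereal) \<Rightarrow> (nat \<Rightarrow> 'd) \<Rightarrow> ('m, 'd) primal_var \<Rightarrow> bool" where
  "primal_feasible I J K T Z c l f zh = (\<lambda>(\<theta>, lam, s, zl, zc, tau, zf).
     \<theta> \<in> T \<and> 0 \<le> lam \<and> (\<forall>i\<in>{1..I}. \<forall>j\<in>{1..J}. \<forall>k\<in>{1..K}. 0 \<le> tau i j k) \<and>
     (\<forall>i\<in>{1..I}. \<forall>j\<in>{1..J}.
        fenchel_conj (\<lambda>z. - l i \<theta> z) (zl i j)
        + persp (fenchel_conj (cost_ext Z c (zh j))) lam (zc i j)
        + (\<Sum>k\<in>{1..K}. persp (fenchel_conj (f k)) (tau i j k) (zf i j k)) \<le> ereal (s j)) \<and>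
     (\<forall>i\<in>{1..I}. \<forall>j\<in>{1..J}. zl i j + zc i j + (\<Sum>k\<in>{1..K}. zf i j k) = 0))"

definition primal_objective ::
  "nat \<Rightarrow> real \<Rightarrow> (nat \<Rightarrow> real) \<Rightarrow> ('m, 'd) primal_var \<Rightarrow> real" where
  "primal_objective J eps p = (\<lambda>(\<theta>, lam, s, zl, zc, tau, zf). lam * eps + (\<Sum>j\<in>{1..J}. p j * s j))"

text \<open>Variables of the dual program: \<open>\<beta>\<close>, \<open>\<nu>\<close>, \<open>q\<close>, \<open>\<xi>\<close>, \<open>\<alpha>\<close>.\<close>

type_synonym ('m, 'd) dual_var =
  "(nat \<Rightarrow> 'm) \<times> (nat \<Rightarrow> real) \<times> (nat \<Rightarrow> nat \<Rightarrow> real) \<times> (nat \<Rightarrow> nat \<Rightarrow> 'd) \<times> (nat \<Rightarrow> nat \<Rightarrow> 'm)"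

definition dual_feasible ::
  "nat \<Rightarrow> nat \<Rightarrow> nat \<Rightarrow> nat \<Rightarrow> 'd::euclidean_space set \<Rightarrow> ('d \<Rightarrow> 'd \<Rightarrow> ennreal) \<Rightarrow>
   (nat \<Rightarrow> 'd \<Rightarrow> ereal) \<Rightarrow> (nat \<Rightarrow> 'd) \<Rightarrow> (nat \<Rightarrow> real) \<Rightarrow> real \<Rightarrow> ('m::euclidean_space, 'd) dual_var \<Rightarrow> bool" where
  "dual_feasible I J K L Z c f zh p eps = (\<lambda>(\<beta>, \<nu>, q, \<xi>, \<alpha>).
     (\<forall>i\<in>{1..I}. \<forall>j\<in>{1..J}. 0 \<le> q i j) \<and> (\<forall>l\<in>{1..L}. 0 \<le> \<nu> l) \<and>
     (\<forall>i\<in>{1..I}. \<forall>j\<in>{1..J}. \<forall>k\<in>{1..K}. persp (\<lambda>x. f k (zh j + x)) (q i j) (\<xi> i j) \<le> 0) \<and>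
     (\<forall>j\<in>{1..J}. (\<Sum>i\<in>{1..I}. q i j) = p j) \<and>
     (\<Sum>i\<in>{1..I}. \<Sum>j\<in>{1..J}. \<alpha> i j) + (\<Sum>l\<in>{1..L}. \<beta> l) = 0 \<and>
     (\<Sum>i\<in>{1..I}. \<Sum>j\<in>{1..J}. persp (\<lambda>x. cost_ext Z c (zh j) (zh j + x)) (q i j) (\<xi> i j)) \<le> ereal eps)"

text \<open>The perspective of \<open>\<ell>\<^sub>i\<^sup>*\<^sup>1\<close> is taken jointly in \<open>(\<alpha>, \<xi>)\<close>, on the product inner product space.\<close>

definition dual_objective ::
  "nat \<Rightarrow> nat \<Rightarrow> nat \<Rightarrow> (nat \<Rightarrow> 'm \<Rightarrow> 'd \<Rightarrow> ereal) \<Rightarrow> (nat \<Rightarrow> 'm \<Rightarrow> ereal) \<Rightarrow> (nat \<Rightarrow> 'd) \<Rightarrow>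
   ('m::euclidean_space, 'd::euclidean_space) dual_var \<Rightarrow> ereal" where
  "dual_objective I J L l g zh = (\<lambda>(\<beta>, \<nu>, q, \<xi>, \<alpha>).
     - (\<Sum>i\<in>{1..I}. \<Sum>j\<in>{1..J}.
          persp (\<lambda>(a, x). fenchel_conj (\<lambda>\<theta>. l i \<theta> (zh j + x)) a) (q i j) (\<alpha> i j, \<xi> i j))
     - (\<Sum>k\<in>{1..L}. persp (fenchel_conj (g k)) (\<nu> k) (\<beta> k)))"

end

theory Submission
  imports Defs
begin

text \<open>All pieces of the loss are finite everywhere, and the cost is infinite outside \<open>Z\<close>. Convexity and
  \<open>c(z, zh) = 0 \<longleftrightarrow> z = zh\<close> make the cost grow at least linearly, so every coupling of bounded cost has
  first moments. Replacing a coupling by the barycenters of its pieces (one per atom of the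
  reference distribution and per active piece of the loss) lowers the cost and raises the
  expected loss by Jensen's inequality. Hence for each \<open>\<theta>\<close> the worst-case risk is the supremum of
  a finite-dimensional family of convex functions of \<open>\<theta>\<close> that is concave-like in its parameters.

  For such a family, inf and sup commute if the supremum has bounded sublevel sets, by
  finitely many applications of the two-function alternative; under superlinear cost growth
  (which includes compact \<open>Z\<close>) one applies this on growing balls and passes to a limit of plans.
  The primal program is then Lagrangian duality for the transport budget plus a sandwich theorem;
  the dual program is Lagrangian duality for \<open>\<Theta>\<close>, where affine constraints active at the Slater point
  are removed one at a time and the others are split off by separating their level sets.\<close>

section \<open>Minimax for concave-like families of convex functions\<close>

text \<open>The transport cost, the worst case and the primal program need not attain their optima,
  so the argument works with reals strictly below a value or slightly above it: open covers by
  strict superlevel sets, couplings of cost at most \<open>eps\<close> plus an error, near-optimal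
  feasible points. The pieces are finite because properness of \<open>l i\<close> in \<theta>
  excludes one infinity and properness of its negative in z the other. Finite convex functions are
  continuous and have supporting affine functions everywhere; finite covers and Jensen's inequality
  rest on this. A plan carries real upper bounds for its costs instead of the costs, so budgets add
  and pass to limits as reals. Merging two plans moves positions to mass-weighted means, which
  improves the value for all \<theta> at once; hence concave-like. Zero mass is the delicate case:
  perspectives at 0 are support functions, and mass escapes to infinity when \<open>q\<close>
  vanishes in the limit but \<open>q * z\<close> does not. Since \<open>eps\<close> is positive, the
  plan that leaves every atom in place is strictly within budget; it yields the multiplier of the
  budget and repairs budgets exceeded by a small amount.\<close>

lemma convexlike_alternative:
  fixes \<phi> \<psi> :: "'x \<Rightarrow> real"
  assumes cl: "\<And>x y t. x \<in> X \<Longrightarrow> y \<in> X \<Longrightarrow> 0 \<le> t \<Longrightarrow> t \<le> 1 \<Longrightarrow>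
      \<exists>w\<in>X. \<phi> w \<le> t * \<phi> x + (1 - t) * \<phi> y \<and> \<psi> w \<le> t * \<psi> x + (1 - t) * \<psi> y"
    and ge: "\<And>x. x \<in> X \<Longrightarrow> 0 \<le> \<phi> x \<or> 0 \<le> \<psi> x"
  obtains t where "0 \<le> t" "t \<le> 1" "\<And>x. x \<in> X \<Longrightarrow> 0 \<le> t * \<phi> x + (1 - t) * \<psi> x"
proof -
  consider "\<forall>x\<in>X. 0 \<le> \<phi> x" | "\<forall>x\<in>X. 0 \<le> \<psi> x" | x0 y0 where "x0 \<in> X" "\<phi> x0 < 0" "y0 \<in> X" "\<psi> y0 < 0"
    by (meson not_le)
  then show thesis
  proof cases
    case 1
    then show thesis by (intro that[of 1]) auto
  next
    case 2
    then show thesis by (intro that[of 0]) auto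
  next
    case 3
    \<comment> \<open>In the plane of pairs (\<open>\<phi>\<close>, \<open>\<psi>\<close>) the
      segment between the images of x and y must avoid the open negative quadrant; the inequality
      says that it passes the origin on the proper side.\<close>
    have key: "\<phi> x * \<psi> y \<le> \<phi> y * \<psi> x" if x: "x \<in> X" "\<phi> x < 0" and y: "y \<in> X" "\<psi> y < 0" for x y
    proof (rule ccontr)
      assume neg: "\<not> ?thesis"
      have nn: "0 \<le> \<psi> x" "0 \<le> \<phi> y" using ge[of x] ge[of y] x y by auto
      define n where "n = \<phi> y - \<phi> x + (\<psi> x - \<psi> y)"
      have n: "n > 0" unfolding n_def using nn x y by linarith
      \<comment> \<open>The weight at which both interpolated bounds agree; their common value would
        be negative, against \<open>ge\<close>.\<close>
      define s where "s = (\<phi> y - \<psi> y) / n"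
      have s: "0 \<le> s" "s \<le> 1" unfolding s_def using nn x y n by (auto simp: n_def)
      have s': "1 - s = (\<psi> x - \<phi> x) / n" unfolding s_def using n by (simp add: field_simps n_def)
      obtain w where w: "w \<in> X" "\<phi> w \<le> s * \<phi> x + (1 - s) * \<phi> y" "\<psi> w \<le> s * \<psi> x + (1 - s) * \<psi> y"
        using cl[OF x(1) y(1) s] by blast
      have "s * \<phi> x + (1 - s) * \<phi> y = (\<phi> y * \<psi> x - \<phi> x * \<psi> y) / n"
        unfolding s' unfolding s_def by (simp add: algebra_simps add_divide_distrib diff_divide_distrib)
      moreover have "s * \<psi> x + (1 - s) * \<psi> y = (\<phi> y * \<psi> x - \<phi> x * \<psi> y) / n"
        unfolding s' unfolding s_def by (simp add: algebra_simps add_divide_distrib diff_divide_distrib)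
      moreover have "(\<phi> y * \<psi> x - \<phi> x * \<psi> y) / n < 0" using neg n by (simp add: divide_neg_pos)
      ultimately show False using w ge[OF w(1)] by linarith
    qed
    \<comment> \<open>For \<open>\<psi> y < 0\<close> the combination at y is nonnegative exactly
      from weight \<open>\<sigma> y\<close> on; for \<open>\<phi> x < 0\<close> exactly up to
      \<open>\<psi> x / (\<psi> x - \<phi> x)\<close>. By \<open>key\<close> all lower thresholds
      stay below all upper ones, so the supremum of the former serves every point.\<close>
    define \<sigma> where "\<sigma> y = - \<psi> y / (\<phi> y - \<psi> y)" for y
    define B where "B = {y\<in>X. \<psi> y < 0}"
    define t where "t = (SUP y\<in>B. \<sigma> y)"
    have \<sigma>01: "0 \<le> \<sigma> y \<and> \<sigma> y \<le> 1" if "y \<in> B" for y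
      using that ge[of y] unfolding B_def \<sigma>_def by (auto simp: field_simps)
    have bdd: "bdd_above (\<sigma> ` B)" using \<sigma>01 by (auto intro!: bdd_aboveI2)
    have y0: "y0 \<in> B" using 3 by (auto simp: B_def)
    have t0: "0 \<le> t" unfolding t_def using cSUP_upper[OF y0 bdd] \<sigma>01[OF y0] by linarith
    have t1: "t \<le> 1" unfolding t_def using y0 \<sigma>01 by (intro cSUP_least) auto
    have "0 \<le> t * \<phi> x + (1 - t) * \<psi> x" if x: "x \<in> X" for x
    proof -
      consider "\<phi> x < 0" | "\<psi> x < 0" | "0 \<le> \<phi> x" "0 \<le> \<psi> x" by linarith
      then show ?thesis
      proof cases
        case 1
        then have \<psi>: "0 \<le> \<psi> x" using ge[OF x] by auto
        have d: "\<psi> x - \<phi> x > 0" using 1 \<psi> by linarith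
        have "t \<le> \<psi> x / (\<psi> x - \<phi> x)"
          unfolding t_def
        proof (rule cSUP_least)
          show "B \<noteq> {}" using y0 by auto
          fix y assume y: "y \<in> B"
          then have yy: "y \<in> X" "\<psi> y < 0" by (auto simp: B_def)
          then have "0 \<le> \<phi> y" using ge[of y] by auto
          then have d': "\<phi> y - \<psi> y > 0" using yy by linarith
          show "\<sigma> y \<le> \<psi> x / (\<psi> x - \<phi> x)"
            unfolding \<sigma>_def using key[OF x 1 yy] d d' by (simp add: divide_simps) (simp add: algebra_simps)
        qed
        then show ?thesis using d by (simp add: field_simps)
      next
        case 2
        then have xB: "x \<in> B" using x by (simp add: B_def)
        have d: "\<phi> x - \<psi> x > 0" using 2 ge[OF x] by linarith
        have "\<sigma> x \<le> t" unfolding t_def by (rule cSUP_upper[OF xB bdd])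
        then show ?thesis unfolding \<sigma>_def using d by (simp add: field_simps)
      next
        case 3
        then show ?thesis using t0 t1 by simp
      qed
    qed
    then show thesis using that t0 t1 by blast
  qed
qed

text \<open>Where \<open>\<Phi> x\<close> reaches a nothing remains to be done. The rest of C is a
  strict sublevel set, hence convex, and the induction hypothesis gives one y for it. On C one of
  the two is then at least a at every point, and the alternative combines them into a mixture
  dominated by a single w.\<close>

lemma concavelike_finite_dominate:
  fixes \<Phi> :: "'x \<Rightarrow> 'a::real_vector \<Rightarrow> real"
  assumes conv: "\<And>x. x \<in> X \<Longrightarrow> convex_on UNIV (\<Phi> x)"
    and mix: "\<And>x y t. x \<in> X \<Longrightarrow> y \<in> X \<Longrightarrow> 0 \<le> t \<Longrightarrow> t \<le> 1 \<Longrightarrow>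
      \<exists>w\<in>X. \<forall>\<theta>. t * \<Phi> x \<theta> + (1 - t) * \<Phi> y \<theta> \<le> \<Phi> w \<theta>"
    and F: "finite F" "F \<noteq> {}" "F \<subseteq> X"
    and "convex C"
    and "\<And>\<theta>. \<theta> \<in> C \<Longrightarrow> \<exists>x\<in>F. a \<le> \<Phi> x \<theta>"
  shows "\<exists>x\<in>X. \<forall>\<theta>\<in>C. a \<le> \<Phi> x \<theta>"
  using F assms(6,7)
proof (induction F arbitrary: C rule: finite_ne_induct)
  case (singleton x)
  then show ?case by auto
next
  case (insert x F)
  define C' where "C' = {\<theta>\<in>C. \<Phi> x \<theta> < a}"
  have x: "x \<in> X" using insert.prems by auto
  have le: "\<Phi> x (u *\<^sub>R \<theta> + v *\<^sub>R \<eta>) \<le> u * \<Phi> x \<theta> + v * \<Phi> x \<eta>" if "0 \<le> u" "0 \<le> v" "u + v = 1" for u v \<theta> \<eta>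
    using conv[OF x] that unfolding convex_on_def by auto
  have "convex C'"
  proof (rule convexI)
    fix \<theta> \<eta> and u v :: real assume *: "\<theta> \<in> C'" "\<eta> \<in> C'" "0 \<le> u" "0 \<le> v" "u + v = 1"
    have "\<Phi> x (u *\<^sub>R \<theta> + v *\<^sub>R \<eta>) \<le> u * \<Phi> x \<theta> + v * \<Phi> x \<eta>" using le * by blast
    also have "\<dots> < a" using * unfolding C'_def by (intro convex_bound_lt) auto
    finally show "u *\<^sub>R \<theta> + v *\<^sub>R \<eta> \<in> C'"
      using * convexD[OF insert.prems(2)] by (auto simp: C'_def)
  qed
  moreover have "\<exists>y\<in>F. a \<le> \<Phi> y \<theta>" if "\<theta> \<in> C'" for \<theta>
    using that insert.prems(3)[of \<theta>] by (auto simp: C'_def)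
  ultimately obtain y where y: "y \<in> X" "\<forall>\<theta>\<in>C'. a \<le> \<Phi> y \<theta>" using insert by blast
  have "\<exists>w\<in>C. \<Phi> x w - a \<le> t * (\<Phi> x \<theta> - a) + (1 - t) * (\<Phi> x \<eta> - a) \<and>
      \<Phi> y w - a \<le> t * (\<Phi> y \<theta> - a) + (1 - t) * (\<Phi> y \<eta> - a)"
    if "\<theta> \<in> C" "\<eta> \<in> C" "0 \<le> t" "t \<le> 1" for \<theta> \<eta> and t :: real
  proof (intro bexI conjI)
    have e: "t * (r - a) + (1 - t) * (s - a) = t * r + (1 - t) * s - a" for r s :: real by (simp add: algebra_simps)
    show "t *\<^sub>R \<theta> + (1 - t) *\<^sub>R \<eta> \<in> C" using that insert.prems(2) by (simp add: convexD)
    show "\<Phi> x (t *\<^sub>R \<theta> + (1 - t) *\<^sub>R \<eta>) - a \<le> t * (\<Phi> x \<theta> - a) + (1 - t) * (\<Phi> x \<eta> - a)"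
      unfolding e using le that by auto
    show "\<Phi> y (t *\<^sub>R \<theta> + (1 - t) *\<^sub>R \<eta>) - a \<le> t * (\<Phi> y \<theta> - a) + (1 - t) * (\<Phi> y \<eta> - a)"
      unfolding e using conv[OF y(1)] that unfolding convex_on_def by auto
  qed
  moreover have "0 \<le> \<Phi> x \<theta> - a \<or> 0 \<le> \<Phi> y \<theta> - a" if "\<theta> \<in> C" for \<theta>
    using y that by (auto simp: C'_def)
  ultimately obtain t where t: "0 \<le> t" "t \<le> 1"
    "\<And>\<theta>. \<theta> \<in> C \<Longrightarrow> 0 \<le> t * (\<Phi> x \<theta> - a) + (1 - t) * (\<Phi> y \<theta> - a)"
    using convexlike_alternative[of C "\<lambda>\<theta>. \<Phi> x \<theta> - a" "\<lambda>\<theta>. \<Phi> y \<theta> - a"] by blast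
  obtain w where w: "w \<in> X" "\<forall>\<theta>. t * \<Phi> x \<theta> + (1 - t) * \<Phi> y \<theta> \<le> \<Phi> w \<theta>"
    using mix[OF x y(1) t(1,2)] by blast
  have "a \<le> \<Phi> w \<theta>" if "\<theta> \<in> C" for \<theta>
  proof -
    have "0 \<le> t * \<Phi> x \<theta> + (1 - t) * \<Phi> y \<theta> - a" using t(3)[OF that] by (simp add: algebra_simps)
    then show ?thesis using w(2) by (smt (verit))
  qed
  then show ?case using w(1) by blast
qed

text \<open>A ball reduces the problem to finitely many indices: some exceed b on its sphere, others
  exceed a inside. Beyond it, a segment from \<open>\<theta>0\<close> crosses the sphere, and
  convexity forces one of the sphere indices to exceed b, which is larger than a.\<close>

lemma minimax_bounded_sublevel:
  fixes \<Phi> :: "'x \<Rightarrow> 'a::euclidean_space \<Rightarrow> real"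
  assumes T: "convex T" "closed T"
    and conv: "\<And>x. x \<in> X \<Longrightarrow> convex_on UNIV (\<Phi> x)"
    and mix: "\<And>x y t. x \<in> X \<Longrightarrow> y \<in> X \<Longrightarrow> 0 \<le> t \<Longrightarrow> t \<le> 1 \<Longrightarrow>
      \<exists>w\<in>X. \<forall>\<theta>. t * \<Phi> x \<theta> + (1 - t) * \<Phi> y \<theta> \<le> \<Phi> w \<theta>"
    and \<theta>0: "\<theta>0 \<in> T" "\<And>x. x \<in> X \<Longrightarrow> \<Phi> x \<theta>0 \<le> b"
    and bdd: "bounded {\<theta>\<in>T. \<forall>x\<in>X. \<Phi> x \<theta> \<le> b}"
    and above: "\<And>\<theta>. \<theta> \<in> T \<Longrightarrow> \<exists>x\<in>X. a < \<Phi> x \<theta>"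
  obtains x where "x \<in> X" "\<And>\<theta>. \<theta> \<in> T \<Longrightarrow> a \<le> \<Phi> x \<theta>"
proof -
  obtain R where R: "\<forall>\<theta>\<in>{\<theta>\<in>T. \<forall>x\<in>X. \<Phi> x \<theta> \<le> b}. norm \<theta> < R"
    using bdd bounded_pos_less by blast
  have opn: "open {\<theta>. r < \<Phi> x \<theta>}" if "x \<in> X" for x r
    using convex_on_continuous[OF open_UNIV conv[OF that]] by (intro open_Collect_less) auto
  have n0: "norm \<theta>0 < R" using R \<theta>0 by auto
  have "sphere 0 R \<inter> T \<subseteq> (\<Union>x\<in>X. {\<theta>. b < \<Phi> x \<theta>})"
    using R by (fastforce simp: not_le)
  then obtain F1 where F1: "F1 \<subseteq> X" "finite F1" "sphere 0 R \<inter> T \<subseteq> (\<Union>x\<in>F1. {\<theta>. b < \<Phi> x \<theta>})"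
    using compactE_image[of "sphere 0 R \<inter> T" X "\<lambda>x. {\<theta>. b < \<Phi> x \<theta>}"] opn T(2)
    by (auto simp: compact_Int_closed)
  have "cball 0 R \<inter> T \<subseteq> (\<Union>x\<in>X. {\<theta>. a < \<Phi> x \<theta>})" using above by auto
  then obtain F2 where F2: "F2 \<subseteq> X" "finite F2" "cball 0 R \<inter> T \<subseteq> (\<Union>x\<in>F2. {\<theta>. a < \<Phi> x \<theta>})"
    using compactE_image[of "cball 0 R \<inter> T" X "\<lambda>x. {\<theta>. a < \<Phi> x \<theta>}"] opn T(2)
    by (auto simp: compact_Int_closed)
  define F where "F = F1 \<union> F2"
  have ab: "a < b" using above[OF \<theta>0(1)] \<theta>0(2) by fastforce
  have cover: "\<exists>x\<in>F. a \<le> \<Phi> x \<theta>" if \<theta>: "\<theta> \<in> T" for \<theta>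
  proof (rule ccontr)
    assume "\<not> ?thesis"
    then have less: "\<Phi> x \<theta> < a" if "x \<in> F" for x using that by (auto simp: not_le)
    have nR: "norm \<theta> > R"
    proof (rule ccontr)
      assume "\<not> norm \<theta> > R"
      then have "\<theta> \<in> cball 0 R \<inter> T" using \<theta> by auto
      then obtain x where "x \<in> F2" "a < \<Phi> x \<theta>" using F2(3) by auto
      then show False using less[of x] by (auto simp: F_def)
    qed
    have "continuous_on {0..1} (\<lambda>u. norm ((1 - u) *\<^sub>R \<theta>0 + u *\<^sub>R \<theta>))"
      by (intro continuous_intros)
    then obtain u where u: "0 \<le> u" "u \<le> 1" "norm ((1 - u) *\<^sub>R \<theta>0 + u *\<^sub>R \<theta>) = R"
      using IVT'[of "\<lambda>u. norm ((1 - u) *\<^sub>R \<theta>0 + u *\<^sub>R \<theta>)" 0 R 1] n0 nR by auto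
    define \<eta> where "\<eta> = (1 - u) *\<^sub>R \<theta>0 + u *\<^sub>R \<theta>"
    have "\<eta> \<in> T" unfolding \<eta>_def using u \<theta>0(1) \<theta> T(1) by (simp add: convexD)
    then have "\<eta> \<in> sphere 0 R \<inter> T" using u(3) by (simp add: \<eta>_def)
    then obtain x where x: "x \<in> F1" "b < \<Phi> x \<eta>" using F1(3) by auto
    then have xX: "x \<in> X" using F1 by auto
    have "\<Phi> x \<eta> \<le> (1 - u) * \<Phi> x \<theta>0 + u * \<Phi> x \<theta>"
      using conv[OF xX] u unfolding convex_on_def \<eta>_def by auto
    also have "\<dots> \<le> b" using \<theta>0(2)[OF xX] less[of x] ab x u by (intro convex_bound_le) (auto simp: F_def)
    finally show False using x by simp
  qed
  have "F \<noteq> {}" using cover[OF \<theta>0(1)] by auto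
  then have "\<exists>x\<in>X. \<forall>\<theta>\<in>T. a \<le> \<Phi> x \<theta>"
    using F1 F2 cover T conv mix
    by (intro concavelike_finite_dominate[where F=F]) (auto simp: F_def)
  then show thesis using that by blast
qed

section \<open>Multipliers for affine functions\<close>

definition affine_real :: "('a::real_inner \<Rightarrow> real) \<Rightarrow> bool" where
  "affine_real h \<longleftrightarrow> (\<exists>a b. \<forall>x. h x = a \<bullet> x + b)"

lemma affine_realI: "(\<And>x. h x = a \<bullet> x + b) \<Longrightarrow> affine_real h"
  unfolding affine_real_def by blast

lemma affine_real_const: "affine_real (\<lambda>x. r)"
  by (rule affine_realI[of _ 0 r]) simp

lemma affine_real_inner: "affine_real (\<lambda>x. a \<bullet> x)"
  by (rule affine_realI[of _ a 0]) simp

lemma affine_real_add: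
  assumes "affine_real h" "affine_real k"
  shows "affine_real (\<lambda>x. h x + k x)"
proof -
  from assms obtain a b a' b' where "\<And>x. h x = a \<bullet> x + b" "\<And>x. k x = a' \<bullet> x + b'"
    unfolding affine_real_def by blast
  then show ?thesis by (intro affine_realI[of _ "a + a'" "b + b'"]) (simp add: inner_add_left)
qed

lemma affine_real_cmult:
  assumes "affine_real h"
  shows "affine_real (\<lambda>x. r * h x)"
proof -
  from assms obtain a b where "\<And>x. h x = a \<bullet> x + b"
    unfolding affine_real_def by blast
  then show ?thesis by (intro affine_realI[of _ "r *\<^sub>R a" "r * b"]) (simp add: distrib_left)
qed

lemma affine_real_uminus: "affine_real h \<Longrightarrow> affine_real (\<lambda>x. - h x)"
  using affine_real_cmult[of h "-1"] by simp

lemma affine_real_diff: "affine_real h \<Longrightarrow> affine_real k \<Longrightarrow> affine_real (\<lambda>x. h x - k x)"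
  using affine_real_add[OF _ affine_real_uminus, of h k] by simp

lemma affine_real_sum:
  assumes "\<And>r. r \<in> F \<Longrightarrow> affine_real (h r)"
  shows "affine_real (\<lambda>x. \<Sum>r\<in>F. h r x)"
  using assms by (induction F rule: infinite_finite_induct) (auto intro: affine_real_const affine_real_add)

lemma affine_real_comb:
  assumes "affine_real h" "s + t = 1"
  shows "h (s *\<^sub>R x + t *\<^sub>R y) = s * h x + t * h y"
proof -
  from assms(1) obtain a b where h: "\<And>x. h x = a \<bullet> x + b"
    unfolding affine_real_def by blast
  have "b = s * b + t * b" using assms(2) by (metis distrib_right mult_1)
  then show ?thesis unfolding h by (simp add: inner_add_right algebra_simps)
qed

lemma affine_real_convex_on:
  assumes "affine_real h" "convex S" shows "convex_on S h"
  using assms unfolding convex_on_def by (auto simp: affine_real_comb)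

lemma convex_affine_real_le:
  assumes "affine_real h" shows "convex {x. h x \<le> 0}"
proof (rule convexI)
  fix x y and u v :: real assume *: "x \<in> {x. h x \<le> 0}" "y \<in> {x. h x \<le> 0}" "0 \<le> u" "0 \<le> v" "u + v = 1"
  then have "u * h x \<le> 0" "v * h y \<le> 0" by (auto intro: mult_nonneg_nonpos)
  then show "u *\<^sub>R x + v *\<^sub>R y \<in> {x. h x \<le> 0}"
    using * affine_real_comb[OF assms] by auto
qed

text \<open>A segment of D ending at a relative interior point can be prolonged beyond it; a
  positive value at x would make h negative there.\<close>

lemma affine_real_zero_on:
  fixes D :: "'a::euclidean_space set"
  assumes "convex D" "\<theta> \<in> rel_interior D" "affine_real h" "\<And>x. x \<in> D \<Longrightarrow> 0 \<le> h x" "h \<theta> \<le> 0" "x \<in> D"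
  shows "h x = 0"
proof -
  obtain e where e: "e > 1" "(1 - e) *\<^sub>R x + e *\<^sub>R \<theta> \<in> D"
    using assms convex_rel_interior_iff[of D \<theta>] by auto
  have "0 \<le> (1 - e) * h x + e * h \<theta>"
    using assms(4)[OF e(2)] affine_real_comb[OF assms(3)] by simp
  then have "(e - 1) * h x \<le> e * h \<theta>" by (simp add: algebra_simps)
  also have "\<dots> \<le> 0" using e assms(5) by (simp add: mult_nonneg_nonpos)
  finally show ?thesis using e assms(4)[OF assms(6)] by (auto simp: mult_le_0_iff)
qed

lemma rel_interior_Int_affine_level:
  fixes D :: "'a::euclidean_space set"
  assumes "convex D" "\<theta> \<in> rel_interior D" "affine_real h" "h \<theta> = 0"
  shows "convex (D \<inter> {x. h x = 0})" "\<theta> \<in> rel_interior (D \<inter> {x. h x = 0})"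
proof -
  have "convex {x. h x = 0}"
    by (rule convexI) (simp add: affine_real_comb[OF assms(3)])
  then show c: "convex (D \<inter> {x. h x = 0})" by (rule convex_Int[OF assms(1)])
  have \<theta>: "\<theta> \<in> D" using assms(2) rel_interior_subset by auto
  show "\<theta> \<in> rel_interior (D \<inter> {x. h x = 0})"

  proof -
    have ne: "D \<inter> {x. h x = 0} \<noteq> {}" using \<theta> assms(4) by auto
    have "\<exists>e>1. (1 - e) *\<^sub>R x + e *\<^sub>R \<theta> \<in> D \<inter> {x. h x = 0}" if x: "x \<in> D \<inter> {x. h x = 0}" for x
    proof -
      obtain e where "e > 1" "(1 - e) *\<^sub>R x + e *\<^sub>R \<theta> \<in> D"
        using x assms(2) convex_rel_interior_iff[OF assms(1), of \<theta>] by blast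
      then show ?thesis using x assms(4) affine_real_comb[OF assms(3), of "1 - e" e x \<theta>] by auto
    qed
    then show ?thesis using convex_rel_interior_iff[OF c ne] by blast
  qed
qed

text \<open>The multiplier of an equality constraint, hence of either sign. A segment joining the
  two sides of the hyperplane crosses it where \<beta> is at most 0, which orders the ratios
  \<open>\<beta> / h\<close> on the two sides.\<close>

lemma hyperplane_multiplier:
  fixes D :: "'a::euclidean_space set"
  assumes "convex D" "\<theta> \<in> rel_interior D" "affine_real h" "h \<theta> = 0" "affine_real \<beta>"
    and le: "\<And>x. x \<in> D \<Longrightarrow> h x = 0 \<Longrightarrow> \<beta> x \<le> 0"
  obtains \<mu> where "\<And>x. x \<in> D \<Longrightarrow> \<beta> x \<le> \<mu> * h x"
proof -
  consider "\<forall>x\<in>D. 0 \<le> h x" | "\<forall>x\<in>D. h x \<le> 0" | x0 y0 where "x0 \<in> D" "h x0 < 0" "y0 \<in> D" "0 < h y0"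
    by (meson not_le)
  then show thesis
  proof cases
    \<comment> \<open>If D lies on one side, the relative interior point on the hyperplane forces
      all of D into it.\<close>
    case 1
    then have "h x = 0" if "x \<in> D" for x
      by (intro affine_real_zero_on[OF assms(1-3) _ _ that]) (auto simp: assms(4))
    then show thesis using le that[of 0] by auto
  next
    case 2
    then have "- h x = 0" if "x \<in> D" for x
      by (intro affine_real_zero_on[OF assms(1-2) affine_real_uminus[OF assms(3)] _ _ that]) (auto simp: assms(4))
    then show thesis using le that[of 0] by auto
  next
    case 3
    define P N where "P = {y\<in>D. 0 < h y}" and "N = {x\<in>D. h x < 0}"
    have key: "\<beta> y / h y \<le> \<beta> x / h x" if "y \<in> P" "x \<in> N" for x y
    proof -
      have h: "h x < 0" "0 < h y" "x \<in> D" "y \<in> D" using that by (auto simp: P_def N_def)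
      define s t where "s = h y / (h y - h x)" and "t = - h x / (h y - h x)"
      have d: "h y - h x > 0" using h by linarith
      have st: "0 \<le> s" "0 \<le> t" "s + t = 1"
        unfolding s_def t_def using h d by (simp_all add: divide_nonpos_pos flip: add_divide_distrib diff_divide_distrib)
      have "h (s *\<^sub>R x + t *\<^sub>R y) = s * h x + t * h y" by (rule affine_real_comb[OF assms(3) st(3)])
      also have "\<dots> = 0" unfolding s_def t_def using d by (simp add: field_simps)
      finally have "\<beta> (s *\<^sub>R x + t *\<^sub>R y) \<le> 0"
        using le convexD[OF assms(1) h(3,4) st] by blast
      then have "s * \<beta> x + t * \<beta> y \<le> 0" using affine_real_comb[OF assms(5) st(3)] by simp
      then have "h y * \<beta> x + - h x * \<beta> y \<le> 0" unfolding s_def t_def using d by (simp add: divide_simps split: if_splits)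
      then show ?thesis using h by (simp add: divide_simps mult.commute)
    qed
    define \<mu> where "\<mu> = (SUP y\<in>P. \<beta> y / h y)"
    have PN: "y0 \<in> P" "x0 \<in> N" using 3 by (auto simp: P_def N_def)
    have bdd: "bdd_above ((\<lambda>y. \<beta> y / h y) ` P)" using key PN by (auto intro!: bdd_aboveI2)
    show thesis
    proof (rule that[of \<mu>])
      fix x assume x: "x \<in> D"
      consider "h x = 0" | "x \<in> P" | "x \<in> N" using x by (force simp: P_def N_def)
      then show "\<beta> x \<le> \<mu> * h x"
      proof cases
        case 1 then show ?thesis using le x by auto
      next
        case 2
        then have "\<beta> x / h x \<le> \<mu>" unfolding \<mu>_def by (rule cSUP_upper[OF _ bdd])
        then show ?thesis using 2 by (simp add: P_def field_simps)
      next
        case 3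
        have "\<mu> \<le> \<beta> x / h x" unfolding \<mu>_def using PN 3 key by (intro cSUP_least) auto
        then show ?thesis using 3 by (simp add: N_def field_simps)
      qed
    qed
  qed
qed

text \<open>Farkas' lemma relative to a convex set. The constraints may be active at \<theta>, so
  the alternative can give \<beta> weight 0; the constraint in question is then an implicit equality
  and is traded for the hyperplane on which it vanishes.\<close>

lemma halfspace_multipliers:
  fixes D :: "'a::euclidean_space set"
  assumes "finite F" "convex D" "\<theta> \<in> rel_interior D"
    and "\<And>r. r \<in> F \<Longrightarrow> affine_real (h r)" "\<And>r. r \<in> F \<Longrightarrow> h r \<theta> \<le> 0"
    and "affine_real \<beta>"
    and "\<And>x. x \<in> D \<Longrightarrow> (\<And>r. r \<in> F \<Longrightarrow> h r x \<le> 0) \<Longrightarrow> \<beta> x \<le> 0"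
  shows "\<exists>\<nu>. (\<forall>r\<in>F. 0 \<le> \<nu> r) \<and> (\<forall>x\<in>D. \<beta> x \<le> (\<Sum>r\<in>F. \<nu> r * h r x))"
  using assms
proof (induction F arbitrary: D \<beta> rule: finite_induct)
  case empty
  then show ?case by auto
next
  case (insert r F)
  have affF: "affine_real (h s)" "h s \<theta> \<le> 0" if "s \<in> F" for s using insert.prems that by auto
  have hr: "affine_real (h r)" "h r \<theta> \<le> 0" using insert.prems by auto
  have \<theta>D: "\<theta> \<in> D" using insert.prems(2) rel_interior_subset by auto
  have upd: "\<exists>\<nu>. (\<forall>s\<in>insert r F. 0 \<le> \<nu> s) \<and> (\<forall>x\<in>D. \<beta> x \<le> (\<Sum>s\<in>insert r F. \<nu> s * h s x))"
    if "\<forall>s\<in>F. 0 \<le> \<nu> s" "0 \<le> m" "\<And>x. x \<in> D \<Longrightarrow> \<beta> x \<le> m * h r x + (\<Sum>s\<in>F. \<nu> s * h s x)" for \<nu> m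
  proof -
    have "(\<Sum>s\<in>insert r F. (\<nu>(r := m)) s * h s x) = m * h r x + (\<Sum>s\<in>F. \<nu> s * h s x)" for x
    proof -
      have "(\<Sum>s\<in>F. (\<nu>(r := m)) s * h s x) = (\<Sum>s\<in>F. \<nu> s * h s x)"
        using insert.hyps by (intro sum.cong) auto
      then show ?thesis using insert.hyps by (subst sum.insert) auto
    qed
    then show ?thesis using that by (intro exI[of _ "\<nu>(r := m)"]) auto
  qed
  define D1 where "D1 = {x\<in>D. \<forall>s\<in>F. h s x \<le> 0}"
  have "D1 = D \<inter> (\<Inter>s\<in>F. {x. h s x \<le> 0})" by (auto simp: D1_def)
  then have cD1: "convex D1"
    using insert.prems(1) affF by (auto intro!: convex_Int convex_INT convex_affine_real_le)
  have \<theta>D1: "\<theta> \<in> D1" using \<theta>D affF by (auto simp: D1_def)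
  have "\<exists>w\<in>D1. - \<beta> w \<le> t * - \<beta> x + (1 - t) * - \<beta> y \<and> h r w \<le> t * h r x + (1 - t) * h r y"
    if "x \<in> D1" "y \<in> D1" "0 \<le> t" "t \<le> 1" for x y t
    using that convexD[OF cD1, of x y t "1 - t"] affine_real_comb[OF hr(1), of t "1 - t" x y]
      affine_real_comb[OF insert.prems(5), of t "1 - t" x y]
    by (intro bexI[of _ "t *\<^sub>R x + (1 - t) *\<^sub>R y"]) auto
  moreover have "0 \<le> - \<beta> x \<or> 0 \<le> h r x" if "x \<in> D1" for x
    using insert.prems(6)[of x] that unfolding D1_def by force
  ultimately obtain t where t: "0 \<le> t" "t \<le> 1" "\<And>x. x \<in> D1 \<Longrightarrow> 0 \<le> t * - \<beta> x + (1 - t) * h r x"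
    using convexlike_alternative[of D1 "\<lambda>x. - \<beta> x" "h r"] by blast
  show ?case
  proof (cases "t > 0")
    case True
    define m where "m = (1 - t) / t"
    have m: "0 \<le> m" using t True by (simp add: m_def)
    have "\<beta> x - m * h r x \<le> 0" if "x \<in> D" "\<And>s. s \<in> F \<Longrightarrow> h s x \<le> 0" for x
      using t(3)[of x] that True by (auto simp: D1_def m_def field_simps)
    moreover have "affine_real (\<lambda>x. \<beta> x - m * h r x)"
      by (intro affine_real_diff affine_real_cmult insert.prems hr)
    ultimately obtain \<nu> where \<nu>: "\<forall>s\<in>F. 0 \<le> \<nu> s" "\<forall>x\<in>D. \<beta> x - m * h r x \<le> (\<Sum>s\<in>F. \<nu> s * h s x)"
      using insert.IH[of D "\<lambda>x. \<beta> x - m * h r x"] insert.prems(1,2) affF by blast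
    have "\<beta> x \<le> m * h r x + (\<Sum>s\<in>F. \<nu> s * h s x)" if "x \<in> D" for x
      using \<nu>(2) that by (simp add: algebra_simps)
    then show ?thesis using upd \<nu>(1) m by blast
  next
    case False
    \<comment> \<open>Here \<open>h r\<close> is nonnegative wherever the other constraints hold, so
      together with its own constraint it is an equality, and \<theta> lies on it.\<close>
    then have "t = 0" using t by simp
    then have hr0: "0 \<le> h r x" if "x \<in> D1" for x using t(3) that by auto
    have hr\<theta>: "h r \<theta> = 0" using hr0[OF \<theta>D1] hr(2) by auto
    have "- h r x \<le> 0" if "x \<in> D" "\<And>s. s \<in> F \<Longrightarrow> h s x \<le> 0" for x
      using hr0[of x] that by (auto simp: D1_def)
    then obtain \<nu> where \<nu>: "\<forall>s\<in>F. 0 \<le> \<nu> s" "\<forall>x\<in>D. - h r x \<le> (\<Sum>s\<in>F. \<nu> s * h s x)"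
      using insert.IH[of D "\<lambda>x. - h r x"] insert.prems(1,2) affF affine_real_uminus[OF hr(1)] by blast
    \<comment> \<open>The combination is nonnegative on D by the choice of \<nu> and at most 0 at
      the relative interior point, so it vanishes on D.\<close>
    have eq: "h r x + (\<Sum>s\<in>F. \<nu> s * h s x) = 0" if "x \<in> D" for x
    proof (rule affine_real_zero_on[OF insert.prems(1,2)])
      show "affine_real (\<lambda>x. h r x + (\<Sum>s\<in>F. \<nu> s * h s x))"
        by (intro affine_real_add affine_real_sum affine_real_cmult hr affF)
      show "0 \<le> h r x + (\<Sum>s\<in>F. \<nu> s * h s x)" if "x \<in> D" for x
        using \<nu>(2)[rule_format, OF that] by linarith
      have "(\<Sum>s\<in>F. \<nu> s * h s \<theta>) \<le> 0"
        using \<nu>(1) affF by (intro sum_nonpos mult_nonneg_nonpos) auto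
      then show "h r \<theta> + (\<Sum>s\<in>F. \<nu> s * h s \<theta>) \<le> 0" using hr by simp
    qed fact
    define D2 where "D2 = D \<inter> {x. h r x = 0}"
    have D2: "convex D2" "\<theta> \<in> rel_interior D2"
      unfolding D2_def using rel_interior_Int_affine_level[OF insert.prems(1,2) hr(1) hr\<theta>] by auto
    have "\<beta> x \<le> 0" if "x \<in> D2" "\<And>s. s \<in> F \<Longrightarrow> h s x \<le> 0" for x
      using insert.prems(6)[of x] that unfolding D2_def by force
    then obtain \<nu>' where \<nu>': "\<forall>s\<in>F. 0 \<le> \<nu>' s" "\<forall>x\<in>D2. \<beta> x \<le> (\<Sum>s\<in>F. \<nu>' s * h s x)"
      using insert.IH[of D2 \<beta>] D2 affF insert.prems(5) by blast
    have "affine_real (\<lambda>x. \<beta> x - (\<Sum>s\<in>F. \<nu>' s * h s x))"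
      by (intro affine_real_diff affine_real_sum affine_real_cmult affF insert.prems)
    then obtain m where m: "\<And>x. x \<in> D \<Longrightarrow> \<beta> x - (\<Sum>s\<in>F. \<nu>' s * h s x) \<le> m * h r x"
      using hyperplane_multiplier[OF insert.prems(1,2) hr(1) hr\<theta>, of "\<lambda>x. \<beta> x - (\<Sum>s\<in>F. \<nu>' s * h s x)"] \<nu>'(2)
      by (auto simp: D2_def)
    show ?thesis
    proof (cases "0 \<le> m")
      case True
      have "\<beta> x \<le> m * h r x + (\<Sum>s\<in>F. \<nu>' s * h s x)" if "x \<in> D" for x
        using m[OF that] by simp
      then show ?thesis using upd \<nu>'(1) True by blast
    next
      case False
      \<comment> \<open>A negative multiplier of \<open>h r\<close> is inadmissible, but
        \<open>eq\<close> expresses \<open>h r\<close> through the other constraints with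
        coefficients \<open>- \<nu> s\<close>, so its weight moves onto them with the right
        sign.\<close>
      have "\<beta> x \<le> 0 * h r x + (\<Sum>s\<in>F. (\<nu>' s + (- m) * \<nu> s) * h s x)" if "x \<in> D" for x
      proof -
        have "h r x = - (\<Sum>s\<in>F. \<nu> s * h s x)" using eq[OF that] by simp
        then have "m * h r x = (\<Sum>s\<in>F. (- m) * \<nu> s * h s x)"
          by (simp add: sum_distrib_left mult.assoc sum_negf)
        then show ?thesis using m[OF that] by (simp add: algebra_simps sum.distrib sum_subtractf sum_negf)
      qed
      moreover have "\<forall>s\<in>F. 0 \<le> \<nu>' s + (- m) * \<nu> s"
        using \<nu>(1) \<nu>'(1) False by (intro ballI add_nonneg_nonneg mult_nonneg_nonneg) auto
      ultimately show ?thesis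
        by (intro upd[where m=0 and \<nu>="\<lambda>s. \<nu>' s + (- m) * \<nu> s"]) simp_all
    qed
  qed
qed

text \<open>The diagonal of \<open>C \<times> D\<close> is cut out by finitely many halfspaces whose boundaries contain the
  common relative interior point, so their multipliers exist and assemble to a separating vector.\<close>

lemma affine_real_split_Int:
  fixes C D :: "'a::euclidean_space set"
  assumes C: "convex C" "\<theta> \<in> rel_interior C" and D: "convex D" "\<theta> \<in> rel_interior D"
    and \<beta>: "affine_real \<beta>" "\<And>x. x \<in> C \<inter> D \<Longrightarrow> \<beta> x \<le> 0"
  obtains a where "affine_real a" "\<And>x. x \<in> C \<Longrightarrow> \<beta> x \<le> a x" "\<And>x. x \<in> D \<Longrightarrow> a x \<le> 0"
proof -
  define F :: "('a \<times> real) set" where "F = Basis \<times> {1, -1}"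
  define h where "h = (\<lambda>(e, s::real) (x, y). s * (e \<bullet> x - e \<bullet> (y::'a)))"
  obtain b0 b1 where b: "\<And>x. \<beta> x = b0 \<bullet> x + b1" using \<beta>(1) unfolding affine_real_def by blast
  have "\<exists>\<nu>. (\<forall>r\<in>F. 0 \<le> \<nu> r) \<and> (\<forall>x\<in>C \<times> D. \<beta> (fst x) \<le> (\<Sum>r\<in>F. \<nu> r * h r x))"
  proof (rule halfspace_multipliers)
    show "finite F" by (simp add: F_def)
    show "convex (C \<times> D)" using C D by (intro convex_Times)
    show "(\<theta>, \<theta>) \<in> rel_interior (C \<times> D)" using C D by (simp add: rel_interior_Times)
    show "affine_real (h r)" for r
      by (rule affine_realI[of _ "snd r *\<^sub>R (fst r, - fst r)" 0])
        (auto simp: h_def split: prod.split simp: algebra_simps)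
    show "h r (\<theta>, \<theta>) \<le> 0" for r by (simp add: h_def split: prod.split)
    show "affine_real (\<lambda>x. \<beta> (fst x))"
      by (rule affine_realI[of _ "(b0, 0)" b1]) (simp add: b inner_prod_def)
    fix x assume x: "x \<in> C \<times> D" "\<And>r. r \<in> F \<Longrightarrow> h r x \<le> 0"
    obtain y z where yz: "x = (y, z)" by (cases x)
    have "e \<bullet> y = e \<bullet> z" if "e \<in> Basis" for e
      using x(2)[of "(e, 1)"] x(2)[of "(e, -1)"] that by (auto simp: F_def h_def yz)
    then have "y = z" by (metis euclidean_eqI inner_commute)
    then show "\<beta> (fst x) \<le> 0" using x(1) \<beta>(2) by (auto simp: yz)
  qed
  then obtain \<nu> where \<nu>: "\<And>x y. x \<in> C \<Longrightarrow> y \<in> D \<Longrightarrow> \<beta> x \<le> (\<Sum>r\<in>F. \<nu> r * h r (x, y))" by fastforce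
  define w where "w = (\<Sum>r\<in>F. (\<nu> r * snd r) *\<^sub>R fst r)"
  have w: "(\<Sum>r\<in>F. \<nu> r * h r (x, y)) = w \<bullet> x - w \<bullet> y" for x y
  proof -
    have "(\<Sum>r\<in>F. \<nu> r * h r (x, y)) = (\<Sum>r\<in>F. \<nu> r * snd r * (fst r \<bullet> x) - \<nu> r * snd r * (fst r \<bullet> y))"
      by (intro sum.cong refl) (auto simp: h_def algebra_simps split: prod.split)
    then show ?thesis by (simp add: w_def inner_sum_left sum_subtractf)
  qed
  have le: "\<beta> x - w \<bullet> x \<le> - (w \<bullet> y)" if "x \<in> C" "y \<in> D" for x y
    using \<nu>[OF that] unfolding w by linarith
  \<comment> \<open>\<open>\<beta> x - w \<bullet> x\<close> on C lies below
    \<open>- (w \<bullet> y)\<close> on D; every constant in between separates, and this is the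
    smallest.\<close>
  define k where "k = (SUP x\<in>C. \<beta> x - w \<bullet> x)"
  have \<theta>: "\<theta> \<in> C" "\<theta> \<in> D" using C D rel_interior_subset by auto
  have bdd: "bdd_above ((\<lambda>x. \<beta> x - w \<bullet> x) ` C)" using le \<theta> by (auto intro!: bdd_aboveI2)
  show thesis
  proof (rule that[of "\<lambda>x. w \<bullet> x + k"])
    show "affine_real (\<lambda>x. w \<bullet> x + k)" by (rule affine_realI) simp
    show "\<beta> x \<le> w \<bullet> x + k" if "x \<in> C" for x
      using cSUP_upper[OF that bdd] unfolding k_def by linarith
    show "w \<bullet> x + k \<le> 0" if "x \<in> D" for x
    proof -
      have "k \<le> - (w \<bullet> x)" unfolding k_def using \<theta> le that by (intro cSUP_least) auto
      then show ?thesis by linarith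
    qed
  qed
qed

lemma rel_interior_INT_finite:
  fixes C :: "'i \<Rightarrow> 'a::euclidean_space set"
  assumes "finite F" "\<And>l. l \<in> F \<Longrightarrow> convex (C l)" "\<And>l. l \<in> F \<Longrightarrow> \<theta> \<in> rel_interior (C l)"
  shows "\<theta> \<in> rel_interior (\<Inter>l\<in>F. C l)"
  using assms
proof (induction F rule: finite_induct)
  case (insert k F)
  have "convex (C k)" "\<theta> \<in> rel_interior (C k)" "convex (\<Inter>l\<in>F. C l)" "\<theta> \<in> rel_interior (\<Inter>l\<in>F. C l)"
    using insert by (auto intro!: convex_INT)
  then show ?case using convex_rel_interior_inter_two[of "C k" "\<Inter>l\<in>F. C l"] by auto
qed simp

lemma sum_insert_fun_upd:
  assumes "finite F" "l \<notin> F"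
  shows "(\<Sum>k\<in>insert l F. (a(l := b)) k x) = b x + (\<Sum>k\<in>F. a k x)"
proof -
  have "(\<Sum>k\<in>F. (a(l := b)) k x) = (\<Sum>k\<in>F. a k x)"
    using assms by (intro sum.cong) auto
  then show ?thesis using assms by simp
qed

text \<open>One set is split off at a time: \<open>a'\<close> lies above \<beta> on the intersection
  of the other sets and is at most 0 on \<open>C l\<close>, so \<open>\<beta> - a'\<close> satisfies
  the hypothesis for the others. After the last split nothing restricts x, hence a bound on the
  whole space.\<close>

lemma affine_real_split_INT:
  fixes C :: "'i \<Rightarrow> 'a::euclidean_space set"
  assumes "finite F" "\<And>l. l \<in> F \<Longrightarrow> convex (C l)" "\<And>l. l \<in> F \<Longrightarrow> \<theta> \<in> rel_interior (C l)"
    and "affine_real \<beta>" "\<And>x. (\<And>l. l \<in> F \<Longrightarrow> x \<in> C l) \<Longrightarrow> \<beta> x \<le> 0"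
  shows "\<exists>a. (\<forall>l\<in>F. affine_real (a l) \<and> (\<forall>x\<in>C l. a l x \<le> 0)) \<and> (\<forall>x. \<beta> x \<le> (\<Sum>l\<in>F. a l x))"
  using assms
proof (induction F arbitrary: \<beta> rule: finite_induct)
  case empty
  then show ?case by auto
next
  case (insert l F)
  define D where "D = (\<Inter>l\<in>F. C l)"
  have D: "convex D" unfolding D_def using insert.prems by (intro convex_INT) auto
  have \<theta>D: "\<theta> \<in> rel_interior D"
    unfolding D_def using insert by (intro rel_interior_INT_finite) auto
  have "\<beta> x \<le> 0" if "x \<in> D \<inter> C l" for x using insert.prems(4)[of x] that by (auto simp: D_def)
  then obtain a' where a': "affine_real a'" "\<And>x. x \<in> D \<Longrightarrow> \<beta> x \<le> a' x" "\<And>x. x \<in> C l \<Longrightarrow> a' x \<le> 0"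
    using affine_real_split_Int[OF D \<theta>D, of "C l" \<beta>] insert.prems by auto
  have "\<exists>a. (\<forall>l\<in>F. affine_real (a l) \<and> (\<forall>x\<in>C l. a l x \<le> 0)) \<and> (\<forall>x. \<beta> x - a' x \<le> (\<Sum>l\<in>F. a l x))"
  proof (rule insert.IH)
    show "affine_real (\<lambda>x. \<beta> x - a' x)" by (intro affine_real_diff insert.prems a')
    show "\<beta> x - a' x \<le> 0" if "\<And>l. l \<in> F \<Longrightarrow> x \<in> C l" for x using a'(2)[of x] that by (auto simp: D_def)
  qed (use insert.prems in auto)
  then obtain a where a: "\<forall>l\<in>F. affine_real (a l) \<and> (\<forall>x\<in>C l. a l x \<le> 0)" "\<forall>x. \<beta> x - a' x \<le> (\<Sum>l\<in>F. a l x)"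
    by blast
  have "\<beta> x \<le> (\<Sum>k\<in>insert l F. (a(l := a')) k x)" for x
    unfolding sum_insert_fun_upd[OF insert.hyps(1,2)] using a(2)[rule_format, of x] by linarith
  then show ?case using a(1) a' by (intro exI[of _ "a(l := a')"]) auto
qed

section \<open>Sandwich and Lagrange multiplier theorems\<close>

text \<open>The strict epigraph of u is separated from the hypograph of h over C. Finiteness of u on
  the whole space rules out a vertical hyperplane, so C can be any nonempty convex set.\<close>

lemma convex_sandwich:
  fixes u :: "'a::euclidean_space \<Rightarrow> real"
  assumes u: "convex_on UNIV u" and h: "convex_on C (\<lambda>x. - h x)" and "C \<noteq> {}"
    and le: "\<And>x. x \<in> C \<Longrightarrow> h x \<le> u x"
  obtains a where "affine_real a" "\<And>x. a x \<le> u x" "\<And>x. x \<in> C \<Longrightarrow> h x \<le> a x"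
proof -
  define S where "S = {p. u (fst p) < snd p}"
  define T where "T = {p. fst p \<in> C \<and> snd p \<le> h (fst p)}"
  have C: "convex C" using h by (rule convex_on_imp_convex)
  have "convex S"
  proof (rule convexI)
    fix p q and s t :: real assume *: "p \<in> S" "q \<in> S" "0 \<le> s" "0 \<le> t" "s + t = 1"
    have "u (s *\<^sub>R fst p + t *\<^sub>R fst q) \<le> s * u (fst p) + t * u (fst q)"
      using u * unfolding convex_on_def by auto
    also have "\<dots> < s * snd p + t * snd q"
    proof (cases "s = 0")
      case True then show ?thesis using * by (simp add: S_def)
    next
      case False
      then have "s * u (fst p) < s * snd p" using * by (simp add: S_def)
      moreover have "t * u (fst q) \<le> t * snd q" using * by (simp add: S_def mult_left_mono)
      ultimately show ?thesis by linarith
    qed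
    finally show "s *\<^sub>R p + t *\<^sub>R q \<in> S" by (simp add: S_def)
  qed
  moreover have "convex T"
  proof (rule convexI)
    fix p q and s t :: real assume *: "p \<in> T" "q \<in> T" "0 \<le> s" "0 \<le> t" "s + t = 1"
    have "s * snd p + t * snd q \<le> s * h (fst p) + t * h (fst q)"
      using * by (intro add_mono mult_left_mono) (auto simp: T_def)
    also have "\<dots> \<le> h (s *\<^sub>R fst p + t *\<^sub>R fst q)"
      using h * unfolding convex_on_def T_def by fastforce
    finally show "s *\<^sub>R p + t *\<^sub>R q \<in> T" using * convexD[OF C] by (simp add: T_def)
  qed
  moreover obtain x0 where x0: "x0 \<in> C" using assms(3) by auto
  then have "(x0, h x0) \<in> T" by (simp add: T_def)
  moreover have "(x0, u x0 + 1) \<in> S" by (simp add: S_def)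
  moreover have "T \<inter> S = {}" using le by (fastforce simp: S_def T_def)
  ultimately obtain ab b where ab: "ab \<noteq> 0" "\<forall>p\<in>T. inner ab p \<le> b" "\<forall>p\<in>S. b \<le> inner ab p"
    using separating_hyperplane_sets[of T S] by blast
  obtain \<alpha> \<beta> where ab_eq: "ab = (\<alpha>, \<beta>)" by (cases ab)
  have T: "\<alpha> \<bullet> x + \<beta> * h x \<le> b" if "x \<in> C" for x
    using ab(2) that by (auto simp: ab_eq T_def)
  have S: "b \<le> \<alpha> \<bullet> x + \<beta> * t" if "u x < t" for x t
    using ab(3) that by (auto simp: ab_eq S_def)
  have "\<beta> > 0"
  proof (rule ccontr)
    assume "\<not> \<beta> > 0"
    consider "\<beta> = 0" | "\<beta> < 0" using \<open>\<not> \<beta> > 0\<close> by linarith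
    then show False
    proof cases
      case 1
      have *: "b \<le> \<alpha> \<bullet> x" for x using S[of x "u x + 1"] 1 by simp
      have "\<alpha> = 0"
      proof (rule ccontr)
        assume "\<alpha> \<noteq> 0"
        then have "\<alpha> \<bullet> (((b - 1) / (\<alpha> \<bullet> \<alpha>)) *\<^sub>R \<alpha>) = b - 1" by simp
        then show False using *[of "((b - 1) / (\<alpha> \<bullet> \<alpha>)) *\<^sub>R \<alpha>"] by linarith
      qed
      then show False using ab(1) 1 ab_eq by (simp add: zero_prod_def)
    next
      case 2
      \<comment> \<open>A point of S so high above \<open>x0\<close> that a negative vertical
        component would violate the separation.\<close>
      define t where "t = max (u x0 + 1) ((b - \<alpha> \<bullet> x0 - 1) / \<beta>)"
      have "\<beta> * t \<le> b - \<alpha> \<bullet> x0 - 1"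
        using 2 mult_left_mono_neg[of "(b - \<alpha> \<bullet> x0 - 1) / \<beta>" t \<beta>] by (simp add: t_def)
      moreover have "b \<le> \<alpha> \<bullet> x0 + \<beta> * t" by (rule S) (simp add: t_def)
      ultimately show False by linarith
    qed
  qed
  define a where "a x = (b - \<alpha> \<bullet> x) / \<beta>" for x
  show thesis
  proof (rule that[of a])
    show "affine_real a"
      by (rule affine_realI[of _ "(- 1 / \<beta>) *\<^sub>R \<alpha>" "b / \<beta>"]) (simp add: a_def diff_divide_distrib)
    show "a x \<le> u x" for x
    proof (rule dense_ge)
      fix t assume "u x < t"
      then show "a x \<le> t" using S[of x t] \<open>\<beta> > 0\<close> by (simp add: a_def field_simps)
    qed
    show "h x \<le> a x" if "x \<in> C" for x
      using T[OF that] \<open>\<beta> > 0\<close> by (simp add: a_def field_simps)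
  qed
qed

lemma convex_supergradient:
  fixes u :: "'a::euclidean_space \<Rightarrow> real"
  assumes "convex_on UNIV (\<lambda>x. - u x)"
  obtains s where "\<And>x. u x \<le> u z + s \<bullet> (x - z)"
proof -
  obtain a where a: "affine_real a" "\<And>x. a x \<le> - u x" "\<And>x. x \<in> {z} \<Longrightarrow> - u z \<le> a x"
    using convex_sandwich[of "\<lambda>x. - u x" "{z}" "\<lambda>x. - u z", OF assms] by (auto simp: convex_on_const)
  obtain v b where vb: "\<And>x. a x = v \<bullet> x + b" using a(1) unfolding affine_real_def by blast
  have "u x \<le> u z + (- v) \<bullet> (x - z)" for x
    using a(2)[of x] a(3)[of z] unfolding vb by (simp add: inner_diff_right)
  then show thesis using that by blast
qed

text \<open>An affine function is repeatedly sandwiched between h minus the other summands and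
  \<open>u i\<close>. Every summand needs a minorant of its own, because each slope becomes a
  variable \<open>\<alpha> i j\<close> of the dual program.\<close>

lemma convex_sum_split:
  fixes u :: "'i \<Rightarrow> 'a::euclidean_space \<Rightarrow> real"
  assumes "finite F" "\<And>i. i \<in> F \<Longrightarrow> convex_on UNIV (u i)" "convex_on C (\<lambda>x. - h x)" "C \<noteq> {}"
    and "\<And>x. x \<in> C \<Longrightarrow> h x \<le> (\<Sum>i\<in>F. u i x)"
  shows "\<exists>a. (\<forall>i\<in>F. affine_real (a i) \<and> (\<forall>x. a i x \<le> u i x)) \<and> (\<forall>x\<in>C. h x \<le> (\<Sum>i\<in>F. a i x))"
  using assms
proof (induction F arbitrary: h rule: finite_induct)
  case empty
  then show ?case by auto
next
  case (insert i F)
  have C: "convex C" using insert.prems(2) by (rule convex_on_imp_convex)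
  have cs: "convex_on C (\<lambda>x. \<Sum>i\<in>F. u i x)"
    using insert.hyps(1) insert.prems(1) C
    by (induction F rule: finite_induct)
      (auto intro!: convex_on_add intro: convex_on_subset simp: convex_on_const)
  have "convex_on C (\<lambda>x. - h x + (\<Sum>i\<in>F. u i x))"
    by (intro convex_on_add insert.prems cs)
  then have "convex_on C (\<lambda>x. - (h x - (\<Sum>i\<in>F. u i x)))" by (simp add: algebra_simps)
  moreover have "h x - (\<Sum>i\<in>F. u i x) \<le> u i x" if "x \<in> C" for x
    using insert.prems(4)[OF that] insert.hyps by simp
  moreover have ui: "convex_on UNIV (u i)" using insert.prems(1) by simp
  ultimately obtain a' where a': "affine_real a'" "\<And>x. a' x \<le> u i x" "\<And>x. x \<in> C \<Longrightarrow> h x - (\<Sum>i\<in>F. u i x) \<le> a' x"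
    using convex_sandwich[of "u i" C "\<lambda>x. h x - (\<Sum>i\<in>F. u i x)"] insert.prems(3) by blast
  have "convex_on C (\<lambda>x. - h x + a' x)"
    by (intro convex_on_add insert.prems affine_real_convex_on a' C)
  then have "convex_on C (\<lambda>x. - (h x - a' x))" by (simp add: algebra_simps)
  then have "\<exists>a. (\<forall>i\<in>F. affine_real (a i) \<and> (\<forall>x. a i x \<le> u i x)) \<and> (\<forall>x\<in>C. h x - a' x \<le> (\<Sum>i\<in>F. a i x))"
    using insert.prems a'(3) by (intro insert.IH) (auto simp: algebra_simps)
  then obtain a where a: "\<forall>i\<in>F. affine_real (a i) \<and> (\<forall>x. a i x \<le> u i x)" "\<forall>x\<in>C. h x - a' x \<le> (\<Sum>i\<in>F. a i x)"
    by blast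
  have "h x \<le> (\<Sum>k\<in>insert i F. (a(i := a')) k x)" if "x \<in> C" for x
    unfolding sum_insert_fun_upd[OF insert.hyps(1,2)] using a(2)[rule_format, OF that] by linarith
  then show ?case using a(1) a'(1,2) by (intro exI[of _ "a(i := a')"]) auto
qed

lemma econvex_comb:
  assumes "econvex f" "f x \<le> ereal s" "f y \<le> ereal t" "0 \<le> u" "0 \<le> v" "u + v = 1"
  shows "f (u *\<^sub>R x + v *\<^sub>R y) \<le> ereal (u * s + v * t)"
  using convexD[OF assms(1)[unfolded econvex_def], of "(x, s)" "(y, t)" u v] assms by auto

lemma edom_real:
  assumes "proper f" "x \<in> edom f"
  shows "f x = ereal (real_of_ereal (f x))"
  using assms unfolding proper_def edom_def by (cases "f x") auto

lemma econvex_convex_on_edom: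
  assumes "proper f" "econvex f"
  shows "convex_on (edom f) (\<lambda>x. real_of_ereal (f x))"
proof -
  have le: "f (u *\<^sub>R x + v *\<^sub>R y) \<le> ereal (u * real_of_ereal (f x) + v * real_of_ereal (f y))"
    if "x \<in> edom f" "y \<in> edom f" "0 \<le> u" "0 \<le> v" "u + v = 1" for x y u v
    using that edom_real[OF assms(1)] by (intro econvex_comb[OF assms(2)]) auto
  have dom: "convex (edom f)"
  proof (rule convexI)
    fix x y and u v :: real assume "x \<in> edom f" "y \<in> edom f" "0 \<le> u" "0 \<le> v" "u + v = 1"
    from le[OF this] show "u *\<^sub>R x + v *\<^sub>R y \<in> edom f"
      by (auto simp: edom_def)
  qed
  show ?thesis
    unfolding convex_on_def
  proof (intro conjI allI ballI impI dom)
    fix x y and u v :: real assume *: "x \<in> edom f" "y \<in> edom f" "0 \<le> u" "0 \<le> v" "u + v = 1"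
    have "u *\<^sub>R x + v *\<^sub>R y \<in> edom f" using convexD[OF dom *] .
    from edom_real[OF assms(1) this] le[OF *]
    show "real_of_ereal (f (u *\<^sub>R x + v *\<^sub>R y)) \<le> u * real_of_ereal (f x) + v * real_of_ereal (f y)"
      by (metis ereal_less_eq(3))
  qed
qed

lemma econvex_convex_level:
  assumes "econvex f"
  shows "convex {x. f x \<le> 0}"
proof (rule convexI)
  fix x y and u v :: real assume "x \<in> {x. f x \<le> 0}" "y \<in> {x. f x \<le> 0}" "0 \<le> u" "0 \<le> v" "u + v = 1"
  then show "u *\<^sub>R x + v *\<^sub>R y \<in> {x. f x \<le> 0}"
    using econvex_comb[OF assms, of x 0 y 0 u v] by (simp add: zero_ereal_def)
qed

text \<open>A segment from the level set through \<theta> is prolonged inside the domain to some y.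
  Retreating from y towards \<theta>, where f is negative, brings the value down to at most 0 at a
  point still beyond \<theta>.\<close>

lemma rel_interior_level:
  fixes f :: "'a::euclidean_space \<Rightarrow> ereal"
  assumes f: "proper f" "econvex f" and \<theta>: "\<theta> \<in> rel_interior (edom f)" "f \<theta> < 0"
  shows "\<theta> \<in> rel_interior {x. f x \<le> 0}"
proof -
  note c = econvex_convex_on_edom[OF f]
  have \<theta>d: "\<theta> \<in> edom f" using \<theta> by (auto simp: edom_def)
  then have ne: "{x. f x \<le> 0} \<noteq> {}" "edom f \<noteq> {}" using \<theta>(2) less_imp_le by blast+
  define r where "r x = real_of_ereal (f x)" for x
  have fr: "f x = ereal (r x)" if "x \<in> edom f" for x using edom_real[OF f(1) that] by (simp add: r_def)
  have r\<theta>: "r \<theta> < 0" using \<theta>(2) fr[OF \<theta>d] by simp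
  have "\<exists>e>1. (1 - e) *\<^sub>R x + e *\<^sub>R \<theta> \<in> {x. f x \<le> 0}" if x: "f x \<le> 0" for x
  proof -
    have "x \<in> edom f" using x by (auto simp: edom_def)
    then obtain e where e: "e > 1" "(1 - e) *\<^sub>R x + e *\<^sub>R \<theta> \<in> edom f"
      using \<theta>(1) convex_rel_interior_iff[OF convex_on_imp_convex[OF c] ne(2)] by blast
    define y where "y = (1 - e) *\<^sub>R x + e *\<^sub>R \<theta>"
    have y: "y \<in> edom f" using e by (simp add: y_def)
    obtain t where t: "0 < t" "t \<le> 1" "(1 - t) * r \<theta> + t * r y \<le> 0"
    proof (cases "r y \<le> r \<theta>")
      case True
      then show thesis using that[of 1] r\<theta> by simp
    next
      case False
      \<comment> \<open>The ratio marks where the linear interpolation from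
        \<open>r \<theta>\<close> to \<open>r y\<close> reaches 0.\<close>
      define t where "t = min 1 (- r \<theta> / (r y - r \<theta>))"
      have "t * (r y - r \<theta>) \<le> (- r \<theta> / (r y - r \<theta>)) * (r y - r \<theta>)"
        using False by (intro mult_right_mono) (auto simp: t_def)
      then have "t * (r y - r \<theta>) \<le> - r \<theta>" using False by simp
      moreover have "0 < t" "t \<le> 1" using False r\<theta> by (auto simp: t_def divide_neg_pos)
      ultimately show thesis using that[of t] by (simp add: algebra_simps)
    qed
    have "f ((1 - t) *\<^sub>R \<theta> + t *\<^sub>R y) \<le> ereal ((1 - t) * r \<theta> + t * r y)"
      using t fr \<theta>d y by (intro econvex_comb[OF f(2)]) auto
    also have "\<dots> \<le> 0" using t by (simp add: zero_ereal_def)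
    finally have "f ((1 - t) *\<^sub>R \<theta> + t *\<^sub>R y) \<le> 0" .
    moreover have "(1 - t) *\<^sub>R \<theta> + t *\<^sub>R y = (1 - (1 + t * (e - 1))) *\<^sub>R x + (1 + t * (e - 1)) *\<^sub>R \<theta>"
      by (simp add: y_def algebra_simps)
    moreover have "1 + t * (e - 1) > 1" using t e by simp
    ultimately show ?thesis by (metis mem_Collect_eq)
  qed
  then show ?thesis using convex_rel_interior_iff[OF econvex_convex_level[OF f(2)] ne(1)] by blast
qed

text \<open>The two-function alternative for \<open>- a\<close> and f; the strict inequality at
  \<theta> keeps the weight of \<open>- a\<close> positive.\<close>

lemma level_multiplier:
  assumes f: "proper f" "econvex f" and \<theta>: "f \<theta> < 0"
    and a: "affine_real a" "\<And>x. f x \<le> 0 \<Longrightarrow> a x \<le> 0"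
  obtains \<nu> where "0 \<le> \<nu>" "\<And>x. x \<in> edom f \<Longrightarrow> a x \<le> \<nu> * real_of_ereal (f x)"
proof -
  define r where "r x = real_of_ereal (f x)" for x
  have c: "convex_on (edom f) r" unfolding r_def by (rule econvex_convex_on_edom[OF f])
  have fr: "f x = ereal (r x)" if "x \<in> edom f" for x using edom_real[OF f(1) that] by (simp add: r_def)
  have "\<exists>w\<in>edom f. - a w \<le> t * - a x + (1 - t) * - a y \<and> r w \<le> t * r x + (1 - t) * r y"
    if "x \<in> edom f" "y \<in> edom f" "0 \<le> t" "t \<le> 1" for x y t
  proof (intro bexI conjI)
    show "t *\<^sub>R x + (1 - t) *\<^sub>R y \<in> edom f" using that convexD[OF convex_on_imp_convex[OF c]] by auto
    show "r (t *\<^sub>R x + (1 - t) *\<^sub>R y) \<le> t * r x + (1 - t) * r y"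
      using that c unfolding convex_on_def by auto
  qed (use affine_real_comb[OF a(1), of t "1 - t" x y] in simp)
  moreover have "0 \<le> - a x \<or> 0 \<le> r x" if "x \<in> edom f" for x
    using a(2)[of x] fr[OF that] by (cases "r x \<le> 0") (auto simp: zero_ereal_def)
  ultimately obtain t where t: "0 \<le> t" "t \<le> 1" "\<And>x. x \<in> edom f \<Longrightarrow> 0 \<le> t * - a x + (1 - t) * r x"
    using convexlike_alternative[of "edom f" "\<lambda>x. - a x" r] by blast
  have \<theta>d: "\<theta> \<in> edom f" using \<theta> by (auto simp: edom_def)
  have "t > 0"
  proof (rule ccontr)
    assume "\<not> t > 0"
    then have "t = 0" using t by simp
    then show False using t(3)[OF \<theta>d] \<theta> fr[OF \<theta>d] by simp
  qed
  then show thesis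
    using t by (intro that[of "(1 - t) / t"]) (auto simp: r_def field_simps)
qed

text \<open>Lagrangian duality in split form: each piece and each constraint contributes its own
  affine function, the source of one slope variable of the dual program. Affine constraints,
  possibly active at the Slater point, go to the halfspace argument; the others hold strictly there
  and go through their level sets.\<close>

lemma lagrange_multipliers:
  fixes g :: "'k \<Rightarrow> 'a::euclidean_space \<Rightarrow> ereal" and u :: "'i \<Rightarrow> 'a \<Rightarrow> real"
  assumes "finite L" "finite F"
    and g: "\<And>k. k \<in> L \<Longrightarrow> proper (g k)" "\<And>k. k \<in> L \<Longrightarrow> econvex (g k)"
    and slater: "slater_point L g \<theta>"
    and u: "\<And>i. i \<in> F \<Longrightarrow> convex_on UNIV (u i)"
    and M: "\<And>x. (\<And>k. k \<in> L \<Longrightarrow> g k x \<le> 0) \<Longrightarrow> M \<le> (\<Sum>i\<in>F. u i x)"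
  shows "\<exists>a b \<nu>. (\<forall>i\<in>F. affine_real (a i) \<and> (\<forall>x. a i x \<le> u i x))
    \<and> (\<forall>k\<in>L. affine_real (b k) \<and> 0 \<le> \<nu> k \<and> (\<forall>x\<in>edom (g k). b k x \<le> \<nu> k * real_of_ereal (g k x)))
    \<and> (\<forall>x. M \<le> (\<Sum>i\<in>F. a i x) + (\<Sum>k\<in>L. b k x))"
proof -
  define C where "C k = {x. g k x \<le> 0}" for k
  define T where "T = (\<Inter>k\<in>L. C k)"
  have cC: "convex (C k)" if "k \<in> L" for k unfolding C_def by (rule econvex_convex_level[OF g(2)[OF that]])
  have cT: "convex T" unfolding T_def by (intro convex_INT cC)
  have \<theta>T: "\<theta> \<in> T" using slater by (auto simp: slater_point_def T_def C_def)
  have "\<exists>a. (\<forall>i\<in>F. affine_real (a i) \<and> (\<forall>x. a i x \<le> u i x)) \<and> (\<forall>x\<in>T. M \<le> (\<Sum>i\<in>F. a i x))"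
    using M \<theta>T
    by (intro convex_sum_split assms convex_on_const[THEN iffD2, OF cT]) (auto simp: T_def C_def)
  then obtain a where a: "\<forall>i\<in>F. affine_real (a i) \<and> (\<forall>x. a i x \<le> u i x)" "\<forall>x\<in>T. M \<le> (\<Sum>i\<in>F. a i x)"
    by blast
  define La where "La = {k\<in>L. affine_fun (g k)}"
  define Ln where "Ln = L - La"
  define h where "h k x = real_of_ereal (g k x)" for k x
  have fin: "finite La" "finite Ln" using assms(1) by (auto simp: La_def Ln_def)
  have gh: "g k x = ereal (h k x)" if "k \<in> La" for k x
    using that by (auto simp: La_def affine_fun_def h_def)
  have ah: "affine_real (h k)" if "k \<in> La" for k
    using gh[OF that] that unfolding La_def affine_fun_def affine_real_def by auto
  have sl: "g k \<theta> < 0" "\<theta> \<in> rel_interior (edom (g k))" if "k \<in> Ln" for k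
    using slater that by (auto simp: slater_point_def Ln_def La_def)
  have \<theta>C: "\<theta> \<in> rel_interior (C k)" if "k \<in> Ln" for k
    unfolding C_def using that g sl by (intro rel_interior_level) (auto simp: Ln_def)
  define D where "D = (\<Inter>k\<in>Ln. C k)"
  have cD: "convex D" unfolding D_def by (intro convex_INT cC) (auto simp: Ln_def)
  have \<theta>D: "\<theta> \<in> rel_interior D"
    unfolding D_def using fin(2) cC \<theta>C by (intro rel_interior_INT_finite) (auto simp: Ln_def)
  \<comment> \<open>What the minorants of the pieces leave uncovered. It is at most 0 on T; the
    affine constraints absorb it on D, and the remainder is distributed over the other level
    sets.\<close>
  define \<beta> where "\<beta> x = M - (\<Sum>i\<in>F. a i x)" for x
  have \<beta>: "affine_real \<beta>"
    unfolding \<beta>_def using a by (intro affine_real_diff affine_real_const affine_real_sum) auto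
  have "\<exists>\<nu>. (\<forall>k\<in>La. 0 \<le> \<nu> k) \<and> (\<forall>x\<in>D. \<beta> x \<le> (\<Sum>k\<in>La. \<nu> k * h k x))"
  proof (rule halfspace_multipliers[OF fin(1) cD \<theta>D ah _ \<beta>])
    show "h k \<theta> \<le> 0" if "k \<in> La" for k
      using \<theta>T gh[OF that, of \<theta>] that by (auto simp: T_def C_def La_def zero_ereal_def)
    fix x assume x: "x \<in> D" "\<And>k. k \<in> La \<Longrightarrow> h k x \<le> 0"
    have "x \<in> C k" if "k \<in> L" for k
      using x that gh[of k x] by (cases "k \<in> La") (auto simp: D_def C_def Ln_def zero_ereal_def)
    then have "x \<in> T" by (auto simp: T_def)
    then show "\<beta> x \<le> 0" using a(2) by (simp add: \<beta>_def)
  qed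
  then obtain \<nu> where \<nu>: "\<forall>k\<in>La. 0 \<le> \<nu> k" "\<forall>x\<in>D. \<beta> x \<le> (\<Sum>k\<in>La. \<nu> k * h k x)" by blast
  have "\<exists>b. (\<forall>k\<in>Ln. affine_real (b k) \<and> (\<forall>x\<in>C k. b k x \<le> 0)) \<and>
      (\<forall>x. \<beta> x - (\<Sum>k\<in>La. \<nu> k * h k x) \<le> (\<Sum>k\<in>Ln. b k x))"
  proof (rule affine_real_split_INT[OF fin(2) _ \<theta>C])
    show "convex (C k)" if "k \<in> Ln" for k using that cC by (auto simp: Ln_def)
    show "affine_real (\<lambda>x. \<beta> x - (\<Sum>k\<in>La. \<nu> k * h k x))"
      by (intro affine_real_diff affine_real_sum affine_real_cmult \<beta> ah)
    show "\<beta> x - (\<Sum>k\<in>La. \<nu> k * h k x) \<le> 0" if "\<And>k. k \<in> Ln \<Longrightarrow> x \<in> C k" for x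
      using \<nu>(2) that by (auto simp: D_def)
  qed
  then obtain b where b: "\<forall>k\<in>Ln. affine_real (b k) \<and> (\<forall>x\<in>C k. b k x \<le> 0)"
    "\<forall>x. \<beta> x - (\<Sum>k\<in>La. \<nu> k * h k x) \<le> (\<Sum>k\<in>Ln. b k x)" by blast
  have "\<exists>m. 0 \<le> m \<and> (\<forall>x\<in>edom (g k). b k x \<le> m * h k x)" if k: "k \<in> Ln" for k
  proof -
    have "proper (g k)" "econvex (g k)" using k g by (auto simp: Ln_def)
    then obtain m where "0 \<le> m" "\<And>x. x \<in> edom (g k) \<Longrightarrow> b k x \<le> m * real_of_ereal (g k x)"
      using level_multiplier[of "g k" \<theta> "b k"] b(1) sl[OF k] k by (auto simp: C_def)
    then show ?thesis by (auto simp: h_def)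
  qed
  then obtain m where m: "\<And>k. k \<in> Ln \<Longrightarrow> 0 \<le> m k \<and> (\<forall>x\<in>edom (g k). b k x \<le> m k * h k x)" by metis
  define b' where "b' k = (if k \<in> La then (\<lambda>x. \<nu> k * h k x) else b k)" for k
  define \<nu>' where "\<nu>' k = (if k \<in> La then \<nu> k else m k)" for k
  have "affine_real (b' k) \<and> 0 \<le> \<nu>' k \<and> (\<forall>x\<in>edom (g k). b' k x \<le> \<nu>' k * real_of_ereal (g k x))" if "k \<in> L" for k
    using that ah \<nu>(1) m b(1) affine_real_cmult[OF ah]
    by (cases "k \<in> La") (auto simp: b'_def \<nu>'_def Ln_def h_def[symmetric])
  moreover have "M \<le> (\<Sum>i\<in>F. a i x) + (\<Sum>k\<in>L. b' k x)" for x
  proof -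
    have "(\<Sum>k\<in>L. b' k x) = (\<Sum>k\<in>Ln. b' k x) + (\<Sum>k\<in>La. b' k x)"
      unfolding Ln_def using assms(1) by (intro sum.subset_diff) (auto simp: La_def)
    also have "(\<Sum>k\<in>La. b' k x) = (\<Sum>k\<in>La. \<nu> k * h k x)"
      by (intro sum.cong) (auto simp: b'_def)
    also have "(\<Sum>k\<in>Ln. b' k x) = (\<Sum>k\<in>Ln. b k x)"
      by (intro sum.cong) (auto simp: b'_def Ln_def)
    finally show ?thesis using b(2)[rule_format, of x] by (simp add: \<beta>_def)
  qed
  ultimately show ?thesis using a(1) by blast
qed

section \<open>Conjugates and perspectives\<close>

lemma lsc_closed_sublevel:
  fixes f :: "'a::real_normed_vector \<Rightarrow> ereal"
  assumes "lsc_on UNIV f"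
  shows "closed {x. f x \<le> t}"
proof -
  have "open {x. t < f x}"
  proof (subst open_subopen, clarify)
    fix x assume x: "t < f x"
    have "t < Liminf (at x) f" using x assms unfolding lsc_on_def by (auto intro: less_le_trans)
    then have "\<forall>\<^sub>F y in at x. t < f y" by (rule less_LiminfD)
    then obtain S where S: "open S" "x \<in> S" "\<And>y. y \<in> S \<Longrightarrow> y \<noteq> x \<Longrightarrow> t < f y"
      unfolding eventually_at_topological by auto
    then show "\<exists>T. open T \<and> x \<in> T \<and> T \<subseteq> {x. t < f x}" using x by (intro exI[of _ S]) auto
  qed
  moreover have "- {x. f x \<le> t} = {x. t < f x}" by auto
  ultimately show ?thesis by (simp add: closed_def)
qed

text \<open>Stated through closed sublevel sets, the form in which semicontinuity of the cost
  relative to Z x Z carries over to its infinite extension.\<close>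

lemma closed_epigraph:
  fixes f :: "'a::real_normed_vector \<Rightarrow> ereal"
  assumes "\<And>t::real. closed {x. f x \<le> ereal t}"
  shows "closed {(x, t::real). f x \<le> ereal t}"
proof -
  have eq: "{(x, t::real). f x \<le> ereal t} = (\<Inter>r::real. {p. f (fst p) \<le> ereal r} \<union> {p. r \<le> snd p})"
  proof (intro set_eqI iffI)
    fix p assume "p \<in> (\<Inter>r::real. {p. f (fst p) \<le> ereal r} \<union> {p. r \<le> snd p})"
    then have *: "f (fst p) \<le> ereal r \<or> r \<le> snd p" for r by auto
    have "f (fst p) \<le> ereal (snd p)"
    proof (rule ereal_le_epsilon2)
      fix e :: real assume "0 < e"
      then show "f (fst p) \<le> ereal (snd p) + ereal e" using *[of "snd p + e"] by simp
    qed
    then show "p \<in> {(x, t::real). f x \<le> ereal t}" by (simp add: case_prod_beta)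
  next
    fix p assume p: "p \<in> {(x, t::real). f x \<le> ereal t}"
    show "p \<in> (\<Inter>r::real. {p. f (fst p) \<le> ereal r} \<union> {p. r \<le> snd p})"
    proof (intro InterI, clarify)
      fix r assume "\<not> r \<le> snd p"
      then have "ereal (snd p) \<le> ereal r" by simp
      then show "f (fst p) \<le> ereal r" using p order_trans by (fastforce simp: case_prod_beta)
    qed
  qed
  have "closed {p :: 'a \<times> real. r \<le> snd p}" for r
    by (intro closed_Collect_le continuous_intros)
  moreover have "closed {p :: 'a \<times> real. f (fst p) \<le> ereal r}" for r
    using closed_vimage[OF assms[of r] continuous_on_fst[OF continuous_on_id]] by (simp add: vimage_def)
  ultimately show ?thesis unfolding eq by (intro closed_INT ballI closed_Un)
qed

text \<open>The epigraph contains upward rays, so the vertical component of the normal cannot be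
  negative; it may vanish when z lies outside the domain.\<close>

lemma separate_epigraph_point:
  fixes f :: "'a::euclidean_space \<Rightarrow> ereal"
  assumes c: "econvex f" and cl: "\<And>t::real. closed {x. f x \<le> ereal t}" and d: "edom f \<noteq> {}"
    and z: "ereal t < f z"
  obtains \<alpha> \<beta> b where "0 \<le> \<beta>" "\<alpha> \<bullet> z + \<beta> * t < b" "\<And>x r. f x \<le> ereal r \<Longrightarrow> b < \<alpha> \<bullet> x + \<beta> * r"
proof -
  let ?E = "{(x, t::real). f x \<le> ereal t}"
  have "(z, t) \<notin> ?E" using z by simp
  then obtain a b where ab: "inner a (z, t) < b" "\<forall>p\<in>?E. b < inner a p"
    using separating_hyperplane_closed_point[OF c[unfolded econvex_def] closed_epigraph[OF cl]] by blast
  obtain \<alpha> \<beta> where a: "a = (\<alpha>, \<beta>)" by (cases a)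
  have E: "b < \<alpha> \<bullet> x + \<beta> * r" if "f x \<le> ereal r" for x r using ab(2) that by (auto simp: a)
  obtain x0 where "x0 \<in> edom f" using d by auto
  then obtain r0 :: real where r0: "f x0 \<le> ereal r0" by (cases "f x0") (auto simp: edom_def)
  have "0 \<le> \<beta>"
  proof (rule ccontr)
    assume neg: "\<not> 0 \<le> \<beta>"
    define r where "r = max r0 ((b - \<alpha> \<bullet> x0) / \<beta>)"
    have "\<beta> * r \<le> b - \<alpha> \<bullet> x0"
      using neg mult_left_mono_neg[of "(b - \<alpha> \<bullet> x0) / \<beta>" r \<beta>] by (simp add: r_def)
    moreover have "f x0 \<le> ereal r" using r0 by (rule order_trans) (simp add: r_def)
    ultimately show False using E[of x0 r] by simp
  qed
  then show thesis using that ab(1) E by (auto simp: a)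
qed

text \<open>A point one unit below the graph is separated from the epigraph; the graph point
  directly above it shows that the hyperplane is not vertical.\<close>

lemma affine_minorant_exists:
  fixes f :: "'a::euclidean_space \<Rightarrow> ereal"
  assumes "proper_convex_lsc f"
  obtains a where "affine_real a" "\<And>x. ereal (a x) \<le> f x"
proof -
  have f: "proper f" "econvex f" "lsc_on UNIV f" using assms by (auto simp: proper_convex_lsc_def)
  obtain x0 where x0: "x0 \<in> edom f" using f(1) by (auto simp: proper_def)
  define r where "r = real_of_ereal (f x0)"
  have r: "f x0 = ereal r" using edom_real[OF f(1) x0] by (simp add: r_def)
  have "edom f \<noteq> {}" "ereal (r - 1) < f x0" using x0 by (auto simp: r)
  then obtain \<alpha> \<beta> b where s: "0 \<le> \<beta>" "\<alpha> \<bullet> x0 + \<beta> * (r - 1) < b" "\<And>x r. f x \<le> ereal r \<Longrightarrow> b < \<alpha> \<bullet> x + \<beta> * r"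
    by (rule separate_epigraph_point[OF f(2) lsc_closed_sublevel[OF f(3)], of "r - 1" x0]) (rule that)
  have "b < \<alpha> \<bullet> x0 + \<beta> * r" using s(3) r by simp
  then have "\<beta> \<noteq> 0" using s(2) by (auto simp: right_diff_distrib)
  then have \<beta>: "\<beta> > 0" using s(1) by simp
  show thesis
  proof (rule that[of "\<lambda>x. (b - \<alpha> \<bullet> x) / \<beta>"])
    show "affine_real (\<lambda>x. (b - \<alpha> \<bullet> x) / \<beta>)"
      by (rule affine_realI[of _ "(- 1 / \<beta>) *\<^sub>R \<alpha>" "b / \<beta>"]) (simp add: diff_divide_distrib)
    show "ereal ((b - \<alpha> \<bullet> x) / \<beta>) \<le> f x" for x
    proof (cases "x \<in> edom f")
      case True
      then have fx: "f x = ereal (real_of_ereal (f x))" by (rule edom_real[OF f(1)])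
      then have "b < \<alpha> \<bullet> x + \<beta> * real_of_ereal (f x)" by (intro s(3)) simp
      then have "(b - \<alpha> \<bullet> x) / \<beta> \<le> real_of_ereal (f x)" using \<beta> by (simp add: field_simps)
      then show ?thesis by (subst fx) simp
    next
      case False
      then show ?thesis by (auto simp: edom_def)
    qed
  qed
qed

text \<open>Nonnegativity turns a vertical separating hyperplane into a steep affine minorant.\<close>

lemma nonneg_affine_minorant_above:
  fixes f :: "'a::euclidean_space \<Rightarrow> ereal"
  assumes c: "econvex f" and cl: "\<And>t::real. closed {x. f x \<le> ereal t}" and d: "edom f \<noteq> {}"
    and nn: "\<And>x. 0 \<le> f x" and z: "ereal t < f z"
  obtains a where "affine_real a" "\<And>x. ereal (a x) \<le> f x" "t < a z"
proof -
  obtain \<alpha> \<beta> b where s: "0 \<le> \<beta>" "\<alpha> \<bullet> z + \<beta> * t < b" "\<And>x r. f x \<le> ereal r \<Longrightarrow> b < \<alpha> \<bullet> x + \<beta> * r"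
    by (rule separate_epigraph_point[OF c cl d z]) (rule that)
  have fx: "f x = ereal (real_of_ereal (f x))" if "f x \<noteq> \<infinity>" for x
    using nn[of x] that by (cases "f x") auto
  show thesis
  proof (cases "\<beta> = 0")
    case False
    then have \<beta>: "\<beta> > 0" using s(1) by simp
    show thesis
    proof (rule that[of "\<lambda>x. (b - \<alpha> \<bullet> x) / \<beta>"])
      show "affine_real (\<lambda>x. (b - \<alpha> \<bullet> x) / \<beta>)"
        by (rule affine_realI[of _ "(- 1 / \<beta>) *\<^sub>R \<alpha>" "b / \<beta>"]) (simp add: diff_divide_distrib)
      show "ereal ((b - \<alpha> \<bullet> x) / \<beta>) \<le> f x" for x
      proof (cases "f x = \<infinity>")
        case False
        have "b < \<alpha> \<bullet> x + \<beta> * real_of_ereal (f x)" using fx[OF False] by (intro s(3)) simp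
        then have "(b - \<alpha> \<bullet> x) / \<beta> \<le> real_of_ereal (f x)" using \<beta> by (simp add: field_simps)
        then show ?thesis by (subst fx[OF False]) simp
      qed simp
      show "t < (b - \<alpha> \<bullet> z) / \<beta>" using s(2) \<beta> by (simp add: field_simps)
    qed
  next
    case True
    \<comment> \<open>Scaled so that the minorant takes the value \<open>\<bar>t\<bar> + 1\<close>
      at z.\<close>
    define k where "k = (\<bar>t\<bar> + 1) / (b - \<alpha> \<bullet> z)"
    have bz: "b - \<alpha> \<bullet> z > 0" using s(2) True by simp
    have k: "k > 0" unfolding k_def using bz by simp
    show thesis
    proof (rule that[of "\<lambda>x. k * (b - \<alpha> \<bullet> x)"])
      show "affine_real (\<lambda>x. k * (b - \<alpha> \<bullet> x))"
        by (intro affine_real_cmult affine_real_diff affine_real_const affine_real_inner)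
      show "ereal (k * (b - \<alpha> \<bullet> x)) \<le> f x" for x
      proof (cases "f x = \<infinity>")
        case False
        have "b < \<alpha> \<bullet> x" using s(3)[of x "real_of_ereal (f x)"] fx[OF False] True by simp
        then have "k * (b - \<alpha> \<bullet> x) \<le> 0" using k by (simp add: mult_le_0_iff)
        then have "ereal (k * (b - \<alpha> \<bullet> x)) \<le> 0" by (simp add: zero_ereal_def)
        then show ?thesis using nn order_trans by blast
      qed simp
      show "t < k * (b - \<alpha> \<bullet> z)" using bz by (simp add: k_def)
    qed
  qed
qed

lemma fenchel_conj_ge: "ereal (y \<bullet> x) - f x \<le> fenchel_conj f y"
  unfolding fenchel_conj_def by (rule SUP_upper) simp

lemma fenchel_conj_leI: "(\<And>x. ereal (y \<bullet> x) - f x \<le> b) \<Longrightarrow> fenchel_conj f y \<le> b"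
  unfolding fenchel_conj_def by (rule SUP_least)

lemma fenchel_conj_affine_minorant:
  assumes "\<And>x. ereal (y \<bullet> x + b) \<le> f x"
  shows "fenchel_conj f y \<le> ereal (- b)"
proof (rule fenchel_conj_leI)
  fix x show "ereal (y \<bullet> x) - f x \<le> ereal (- b)" using assms[of x] by (cases "f x") auto
qed

text \<open>The biconjugate never exceeds the function. This bounds a perspective at 0, a supremum
  over the domain of the biconjugate, from below by points of the domain of f.\<close>

lemma edom_biconj: "edom f \<subseteq> edom (fenchel_conj (fenchel_conj f))"
proof
  fix x assume x: "x \<in> edom f"
  have "fenchel_conj (fenchel_conj f) x \<le> f x"
  proof (rule fenchel_conj_leI)
    fix y show "ereal (x \<bullet> y) - fenchel_conj f y \<le> f x"
      using fenchel_conj_ge[of y x f] by (cases "f x"; cases "fenchel_conj f y") (auto simp: inner_commute)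
  qed
  then show "x \<in> edom (fenchel_conj (fenchel_conj f))" using x unfolding edom_def by (auto intro: le_less_trans)
qed

text \<open>The Fenchel-Young inequality scaled by q, together with its limit at q = 0, where x
  belongs to the set whose support function is taken. Weak duality of both programs uses it.\<close>

lemma persp_conj_ge:
  assumes "0 \<le> q" "f x \<le> ereal r"
  shows "ereal (y \<bullet> x - q * r) \<le> persp (fenchel_conj f) q y"
proof (cases "q = 0")
  case True
  have "x \<in> edom f" using assms(2) by (auto simp: edom_def)
  then have "ereal (y \<bullet> x) \<le> (SUP z\<in>edom (fenchel_conj (fenchel_conj f)). ereal (y \<bullet> z))"
    using edom_biconj by (intro SUP_upper) auto
  then show ?thesis using True by (simp add: persp_def)
next
  case False
  then have q: "q > 0" using assms(1) by simp
  have "ereal ((y /\<^sub>R q) \<bullet> x) - ereal r \<le> ereal ((y /\<^sub>R q) \<bullet> x) - f x"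
    using assms(2) by (intro ereal_minus_mono) auto
  also have "\<dots> \<le> fenchel_conj f (y /\<^sub>R q)" by (rule fenchel_conj_ge)
  finally have "ereal q * ereal ((y /\<^sub>R q) \<bullet> x - r) \<le> ereal q * fenchel_conj f (y /\<^sub>R q)"
    using q by (intro ereal_mult_left_mono) auto
  moreover have "q * ((y /\<^sub>R q) \<bullet> x - r) = y \<bullet> x - q * r" using q by (simp add: field_simps)
  ultimately show ?thesis using False by (simp add: persp_def)
qed

text \<open>For \<open>\<nu> = 0\<close> this needs an affine minorant of \<open>f\<close>: shifting its slope along \<open>y\<close> keeps
  the conjugate finite, so the biconjugate is infinite wherever the support function of
  \<open>edom f\<close> is exceeded.\<close>

lemma persp_conj_le:
  fixes f :: "'a::euclidean_space \<Rightarrow> ereal"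
  assumes f: "proper_convex_lsc f" and "0 \<le> \<nu>"
    and le: "\<And>x. x \<in> edom f \<Longrightarrow> y \<bullet> x + b \<le> \<nu> * real_of_ereal (f x)"
  shows "persp (fenchel_conj f) \<nu> y \<le> ereal (- b)"
proof (cases "\<nu> = 0")
  case False
  then have q: "\<nu> > 0" using assms(2) by simp
  have pf: "proper f" using f by (simp add: proper_convex_lsc_def)
  have "fenchel_conj f (y /\<^sub>R \<nu>) \<le> ereal (- (b / \<nu>))"
  proof (rule fenchel_conj_affine_minorant)
    fix x show "ereal ((y /\<^sub>R \<nu>) \<bullet> x + b / \<nu>) \<le> f x"
    proof (cases "x \<in> edom f")
      case True
      have "(y /\<^sub>R \<nu>) \<bullet> x + b / \<nu> \<le> real_of_ereal (f x)" using le[OF True] q by (simp add: field_simps)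
      then show ?thesis by (subst edom_real[OF pf True]) simp
    qed (auto simp: edom_def)
  qed
  then have "ereal \<nu> * fenchel_conj f (y /\<^sub>R \<nu>) \<le> ereal \<nu> * ereal (- (b / \<nu>))"
    using q by (intro ereal_mult_left_mono) auto
  then show ?thesis using q by (simp add: persp_def)
next
  case True
  obtain a where a: "affine_real a" "\<And>x. ereal (a x) \<le> f x" using affine_minorant_exists[OF f] by blast
  obtain v r where vr: "\<And>x. a x = v \<bullet> x + r" using a(1) unfolding affine_real_def by blast
  have "y \<bullet> w \<le> - b" if w: "w \<in> edom (fenchel_conj (fenchel_conj f))" for w
  proof (rule ccontr)
    assume "\<not> ?thesis"
    then have d: "y \<bullet> w + b > 0" by simp
    have conj: "fenchel_conj f (v + t *\<^sub>R y) \<le> ereal (- (r + t * b))" if "0 \<le> t" for t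
    proof (rule fenchel_conj_affine_minorant)
      fix x show "ereal ((v + t *\<^sub>R y) \<bullet> x + (r + t * b)) \<le> f x"
      proof (cases "x \<in> edom f")
        case True
        have "t * (y \<bullet> x + b) \<le> 0" using le[OF True] \<open>\<nu> = 0\<close> that by (simp add: mult_nonneg_nonpos)
        then have "(v + t *\<^sub>R y) \<bullet> x + (r + t * b) \<le> a x" by (simp add: vr inner_add_left algebra_simps)
        then show ?thesis using a(2)[of x] by (metis ereal_less_eq(3) order_trans)
      qed (auto simp: edom_def)
    qed
    have ge: "ereal (w \<bullet> v + r + t * (y \<bullet> w + b)) \<le> fenchel_conj (fenchel_conj f) w" if "0 \<le> t" for t
    proof -
      have "ereal (w \<bullet> (v + t *\<^sub>R y)) - ereal (- (r + t * b)) \<le> ereal (w \<bullet> (v + t *\<^sub>R y)) - fenchel_conj f (v + t *\<^sub>R y)"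
        using conj[OF that] by (intro ereal_minus_mono) auto
      also have "\<dots> \<le> fenchel_conj (fenchel_conj f) w" by (rule fenchel_conj_ge)
      finally show ?thesis by (simp add: inner_add_right inner_commute algebra_simps)
    qed
    have "fenchel_conj (fenchel_conj f) w \<noteq> \<infinity>" using w by (auto simp: edom_def)
    moreover have "fenchel_conj (fenchel_conj f) w \<noteq> -\<infinity>" using ge[of 0] by auto
    ultimately obtain m where m: "fenchel_conj (fenchel_conj f) w = ereal m"
      by (cases "fenchel_conj (fenchel_conj f) w") auto
    \<comment> \<open>Large enough for the lower bound \<open>ge\<close>, linear in t, to exceed the
      finite biconjugate value m by 1.\<close>
    define t where "t = max 0 ((m - w \<bullet> v - r + 1) / (y \<bullet> w + b))"
    have "(m - w \<bullet> v - r + 1) / (y \<bullet> w + b) * (y \<bullet> w + b) \<le> t * (y \<bullet> w + b)"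
      using d by (intro mult_right_mono) (auto simp: t_def)
    then have "m - w \<bullet> v - r + 1 \<le> t * (y \<bullet> w + b)" using d by simp
    moreover have "w \<bullet> v + r + t * (y \<bullet> w + b) \<le> m" using ge[of t] by (simp add: m t_def)
    ultimately show False by linarith
  qed
  then show ?thesis using True by (auto simp: persp_def intro!: SUP_least)
qed

text \<open>Only an inequality: the domain of the conjugate may be empty, and the supremum is then
  minus infinity.\<close>

lemma persp_zero_le: "persp f 0 0 \<le> 0"
  unfolding persp_def by (auto intro!: SUP_least)

section \<open>Transport plans\<close>

lemma finite_family_convergent_subseq:
  fixes f :: "'s \<Rightarrow> nat \<Rightarrow> 'a::heine_borel"
  assumes "finite S" "\<And>s. s \<in> S \<Longrightarrow> bounded (range (f s))"
  shows "\<exists>r l. strict_mono r \<and> (\<forall>s\<in>S. (\<lambda>n. f s (r n)) \<longlonglongrightarrow> l s)"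
  using assms
proof (induction S rule: finite_induct)
  case empty
  show ?case by (intro exI[of _ id] exI[of _ undefined]) (auto simp: strict_mono_def)
next
  case (insert s S)
  then obtain r l where r: "strict_mono r" "\<forall>s\<in>S. (\<lambda>n. f s (r n)) \<longlonglongrightarrow> l s" by auto
  have "bounded (range (\<lambda>n. f s (r n)))"
    by (rule bounded_subset[of "range (f s)"]) (use insert.prems in auto)
  then obtain l' r' where r': "strict_mono r'" "((\<lambda>n. f s (r n)) \<circ> r') \<longlonglongrightarrow> l'"
    using bounded_imp_convergent_subsequence by blast
  have "(\<lambda>n. f k ((r \<circ> r') n)) \<longlonglongrightarrow> (l(s := l')) k" if "k \<in> insert s S" for k
    using that r' LIMSEQ_subseq_LIMSEQ[OF r(2)[rule_format] r'(1), of k] insert.hyps(2)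
    by (cases "k = s") (auto simp: o_def)
  then show ?case using strict_mono_o[OF r(1) r'(1)] by blast
qed

text \<open>A closed convex nonnegative function is the supremum of its affine minorants. Cost
  bounds at barycenters and at limits can therefore be tested on affine functions, which commute
  with averages and limits.\<close>

lemma nonneg_level_via_minorants:
  fixes f :: "'a::euclidean_space \<Rightarrow> ereal"
  assumes c: "econvex f" and cl: "\<And>t::real. closed {x. f x \<le> ereal t}" and d: "edom f \<noteq> {}"
    and nn: "\<And>x. 0 \<le> f x"
    and le: "\<And>a. affine_real a \<Longrightarrow> (\<And>x. ereal (a x) \<le> f x) \<Longrightarrow> a z \<le> t"
  shows "f z \<le> ereal t"
proof (rule ccontr)
  assume "\<not> ?thesis"
  then have "ereal t < f z" by simp
  then obtain a where "affine_real a" "\<And>x. ereal (a x) \<le> f x" "t < a z"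
    by (rule nonneg_affine_minorant_above[OF c cl d nn]) (rule that)
  then show False using le[of a] by fastforce
qed

text \<open>Joint convexity of the perspective \<open>a * C z\<close>. The position is prescribed
  only for positive total mass; a part without mass contributes just a nonnegative bound.\<close>

lemma scaled_cost_mix:
  assumes C: "econvex C" "\<And>z. 0 \<le> C z" and ab: "0 \<le> a" "0 \<le> b"
    and z: "a + b \<noteq> 0 \<Longrightarrow> z = (a *\<^sub>R z1 + b *\<^sub>R z2) /\<^sub>R (a + b)"
    and g: "ereal a * C z1 \<le> ereal g1" "ereal b * C z2 \<le> ereal g2"
  shows "ereal (a + b) * C z \<le> ereal (g1 + g2)"
proof -
  have "0 \<le> ereal a * C z1" "0 \<le> ereal b * C z2" using C ab by simp_all
  then have "0 \<le> ereal g1" "0 \<le> ereal g2" using g order_trans by blast+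
  then have nn: "0 \<le> g1" "0 \<le> g2" by simp_all
  have scale: "C w \<le> ereal (g / s)" if "ereal s * C w \<le> ereal g" "0 < s" for s g w
    using that C(2)[of w] by (cases "C w") (auto simp: field_simps)
  consider "a = 0" "b = 0" | "a = 0" "0 < b" | "0 < a" "b = 0" | "0 < a" "0 < b" using ab by linarith
  then show ?thesis
  proof cases
    case 1 then show ?thesis using nn by (simp add: zero_ereal_def[symmetric])
  next
    case 2
    then have "z = z2" using z by simp
    then show ?thesis using 2 g(2) nn by (auto intro: order_trans)
  next
    case 3
    then have "z = z1" using z by simp
    then show ?thesis using 3 g(1) nn by (auto intro: order_trans)
  next
    case 4
    then have ze: "z = (a / (a + b)) *\<^sub>R z1 + (b / (a + b)) *\<^sub>R z2"
      using z by (simp add: scaleR_add_right divide_inverse mult.commute)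
    have "C z \<le> ereal (a / (a + b) * (g1 / a) + b / (a + b) * (g2 / b))"
      unfolding ze using 4 scale g
      by (intro econvex_comb[OF C(1)]) (auto simp flip: add_divide_distrib)
    also have "a / (a + b) * (g1 / a) + b / (a + b) * (g2 / b) = (g1 + g2) / (a + b)"
      using 4 by (simp add: add_divide_distrib)
    finally have "ereal (a + b) * C z \<le> ereal (a + b) * ereal ((g1 + g2) / (a + b))"
      using ab by (intro ereal_mult_left_mono) auto
    then show ?thesis using 4 by simp
  qed
qed

lemma scaled_concave_mix:
  fixes u :: "'a::real_vector \<Rightarrow> real"
  assumes u: "convex_on UNIV (\<lambda>z. - u z)" and ab: "0 \<le> a" "0 \<le> b"
    and z: "a + b \<noteq> 0 \<Longrightarrow> z = (a *\<^sub>R z1 + b *\<^sub>R z2) /\<^sub>R (a + b)"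
  shows "a * u z1 + b * u z2 \<le> (a + b) * u z"
proof (cases "a + b = 0")
  case True
  then show ?thesis using ab by (simp add: add_nonneg_eq_0_iff)
next
  case False
  then have pos: "a + b > 0" using ab by simp
  have ze: "z = (a / (a + b)) *\<^sub>R z1 + (b / (a + b)) *\<^sub>R z2"
    using z[OF False] by (simp add: scaleR_add_right divide_inverse mult.commute)
  have eq: "1 - b / (a + b) = a / (a + b)" using pos by (simp add: field_simps)
  have "- u z \<le> (a / (a + b)) * - u z1 + (b / (a + b)) * - u z2"
    unfolding ze using convex_onD[OF u, of "b / (a + b)" z1 z2] ab pos eq by auto
  then have "(a * u z1 + b * u z2) / (a + b) \<le> u z" by (simp add: add_divide_distrib)
  then show ?thesis using pos by (simp add: field_simps)
qed

section \<open>Plans between atoms and loss pieces, and their values\<close>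

locale dro_data =
  fixes I J :: nat and p :: "nat \<Rightarrow> real" and zh :: "nat \<Rightarrow> 'd::euclidean_space"
    and C :: "nat \<Rightarrow> 'd \<Rightarrow> ereal" and u :: "nat \<Rightarrow> 'm::euclidean_space \<Rightarrow> 'd \<Rightarrow> real"
    and T :: "'m set" and eps :: real
  assumes I: "1 \<le> I" and p: "\<And>j. j \<in> {1..J} \<Longrightarrow> 0 < p j"
    and C_nonneg: "\<And>j z. j \<in> {1..J} \<Longrightarrow> 0 \<le> C j z"
    and C_convex: "\<And>j. j \<in> {1..J} \<Longrightarrow> econvex (C j)"
    and C_closed: "\<And>j t. j \<in> {1..J} \<Longrightarrow> closed {z. C j z \<le> ereal t}"
    and C_zero: "\<And>j z. j \<in> {1..J} \<Longrightarrow> C j z = 0 \<longleftrightarrow> z = zh j"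
    and u_concave: "\<And>i \<theta>. i \<in> {1..I} \<Longrightarrow> convex_on UNIV (\<lambda>z. - u i \<theta> z)"
    and u_convex: "\<And>i z. i \<in> {1..I} \<Longrightarrow> convex_on UNIV (\<lambda>\<theta>. u i \<theta> z)"
    and T_convex: "convex T" and T_closed: "closed T" and T_nonempty: "T \<noteq> {}"
    and eps: "0 < eps"
begin

text \<open>A plan moves mass \<open>q i j\<close> from the \<open>j\<close>-th atom to \<open>z i j\<close> at cost at most \<open>\<gamma> i j\<close>; the
  position \<open>z i j\<close> is irrelevant when \<open>q i j = 0\<close>, since \<open>0 * \<infinity> = 0\<close> in \<^typ>\<open>ereal\<close>.\<close>

definition plans :: "real \<Rightarrow> ((nat \<Rightarrow> nat \<Rightarrow> real) \<times> (nat \<Rightarrow> nat \<Rightarrow> 'd) \<times> (nat \<Rightarrow> nat \<Rightarrow> real)) set" where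
  "plans e = {(q, z, \<gamma>).
     (\<forall>i\<in>{1..I}. \<forall>j\<in>{1..J}. 0 \<le> q i j \<and> ereal (q i j) * C j (z i j) \<le> ereal (\<gamma> i j)) \<and>
     (\<forall>j\<in>{1..J}. (\<Sum>i\<in>{1..I}. q i j) = p j) \<and> (\<Sum>i\<in>{1..I}. \<Sum>j\<in>{1..J}. \<gamma> i j) \<le> e}"

definition val :: "(nat \<Rightarrow> nat \<Rightarrow> real) \<times> (nat \<Rightarrow> nat \<Rightarrow> 'd) \<times> (nat \<Rightarrow> nat \<Rightarrow> real) \<Rightarrow> 'm \<Rightarrow> real" where
  "val = (\<lambda>(q, z, \<gamma>) \<theta>. \<Sum>i\<in>{1..I}. \<Sum>j\<in>{1..J}. q i j * u i \<theta> (z i j))"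

definition worst :: "'m \<Rightarrow> ereal" where
  "worst \<theta> = (SUP x\<in>plans eps. ereal (val x \<theta>))"

lemma plans_gamma_nonneg:
  assumes "(q, z, \<gamma>) \<in> plans e" "i \<in> {1..I}" "j \<in> {1..J}"
  shows "0 \<le> \<gamma> i j"
proof -
  have "0 \<le> ereal (q i j) * C j (z i j)" "ereal (q i j) * C j (z i j) \<le> ereal (\<gamma> i j)"
    using assms C_nonneg[OF assms(3)] by (auto simp: plans_def)
  then have "0 \<le> ereal (\<gamma> i j)" by (rule order_trans)
  then show ?thesis by simp
qed

lemma plans_mono: "e \<le> e' \<Longrightarrow> plans e \<subseteq> plans e'"
  by (auto simp: plans_def)

text \<open>Masses are averaged and positions become mass-weighted means: convexity keeps the costs
  within the mixed bounds, and concavity of the pieces raises the value for every \<theta>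
  simultaneously. The two budgets differ, as the budget multiplier and the repair of an exceeded
  budget require.\<close>

lemma plans_mix:
  assumes x: "x \<in> plans e1" and y: "y \<in> plans e2" and t: "0 \<le> t" "t \<le> 1"
  shows "\<exists>w\<in>plans (t * e1 + (1 - t) * e2). \<forall>\<theta>. t * val x \<theta> + (1 - t) * val y \<theta> \<le> val w \<theta>"
proof -
  obtain q1 z1 g1 where xe: "x = (q1, z1, g1)" by (cases x)
  obtain q2 z2 g2 where ye: "y = (q2, z2, g2)" by (cases y)
  define q where "q i j = t * q1 i j + (1 - t) * q2 i j" for i j
  define z where "z i j = ((t * q1 i j) *\<^sub>R z1 i j + ((1 - t) * q2 i j) *\<^sub>R z2 i j) /\<^sub>R q i j" for i j
  define g where "g i j = t * g1 i j + (1 - t) * g2 i j" for i j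
  have sc: "ereal (s * r) * c \<le> ereal (s * m)" if "ereal r * c \<le> ereal m" "0 \<le> s" for s r m c
  proof -
    have "ereal s * (ereal r * c) \<le> ereal s * ereal m" using that by (intro ereal_mult_left_mono) auto
    then show ?thesis by (simp add: mult.assoc[symmetric])
  qed
  have nn: "0 \<le> t * q1 i j" "0 \<le> (1 - t) * q2 i j" if "i \<in> {1..I}" "j \<in> {1..J}" for i j
    using x y t that by (auto simp: xe ye plans_def)
  have "0 \<le> q i j" "ereal (q i j) * C j (z i j) \<le> ereal (g i j)" if ij: "i \<in> {1..I}" "j \<in> {1..J}" for i j
  proof -
    show "0 \<le> q i j" using nn[OF ij] by (simp add: q_def)
    show "ereal (q i j) * C j (z i j) \<le> ereal (g i j)"
      unfolding q_def g_def
    proof (rule scaled_cost_mix[OF C_convex[OF ij(2)] C_nonneg[OF ij(2)] nn[OF ij]])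
      show "z i j = ((t * q1 i j) *\<^sub>R z1 i j + ((1 - t) * q2 i j) *\<^sub>R z2 i j) /\<^sub>R (t * q1 i j + (1 - t) * q2 i j)"
        by (simp add: z_def q_def)
      show "ereal (t * q1 i j) * C j (z1 i j) \<le> ereal (t * g1 i j)"
        using x ij t by (intro sc) (auto simp: xe plans_def)
      show "ereal ((1 - t) * q2 i j) * C j (z2 i j) \<le> ereal ((1 - t) * g2 i j)"
        using y ij t by (intro sc) (auto simp: ye plans_def)
    qed
  qed
  moreover have "(\<Sum>i\<in>{1..I}. q i j) = p j" if j: "j \<in> {1..J}" for j
  proof -
    have "(\<Sum>i\<in>{1..I}. q1 i j) = p j" "(\<Sum>i\<in>{1..I}. q2 i j) = p j"
      using x y j by (auto simp: xe ye plans_def)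
    then have "(\<Sum>i\<in>{1..I}. q i j) = t * p j + (1 - t) * p j"
      by (simp add: q_def sum.distrib flip: sum_distrib_left)
    then show ?thesis by (simp add: algebra_simps)
  qed
  moreover have "(\<Sum>i\<in>{1..I}. \<Sum>j\<in>{1..J}. g i j) \<le> t * e1 + (1 - t) * e2"
  proof -
    have "(\<Sum>i\<in>{1..I}. \<Sum>j\<in>{1..J}. g i j) =
        t * (\<Sum>i\<in>{1..I}. \<Sum>j\<in>{1..J}. g1 i j) + (1 - t) * (\<Sum>i\<in>{1..I}. \<Sum>j\<in>{1..J}. g2 i j)"
      by (simp add: g_def sum.distrib flip: sum_distrib_left)
    also have "\<dots> \<le> t * e1 + (1 - t) * e2"
      using x y t by (intro add_mono mult_left_mono) (auto simp: xe ye plans_def)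
    finally show ?thesis .
  qed
  ultimately have "(q, z, g) \<in> plans (t * e1 + (1 - t) * e2)" by (auto simp: plans_def)
  moreover have "t * val x \<theta> + (1 - t) * val y \<theta> \<le> val (q, z, g) \<theta>" for \<theta>
  proof -
    have "t * val x \<theta> + (1 - t) * val y \<theta> =
      (\<Sum>i\<in>{1..I}. \<Sum>j\<in>{1..J}. (t * q1 i j) * u i \<theta> (z1 i j) + ((1 - t) * q2 i j) * u i \<theta> (z2 i j))"
      by (simp add: val_def xe ye sum.distrib mult.assoc flip: sum_distrib_left)
    also have "\<dots> \<le> val (q, z, g) \<theta>"
      unfolding val_def prod.case
    proof (intro sum_mono)
      fix i j assume ij: "i \<in> {1..I}" "j \<in> {1..J}"
      show "(t * q1 i j) * u i \<theta> (z1 i j) + ((1 - t) * q2 i j) * u i \<theta> (z2 i j) \<le> q i j * u i \<theta> (z i j)"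
        unfolding q_def
        by (rule scaled_concave_mix[OF u_concave[OF ij(1)] nn[OF ij]]) (simp add: z_def q_def)
    qed
    finally show ?thesis .
  qed
  ultimately show ?thesis by blast
qed

lemma plans_mix_eps:
  assumes "x \<in> plans e" "y \<in> plans e" "0 \<le> t" "t \<le> 1"
  shows "\<exists>w\<in>plans e. \<forall>\<theta>. t * val x \<theta> + (1 - t) * val y \<theta> \<le> val w \<theta>"
  using plans_mix[OF assms] by (simp add: algebra_simps)

text \<open>All mass stays at its atom and is credited to the first piece. With budget 0 it is the
  Slater point of the constraint that the budget be at most \<open>eps\<close>.\<close>

lemma stay_plan: "((\<lambda>i j. if i = 1 then p j else 0), (\<lambda>i. zh), (\<lambda>i j. 0)) \<in> plans 0"
proof -
  have "C j (zh j) = 0" if "j \<in> {1..J}" for j using C_zero[OF that] by simp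
  moreover have "0 \<le> p j" if "j \<in> {1..J}" for j using p[OF that] by simp
  ultimately show ?thesis using I by (auto simp: plans_def sum.delta)
qed

lemma plans_nonempty: "plans eps \<noteq> {}"
  using stay_plan plans_mono[of 0 eps] eps by auto

lemma val_convex:
  assumes "x \<in> plans e"
  shows "convex_on UNIV (val x)"
proof -
  obtain q z \<gamma> where x: "x = (q, z, \<gamma>)" by (cases x)
  have 1: "convex_on UNIV (\<lambda>\<theta>. q i j * u i \<theta> (z i j))" if "i \<in> {1..I}" "j \<in> {1..J}" for i j
    using that assms u_convex by (intro convex_on_cmul) (auto simp: x plans_def)
  have 2: "convex_on UNIV (\<lambda>\<theta>. \<Sum>s\<in>S. h s \<theta>)"
    if "finite S" "\<And>s. s \<in> S \<Longrightarrow> convex_on UNIV (h s)" for S and h :: "nat \<Rightarrow> 'm \<Rightarrow> real"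
    using that by (induction S rule: finite_induct) (auto simp: convex_on_const intro: convex_on_add)
  have "convex_on UNIV (\<lambda>\<theta>. \<Sum>i\<in>{1..I}. \<Sum>j\<in>{1..J}. q i j * u i \<theta> (z i j))"
    by (intro 2 1 finite_atLeastAtMost)
  then show ?thesis by (simp add: x val_def[abs_def])
qed

lemma val_le_worst: "x \<in> plans eps \<Longrightarrow> ereal (val x \<theta>) \<le> worst \<theta>"
  unfolding worst_def by (rule SUP_upper)

lemma worst_not_MInf: "worst \<theta> \<noteq> -\<infinity>"
  using plans_nonempty val_le_worst[of _ \<theta>] by force

section \<open>Minimax over plans\<close>

lemma minimax_bounded:
  assumes \<theta>0: "\<theta>0 \<in> T" "worst \<theta>0 < \<infinity>" and bdd: "\<And>b::real. bounded {\<theta>\<in>T. worst \<theta> \<le> ereal b}"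
    and a: "\<And>\<theta>. \<theta> \<in> T \<Longrightarrow> ereal a < worst \<theta>"
  obtains x where "x \<in> plans eps" "\<And>\<theta>. \<theta> \<in> T \<Longrightarrow> a \<le> val x \<theta>"
proof -
  obtain b where b: "worst \<theta>0 = ereal b" using \<theta>0(2) worst_not_MInf[of \<theta>0] by (cases "worst \<theta>0") auto
  show thesis
  proof (rule minimax_bounded_sublevel[OF T_convex T_closed val_convex plans_mix_eps \<theta>0(1)])
    show "val x \<theta>0 \<le> b" if "x \<in> plans eps" for x using val_le_worst[OF that, of \<theta>0] by (simp add: b)
    have "{\<theta>\<in>T. \<forall>x\<in>plans eps. val x \<theta> \<le> b} \<subseteq> {\<theta>\<in>T. worst \<theta> \<le> ereal b}"
      by (auto simp: worst_def intro!: SUP_least)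
    then show "bounded {\<theta>\<in>T. \<forall>x\<in>plans eps. val x \<theta> \<le> b}" using bdd bounded_subset by blast
    show "\<exists>x\<in>plans eps. a < val x \<theta>" if "\<theta> \<in> T" for \<theta>
      using a[OF that] by (auto simp: worst_def less_SUP_iff)
  qed (use that in auto)
qed


lemma C_edom: "j \<in> {1..J} \<Longrightarrow> edom (C j) \<noteq> {}"
  using C_zero[of j "zh j"] by (auto simp: edom_def intro!: exI[of _ "zh j"])

lemma minorant_le_gamma:
  assumes x: "(q, z, \<gamma>) \<in> plans e" and ij: "i \<in> {1..I}" "j \<in> {1..J}" and a: "\<And>w. ereal (a w) \<le> C j w"
  shows "q i j * a (z i j) \<le> \<gamma> i j"
proof -
  have "ereal (q i j) * ereal (a (z i j)) \<le> ereal (q i j) * C j (z i j)"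
    using x ij a by (intro ereal_mult_left_mono) (auto simp: plans_def)
  also have "\<dots> \<le> ereal (\<gamma> i j)" using x ij by (auto simp: plans_def)
  finally show ?thesis by simp
qed

lemma cost_le_of_minorants:
  assumes j: "j \<in> {1..J}" and q: "0 \<le> q" and g: "0 \<le> g"
    and le: "\<And>v b. (\<And>w. ereal (v \<bullet> w + b) \<le> C j w) \<Longrightarrow> q * (v \<bullet> z + b) \<le> g"
  shows "ereal q * C j z \<le> ereal g"
proof (cases "q = 0")
  case True
  then show ?thesis using g by (simp add: zero_ereal_def[symmetric])
next
  case False
  then have q: "q > 0" using q by simp
  have "C j z \<le> ereal (g / q)"
  proof (rule nonneg_level_via_minorants[OF C_convex[OF j] C_closed[OF j] C_edom[OF j] C_nonneg[OF j]])
    fix a assume "affine_real a" "\<And>x. ereal (a x) \<le> C j x"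
    then obtain v b where "\<And>x. a x = v \<bullet> x + b" "\<And>w. ereal (v \<bullet> w + b) \<le> C j w"
      unfolding affine_real_def by metis
    then show "a z \<le> g / q" using le[of v b] q by (simp add: field_simps)
  qed
  then have "ereal q * C j z \<le> ereal q * ereal (g / q)" using q by (intro ereal_mult_left_mono) auto
  then show ?thesis using q by simp
qed

text \<open>The first moments \<open>q i j * z i j\<close> of plans are bounded by superlinear growth; a limit of
  plans is built from limits of \<open>q\<close>, \<open>q * z\<close> and \<open>\<gamma>\<close>, and growth rules out mass escaping to
  infinity.\<close>

lemma minimax_superlinear:
  assumes growth: "\<And>j N. j \<in> {1..J} \<Longrightarrow> \<exists>R. \<forall>z. R \<le> norm z \<longrightarrow> ereal (N * norm z) \<le> C j z"
    and \<theta>0: "\<theta>0 \<in> T" "worst \<theta>0 < \<infinity>" and a: "\<And>\<theta>. \<theta> \<in> T \<Longrightarrow> ereal a < worst \<theta>"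
  obtains x where "x \<in> plans eps" "\<And>\<theta>. \<theta> \<in> T \<Longrightarrow> a \<le> val x \<theta>"
proof -
  define S where "S = {1..I} \<times> {1..J}"
  obtain b where b: "worst \<theta>0 = ereal b" using \<theta>0(2) worst_not_MInf[of \<theta>0] by (cases "worst \<theta>0") auto
  \<comment> \<open>On a ball sublevel sets are trivially bounded; the radius starts at
    \<open>norm \<theta>0\<close> so that \<open>\<theta>0\<close> remains available as the point
    where all values are at most b.\<close>
  have "\<exists>x\<in>plans eps. \<forall>\<theta>\<in>T \<inter> cball 0 (norm \<theta>0 + real n). a \<le> val x \<theta>" for n
  proof -
    have 1: "val x \<theta>0 \<le> b" if "x \<in> plans eps" for x using val_le_worst[OF that, of \<theta>0] by (simp add: b)
    have 2: "bounded {\<theta>\<in>T \<inter> cball 0 (norm \<theta>0 + real n). \<forall>x\<in>plans eps. val x \<theta> \<le> b}"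
      by (rule bounded_subset[OF bounded_cball[of 0 "norm \<theta>0 + real n"]]) auto
    have 3: "\<exists>x\<in>plans eps. a < val x \<theta>" if "\<theta> \<in> T \<inter> cball 0 (norm \<theta>0 + real n)" for \<theta>
      using a[of \<theta>] that by (auto simp: worst_def less_SUP_iff)
    have 4: "convex (T \<inter> cball 0 (norm \<theta>0 + real n))" "closed (T \<inter> cball 0 (norm \<theta>0 + real n))"
      "\<theta>0 \<in> T \<inter> cball 0 (norm \<theta>0 + real n)"
      using T_convex T_closed \<theta>0(1) by (auto intro: convex_Int closed_Int)
    obtain x where "x \<in> plans eps" "\<And>\<theta>. \<theta> \<in> T \<inter> cball 0 (norm \<theta>0 + real n) \<Longrightarrow> a \<le> val x \<theta>"
      by (rule minimax_bounded_sublevel[OF 4(1,2) val_convex plans_mix_eps 4(3) 1 2 3]) (assumption | rule that)+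
    then show ?thesis by blast
  qed
  then obtain X where X: "\<And>n. X n \<in> plans eps" "\<And>n \<theta>. \<theta> \<in> T \<Longrightarrow> norm \<theta> \<le> norm \<theta>0 + real n \<Longrightarrow> a \<le> val (X n) \<theta>"
    by (metis IntI mem_cball_0)
  define Q where "Q n = fst (X n)" for n
  define Y where "Y n = fst (snd (X n))" for n
  define G where "G n = snd (snd (X n))" for n
  have Xe: "X n = (Q n, Y n, G n)" for n by (simp add: Q_def Y_def G_def)
  have XP: "(Q n, Y n, G n) \<in> plans eps" for n using X(1)[of n] by (simp add: Xe)
  have Q0: "0 \<le> Q n i j" and G0: "0 \<le> G n i j" if "(i, j) \<in> S" for n i j
    using that XP[of n] plans_gamma_nonneg[OF XP[of n]] by (auto simp: S_def plans_def)
  have Qp: "Q n i j \<le> p j" if "(i, j) \<in> S" for n i j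
  proof -
    have "Q n i j \<le> (\<Sum>i\<in>{1..I}. Q n i j)"
      using that Q0 by (intro member_le_sum) (auto simp: S_def)
    also have "\<dots> = p j" using that XP[of n] by (auto simp: S_def plans_def)
    finally show ?thesis .
  qed
  have Ge: "G n i j \<le> eps" if "(i, j) \<in> S" for n i j
  proof -
    have "G n i j \<le> (\<Sum>j\<in>{1..J}. G n i j)"
      using that G0 by (intro member_le_sum) (auto simp: S_def)
    also have "\<dots> \<le> (\<Sum>i\<in>{1..I}. \<Sum>j\<in>{1..J}. G n i j)"
      using that G0 by (intro member_le_sum sum_nonneg) (auto simp: S_def)
    also have "\<dots> \<le> eps" using XP[of n] by (auto simp: plans_def)
    finally show ?thesis .
  qed
  \<comment> \<open>Far out the cost dominates \<open>N * norm z\<close>, nearby the position is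
    bounded by R. The choice N = 1 bounds the moments, and arbitrary N excludes escaping
    mass.\<close>
  have moment: "\<exists>R\<ge>0. \<forall>n. norm (Q n i j *\<^sub>R Y n i j) \<le> Q n i j * R + G n i j / N" if ij: "(i, j) \<in> S" and N: "N > 0" for i j N
  proof -
    have ij': "i \<in> {1..I}" "j \<in> {1..J}" using ij by (auto simp: S_def)
    obtain R where R: "\<And>z. R \<le> norm z \<Longrightarrow> ereal (N * norm z) \<le> C j z" using growth[OF ij'(2), of N] by blast
    have "norm (Q n i j *\<^sub>R Y n i j) \<le> Q n i j * max 0 R + G n i j / N" for n
    proof (cases "R \<le> norm (Y n i j)")
      case True
      have "ereal (Q n i j) * ereal (N * norm (Y n i j)) \<le> ereal (Q n i j) * C j (Y n i j)"
        using R[OF True] Q0[OF ij] by (intro ereal_mult_left_mono) auto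
      also have "\<dots> \<le> ereal (G n i j)" using XP[of n] ij' by (auto simp: plans_def)
      finally have "Q n i j * norm (Y n i j) \<le> G n i j / N" using N by (simp add: field_simps)
      moreover have "0 \<le> Q n i j * max 0 R" using Q0[OF ij] by (intro mult_nonneg_nonneg) auto
      moreover have "norm (Q n i j *\<^sub>R Y n i j) = Q n i j * norm (Y n i j)" using Q0[OF ij, of n] by simp
      ultimately show ?thesis by linarith
    next
      case False
      then have "Q n i j * norm (Y n i j) \<le> Q n i j * max 0 R" using Q0[OF ij] by (intro mult_left_mono) auto
      moreover have "0 \<le> G n i j / N" using G0[OF ij] N by simp
      moreover have "norm (Q n i j *\<^sub>R Y n i j) = Q n i j * norm (Y n i j)" using Q0[OF ij, of n] by simp
      ultimately show ?thesis by linarith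
    qed
    then show ?thesis by (intro exI[of _ "max 0 R"]) auto
  qed
  define f where "f = (\<lambda>(i, j) n. (Q n i j, Q n i j *\<^sub>R Y n i j, G n i j))"
  have "bounded (range (f s))" if s: "s \<in> S" for s
  proof -
    obtain i j where ij: "s = (i, j)" by (cases s)
    with s have ijS: "(i, j) \<in> S" by simp
    obtain R where R: "R \<ge> 0" "\<And>n. norm (Q n i j *\<^sub>R Y n i j) \<le> Q n i j * R + G n i j / 1"
      using moment[OF ijS, of 1] by auto
    have m: "norm (Q n i j *\<^sub>R Y n i j) \<le> p j * R + eps" for n
    proof -
      have "Q n i j * R \<le> p j * R" using Qp[OF ijS] R(1) by (intro mult_right_mono)
      then show ?thesis using R(2)[of n] Ge[OF ijS, of n] by simp
    qed
    have "range (f s) \<subseteq> {0..p j} \<times> cball 0 (p j * R + eps) \<times> {0..eps}"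
      using Q0[OF ijS] G0[OF ijS] Qp[OF ijS] Ge[OF ijS] m by (auto simp: f_def ij)
    moreover have "bounded ({0..p j} \<times> cball (0::'d) (p j * R + eps) \<times> {0..eps})"
      by (intro bounded_Times bounded_cball bounded_closed_interval)
    ultimately show ?thesis by (rule bounded_subset[rotated])
  qed
  moreover have "finite S" by (simp add: S_def)
  ultimately obtain r lim where r: "strict_mono r" and lim: "\<And>s. s \<in> S \<Longrightarrow> (\<lambda>n. f s (r n)) \<longlonglongrightarrow> lim s"
    using finite_family_convergent_subseq[of S f] by blast
  define q where "q i j = fst (lim (i, j))" for i j
  define m where "m i j = fst (snd (lim (i, j)))" for i j
  define g where "g i j = snd (snd (lim (i, j)))" for i j
  define z where "z i j = (if q i j = 0 then zh j else m i j /\<^sub>R q i j)" for i j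
  have limq: "(\<lambda>n. Q (r n) i j) \<longlonglongrightarrow> q i j" if "(i, j) \<in> S" for i j
    using tendsto_fst[OF lim[OF that]] by (simp add: f_def q_def)
  have limm: "(\<lambda>n. Q (r n) i j *\<^sub>R Y (r n) i j) \<longlonglongrightarrow> m i j" if "(i, j) \<in> S" for i j
    using tendsto_fst[OF tendsto_snd[OF lim[OF that]]] by (simp add: f_def m_def)
  have limg: "(\<lambda>n. G (r n) i j) \<longlonglongrightarrow> g i j" if "(i, j) \<in> S" for i j
    using tendsto_snd[OF tendsto_snd[OF lim[OF that]]] by (simp add: f_def g_def)
  have q0: "0 \<le> q i j" and g0: "0 \<le> g i j" if "(i, j) \<in> S" for i j
    using LIMSEQ_le_const[OF limq[OF that]] LIMSEQ_le_const[OF limg[OF that]] Q0[OF that] G0[OF that] by auto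
  have m_eq: "m i j = q i j *\<^sub>R z i j" if ij: "(i, j) \<in> S" for i j
  proof (cases "q i j = 0")
    case True
    \<comment> \<open>Without limiting mass only the cost term survives in \<open>moment\<close>; as
      N is arbitrary, the limiting moment vanishes.\<close>
    have "norm (m i j) \<le> g i j / N" if N: "N > 0" for N
    proof -
      obtain R where R: "\<And>n. norm (Q n i j *\<^sub>R Y n i j) \<le> Q n i j * R + G n i j / N"
        using moment[OF ij N] by blast
      have "(\<lambda>n. Q (r n) i j * R + G (r n) i j / N) \<longlonglongrightarrow> q i j * R + g i j / N"
        using N by (intro tendsto_intros limq limg ij) auto
      from LIMSEQ_le[OF tendsto_norm[OF limm[OF ij]] this] R show ?thesis by (auto simp: True)
    qed
    then have le: "norm (m i j) * N \<le> g i j" if "N > 0" for N using that by (simp add: field_simps)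
    have "m i j = 0"
    proof (rule ccontr)
      assume "m i j \<noteq> 0"
      then show False using le[of "(g i j + 1) / norm (m i j)"] g0[OF ij] by (simp add: field_simps)
    qed
    then show ?thesis using True by simp
  qed (simp add: z_def)
  have "(q, z, g) \<in> plans eps"
  proof -
    have 1: "0 \<le> q i j \<and> ereal (q i j) * C j (z i j) \<le> ereal (g i j)" if "i \<in> {1..I}" "j \<in> {1..J}" for i j
    proof
      have ij: "(i, j) \<in> S" using that by (simp add: S_def)
      show "0 \<le> q i j" by (rule q0[OF ij])
      show "ereal (q i j) * C j (z i j) \<le> ereal (g i j)"
      proof (rule cost_le_of_minorants[OF that(2) q0[OF ij] g0[OF ij]])
        fix v b assume "\<And>w. ereal (v \<bullet> w + b) \<le> C j w"
        then have "Q (r n) i j * (v \<bullet> Y (r n) i j + b) \<le> G (r n) i j" for n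
          by (rule minorant_le_gamma[OF XP that])
        then have *: "v \<bullet> (Q (r n) i j *\<^sub>R Y (r n) i j) + b * Q (r n) i j \<le> G (r n) i j" for n
          by (simp add: algebra_simps)
        have "(\<lambda>n. v \<bullet> (Q (r n) i j *\<^sub>R Y (r n) i j) + b * Q (r n) i j) \<longlonglongrightarrow> v \<bullet> m i j + b * q i j"
          by (intro tendsto_intros limq limm ij)
        then have "v \<bullet> m i j + b * q i j \<le> g i j" by (rule LIMSEQ_le[OF _ limg[OF ij]]) (use * in auto)
        then show "q i j * (v \<bullet> z i j + b) \<le> g i j" by (simp add: m_eq[OF ij] algebra_simps)
      qed
    qed
    have 2: "(\<Sum>i\<in>{1..I}. q i j) = p j" if "j \<in> {1..J}" for j
    proof (rule LIMSEQ_unique)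
      show "(\<lambda>n. \<Sum>i\<in>{1..I}. Q (r n) i j) \<longlonglongrightarrow> (\<Sum>i\<in>{1..I}. q i j)"
        using that by (intro tendsto_sum limq) (auto simp: S_def)
      have "(\<Sum>i\<in>{1..I}. Q (r n) i j) = p j" for n using XP[of "r n"] that by (auto simp: plans_def)
      then show "(\<lambda>n. \<Sum>i\<in>{1..I}. Q (r n) i j) \<longlonglongrightarrow> p j" by simp
    qed
    have "(\<lambda>n. \<Sum>i\<in>{1..I}. \<Sum>j\<in>{1..J}. G (r n) i j) \<longlonglongrightarrow> (\<Sum>i\<in>{1..I}. \<Sum>j\<in>{1..J}. g i j)"
      by (intro tendsto_sum limg) (auto simp: S_def)
    then have "(\<Sum>i\<in>{1..I}. \<Sum>j\<in>{1..J}. g i j) \<le> eps"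
      by (rule LIMSEQ_le_const2) (use XP in \<open>auto simp: plans_def\<close>)
    then show ?thesis using 1 2 by (auto simp: plans_def)
  qed
  moreover have "a \<le> val (q, z, g) \<theta>" if \<theta>: "\<theta> \<in> T" for \<theta>
  proof -
    \<comment> \<open>Each piece is replaced by a supporting affine function at the limit position.
      The resulting upper bounds \<open>U n\<close> depend only on masses and moments, so they
      converge, and their limit is the value of the limit plan.\<close>
    have "\<exists>s. \<forall>x. u i \<theta> x \<le> u i \<theta> (z i j) + s \<bullet> (x - z i j)" if "i \<in> {1..I}" for i j
      by (rule convex_supergradient[OF u_concave[OF that]]) blast
    then obtain s where s: "\<And>i j x. i \<in> {1..I} \<Longrightarrow> u i \<theta> x \<le> u i \<theta> (z i j) + s i j \<bullet> (x - z i j)" by metis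
    define U where "U n = (\<Sum>i\<in>{1..I}. \<Sum>j\<in>{1..J}. Q n i j * u i \<theta> (z i j) + s i j \<bullet> (Q n i j *\<^sub>R Y n i j - Q n i j *\<^sub>R z i j))" for n
    have "val (X n) \<theta> \<le> U n" for n
      unfolding U_def Xe val_def prod.case
    proof (intro sum_mono)
      fix i j assume ij: "i \<in> {1..I}" "j \<in> {1..J}"
      have "Q n i j * u i \<theta> (Y n i j) \<le> Q n i j * (u i \<theta> (z i j) + s i j \<bullet> (Y n i j - z i j))"
        using s[OF ij(1)] Q0 ij by (intro mult_left_mono) (auto simp: S_def)
      then show "Q n i j * u i \<theta> (Y n i j) \<le> Q n i j * u i \<theta> (z i j) + s i j \<bullet> (Q n i j *\<^sub>R Y n i j - Q n i j *\<^sub>R z i j)"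
        by (simp add: algebra_simps)
    qed
    moreover have "(\<lambda>n. U (r n)) \<longlonglongrightarrow> (\<Sum>i\<in>{1..I}. \<Sum>j\<in>{1..J}. q i j * u i \<theta> (z i j) + s i j \<bullet> (m i j - q i j *\<^sub>R z i j))"
      unfolding U_def by (intro tendsto_intros limq limm) (auto simp: S_def)
    moreover have "(\<Sum>i\<in>{1..I}. \<Sum>j\<in>{1..J}. q i j * u i \<theta> (z i j) + s i j \<bullet> (m i j - q i j *\<^sub>R z i j)) = val (q, z, g) \<theta>"
      unfolding val_def prod.case by (intro sum.cong refl) (simp add: m_eq S_def)
    moreover obtain N :: nat where "norm \<theta> \<le> real N" using real_arch_simple by blast
    then have "a \<le> val (X (r n)) \<theta>" if "n \<ge> N" for n
      using that seq_suble[OF r, of n] by (intro X(2)[OF \<theta>]) (smt (verit) norm_ge_zero of_nat_mono)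
    ultimately show ?thesis
      by (intro LIMSEQ_le_const[of "\<lambda>n. U (r n)"]) (auto intro: order_trans)
  qed
  ultimately show thesis using that by blast
qed

end

section \<open>Expectations and barycenters of couplings\<close>

lemma e2ennreal_max_0_ereal: "e2ennreal (max 0 (ereal r)) = ennreal r"
  unfolding e2ennreal_ereal[symmetric] by (simp only: e2ennreal_def max.left_idem)

text \<open>An integrable majorant bounds the integral of the positive part, so the difference in
  \<open>eexpect\<close> is meaningful even if the negative part has infinite integral.\<close>

lemma eexpect_distr_le:
  assumes X: "X \<in> measurable M borel" and f: "f \<in> borel_measurable borel"
    and h: "integrable M h" and le: "AE w in M. f (X w) \<le> ereal (h w)"
  shows "eexpect (distr M borel X) f \<le> ereal (\<integral>w. h w \<partial>M)"
proof -
  have fin: "(\<integral>\<^sup>+w. ennreal (h w) \<partial>M) < \<infinity>" "(\<integral>\<^sup>+w. ennreal (- h w) \<partial>M) < \<infinity>"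
    using h by (auto simp: real_integrable_def less_top[symmetric])
  have "(\<integral>\<^sup>+z. e2ennreal (max 0 (f z)) \<partial>distr M borel X) = (\<integral>\<^sup>+w. e2ennreal (max 0 (f (X w))) \<partial>M)"
    using X f by (intro nn_integral_distr) auto
  also have "\<dots> \<le> (\<integral>\<^sup>+w. ennreal (h w) \<partial>M)"
    using le
  proof (intro nn_integral_mono_AE, eventually_elim)
    case (elim w)
    have "e2ennreal (max 0 (f (X w))) \<le> e2ennreal (max 0 (ereal (h w)))"
      using elim by (intro e2ennreal_mono max.mono) auto
    then show ?case by (simp only: e2ennreal_max_0_ereal)
  qed
  finally have pos: "(\<integral>\<^sup>+z. e2ennreal (max 0 (f z)) \<partial>distr M borel X) \<le> (\<integral>\<^sup>+w. ennreal (h w) \<partial>M)" .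
  have "(\<integral>\<^sup>+w. ennreal (- h w) \<partial>M) \<le> (\<integral>\<^sup>+w. e2ennreal (max 0 (- f (X w))) \<partial>M)"
    using le
  proof (intro nn_integral_mono_AE, eventually_elim)
    case (elim w)
    have "ereal (- h w) \<le> - f (X w)" using elim by (metis ereal_minus_le_minus uminus_ereal.simps(1))
    then have "e2ennreal (max 0 (ereal (- h w))) \<le> e2ennreal (max 0 (- f (X w)))"
      by (intro e2ennreal_mono max.mono) auto
    then show ?case by (simp only: e2ennreal_max_0_ereal)
  qed
  also have "\<dots> = (\<integral>\<^sup>+z. e2ennreal (max 0 (- f z)) \<partial>distr M borel X)"
    using X f by (intro nn_integral_distr[symmetric]) auto
  finally have neg: "(\<integral>\<^sup>+w. ennreal (- h w) \<partial>M) \<le> (\<integral>\<^sup>+z. e2ennreal (max 0 (- f z)) \<partial>distr M borel X)" .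
  have conv: "enn2ereal x = ereal (enn2real x)" if "x < \<infinity>" for x
    using that by (cases x) (auto simp: less_top)
  have "eexpect (distr M borel X) f \<le> enn2ereal (\<integral>\<^sup>+w. ennreal (h w) \<partial>M) - enn2ereal (\<integral>\<^sup>+w. ennreal (- h w) \<partial>M)"
    unfolding eexpect_def using pos neg by (intro ereal_minus_mono) (auto simp: less_eq_ennreal.rep_eq)
  also have "\<dots> = ereal (\<integral>w. h w \<partial>M)"
    using fin h by (simp add: conv real_lebesgue_integral_def)
  finally show ?thesis .
qed

lemma eexpect_distr_eq:
  assumes X: "X \<in> measurable M borel" and f: "f \<in> borel_measurable borel"
    and h: "integrable M h" and eq: "\<And>w. w \<in> space M \<Longrightarrow> f (X w) = ereal (h w)"
  shows "eexpect (distr M borel X) f = ereal (\<integral>w. h w \<partial>M)"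
proof -
  have conv: "enn2ereal x = ereal (enn2real x)" if "x < \<infinity>" for x
    using that by (cases x) (auto simp: less_top)
  have fin: "(\<integral>\<^sup>+w. ennreal (h w) \<partial>M) < \<infinity>" "(\<integral>\<^sup>+w. ennreal (- h w) \<partial>M) < \<infinity>"
    using h by (auto simp: real_integrable_def less_top[symmetric])
  have "(\<integral>\<^sup>+z. e2ennreal (max 0 (f z)) \<partial>distr M borel X) = (\<integral>\<^sup>+w. e2ennreal (max 0 (f (X w))) \<partial>M)"
    using X f by (intro nn_integral_distr) auto
  also have "\<dots> = (\<integral>\<^sup>+w. ennreal (h w) \<partial>M)"
    by (intro nn_integral_cong) (simp only: eq e2ennreal_max_0_ereal)
  finally have pos: "(\<integral>\<^sup>+z. e2ennreal (max 0 (f z)) \<partial>distr M borel X) = (\<integral>\<^sup>+w. ennreal (h w) \<partial>M)" .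
  have "(\<integral>\<^sup>+z. e2ennreal (max 0 (- f z)) \<partial>distr M borel X) = (\<integral>\<^sup>+w. e2ennreal (max 0 (- f (X w))) \<partial>M)"
    using X f by (intro nn_integral_distr) auto
  also have "\<dots> = (\<integral>\<^sup>+w. ennreal (- h w) \<partial>M)"
    by (intro nn_integral_cong) (simp only: eq e2ennreal_max_0_ereal uminus_ereal.simps)
  finally have neg: "(\<integral>\<^sup>+z. e2ennreal (max 0 (- f z)) \<partial>distr M borel X) = (\<integral>\<^sup>+w. ennreal (- h w) \<partial>M)" .
  show ?thesis
    unfolding eexpect_def pos neg using fin h by (simp add: conv real_lebesgue_integral_def)
qed

lemma eexpect_discrete_dist:
  assumes "finite A" "\<And>a. a \<in> A \<Longrightarrow> 0 \<le> w a" "f \<in> borel_measurable borel" "\<And>z. f z = ereal (g z)"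
  shows "eexpect (discrete_dist A w x) f = ereal (\<Sum>a\<in>A. w a * g (x a))"
proof -
  have "eexpect (discrete_dist A w x) f = ereal (\<integral>a. g (x a) \<partial>point_measure A (\<lambda>a. ennreal (w a)))"
    unfolding discrete_dist_def using assms
    by (intro eexpect_distr_eq integrable_point_measure_finite) (auto simp: measurable_def space_point_measure sets_point_measure)
  also have "(\<integral>a. g (x a) \<partial>point_measure A (\<lambda>a. ennreal (w a))) = (\<Sum>a\<in>A. w a * g (x a))"
    using assms by (simp add: lebesgue_integral_point_measure_finite)
  finally show ?thesis .
qed

lemma integral_le_nn_integral:
  assumes r: "integrable M r" and le: "\<And>w. w \<in> space M \<Longrightarrow> ennreal (r w) \<le> G w" and fin: "(\<integral>\<^sup>+w. G w \<partial>M) < \<infinity>"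
  shows "(\<integral>w. r w \<partial>M) \<le> enn2real (\<integral>\<^sup>+w. G w \<partial>M)"
proof -
  have "(\<integral>w. r w \<partial>M) \<le> enn2real (\<integral>\<^sup>+w. ennreal (r w) \<partial>M)"
    using real_lebesgue_integral_def[OF r] by simp
  also have "\<dots> \<le> enn2real (\<integral>\<^sup>+w. G w \<partial>M)"
    using fin le by (intro enn2real_mono nn_integral_mono) auto
  finally show ?thesis .
qed

context dro_data begin

lemma C_measurable: "j \<in> {1..J} \<Longrightarrow> C j \<in> borel_measurable borel"
proof (rule borel_measurableI_le)
  fix y assume j: "j \<in> {1..J}"
  show "{x \<in> space borel. C j x \<le> y} \<in> sets borel"
  proof (cases y)
    case (real r)
    then show ?thesis using C_closed[OF j, of r] by simp
  next
    case MInf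
    then have "{x \<in> space borel. C j x \<le> y} = {}" using C_nonneg[OF j] by auto
    then show ?thesis by simp
  qed simp
qed

lemma u_continuous: "i \<in> {1..I} \<Longrightarrow> continuous_on UNIV (u i \<theta>)"
  using continuous_on_minus[OF convex_on_continuous[OF open_UNIV u_concave, of i \<theta>]] by simp

text \<open>On the unit sphere around \<open>zh j\<close> the cost is bounded away from zero by compactness, and
  convexity propagates this bound outwards.\<close>

lemma cost_linear_growth:
  assumes j: "j \<in> {1..J}"
  obtains \<kappa> where "0 < \<kappa>" "\<And>z. ereal (\<kappa> * (norm (z - zh j) - 1)) \<le> C j z"
proof -
  have "sphere (zh j) 1 \<subseteq> (\<Union>n\<in>UNIV. {z. ereal (1 / real (Suc n)) < C j z})"
  proof
    fix z assume "z \<in> sphere (zh j) 1"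
    then have "z \<noteq> zh j" by auto
    then have "0 < C j z" using C_zero[OF j, of z] C_nonneg[OF j, of z] by (metis order_le_less)
    then obtain r where r: "0 < ereal r" "ereal r < C j z" using ereal_dense2 by blast
    then obtain n where "1 / real (Suc n) < r" using nat_approx_posE[of r] by auto
    then have "ereal (1 / real (Suc n)) < C j z" using r by (metis ereal_less(2) less_trans less_ereal.simps(1))
    then show "z \<in> (\<Union>n\<in>UNIV. {z. ereal (1 / real (Suc n)) < C j z})" by blast
  qed
  moreover have "open {z. ereal r < C j z}" for r
  proof -
    have "{z. ereal r < C j z} = - {z. C j z \<le> ereal r}" by auto
    then show ?thesis using C_closed[OF j] by (simp add: open_Compl)
  qed
  ultimately obtain N where N: "finite N" "sphere (zh j) 1 \<subseteq> (\<Union>n\<in>N. {z. ereal (1 / real (Suc n)) < C j z})"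
    using compactE_image[OF compact_sphere, of UNIV "\<lambda>n. {z. ereal (1 / real (Suc n)) < C j z}" "zh j" 1]
    by (metis subset_UNIV)
  \<comment> \<open>A common lower bound for the finitely many covering levels; inserting 0 keeps
    \<open>Max\<close> meaningful for an empty cover.\<close>
  define \<kappa> where "\<kappa> = 1 / real (Suc (Max (insert 0 N)))"
  have \<kappa>: "\<kappa> > 0" by (simp add: \<kappa>_def)
  have sph: "ereal \<kappa> \<le> C j z" if z: "z \<in> sphere (zh j) 1" for z
  proof -
    obtain n where n: "n \<in> N" "ereal (1 / real (Suc n)) < C j z" using N z by auto
    then have "n \<le> Max (insert 0 N)" using N by simp
    then have "\<kappa> \<le> 1 / real (Suc n)" by (simp add: \<kappa>_def field_simps)
    then show ?thesis using n(2) by (meson ereal_less_eq(3) less_imp_le order_trans)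
  qed
  have "ereal (\<kappa> * (norm (z - zh j) - 1)) \<le> C j z" for z
  proof (cases "norm (z - zh j) \<le> 1")
    case True
    then have "\<kappa> * (norm (z - zh j) - 1) \<le> 0" using \<kappa> by (simp add: mult_nonneg_nonpos)
    then have "ereal (\<kappa> * (norm (z - zh j) - 1)) \<le> 0" by (simp add: zero_ereal_def)
    then show ?thesis using C_nonneg[OF j, of z] by (rule order_trans)
  next
    case False
    define r where "r = norm (z - zh j)"
    have r: "r > 1" using False by (simp add: r_def)
    show ?thesis
    proof (cases "C j z")
      case (real s)
      have "C j ((1 / r) *\<^sub>R z + (1 - 1 / r) *\<^sub>R zh j) \<le> ereal (1 / r * s + (1 - 1 / r) * 0)"
        using r real C_zero[OF j, of "zh j"] by (intro econvex_comb[OF C_convex[OF j]]) (auto simp: zero_ereal_def)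
      moreover have "(1 / r) *\<^sub>R z + (1 - 1 / r) *\<^sub>R zh j \<in> sphere (zh j) 1"
      proof -
        have "zh j - ((1 / r) *\<^sub>R z + (1 - 1 / r) *\<^sub>R zh j) = - ((1 / r) *\<^sub>R (z - zh j))" by (simp add: algebra_simps)
        then have "dist (zh j) ((1 / r) *\<^sub>R z + (1 - 1 / r) *\<^sub>R zh j) = norm ((1 / r) *\<^sub>R (z - zh j))"
          by (metis dist_norm norm_minus_cancel)
        also have "\<dots> = 1" using r by (auto simp: r_def)
        finally show ?thesis by simp
      qed
      ultimately have "ereal \<kappa> \<le> ereal (1 / r * s + (1 - 1 / r) * 0)" using sph order_trans by blast
      then have "\<kappa> * r \<le> s" using r by (simp add: field_simps)
      moreover have "\<kappa> * (r - 1) \<le> \<kappa> * r" using \<kappa> by simp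
      ultimately show ?thesis using real by (simp add: r_def)
    qed (use C_nonneg[OF j, of z] in auto)
  qed
  then show thesis using that \<kappa> by blast
qed

definition loss_of :: "'m \<Rightarrow> 'd \<Rightarrow> real" where
  "loss_of \<theta> z = Max ((\<lambda>i. u i \<theta> z) ` {1..I})"

lemma u_le_loss_of: "i \<in> {1..I} \<Longrightarrow> u i \<theta> z \<le> loss_of \<theta> z"
  unfolding loss_of_def by (intro Max_ge) auto

lemma loss_of_measurable: "loss_of \<theta> \<in> borel_measurable borel"
proof -
  have "(\<lambda>z. Max ((\<lambda>i. u i \<theta> z) ` {1..I})) \<in> borel_measurable borel"
    using u_continuous by (intro borel_measurable_Max) (auto intro: borel_measurable_continuous_onI)
  then show ?thesis by (simp add: loss_of_def[abs_def])
qed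

text \<open>Ties go to the smallest index, so that these sets form a Borel partition.\<close>

definition active :: "'m \<Rightarrow> nat \<Rightarrow> 'd set" where
  "active \<theta> i = {z. u i \<theta> z = loss_of \<theta> z \<and> (\<forall>k\<in>{1..I}. k < i \<longrightarrow> u k \<theta> z < loss_of \<theta> z)}"

lemma active_borel: "i \<in> {1..I} \<Longrightarrow> active \<theta> i \<in> sets borel"
proof -
  assume i: "i \<in> {1..I}"
  have m: "u k \<theta> \<in> borel_measurable borel" if "k \<in> {1..I}" for k
    using u_continuous[OF that] by (intro borel_measurable_continuous_onI)
  note [measurable] = m[OF i] loss_of_measurable
  have "{z \<in> space borel. u i \<theta> z = loss_of \<theta> z} \<in> sets borel" by measurable
  moreover have "{z \<in> space borel. u k \<theta> z < loss_of \<theta> z} \<in> sets borel" if "k \<in> {1..I}" for k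
    using m[OF that] by measurable
  ultimately have "{z \<in> space borel. u i \<theta> z = loss_of \<theta> z} \<inter>
      (\<Inter>k\<in>{1..I}. if k < i then {z \<in> space borel. u k \<theta> z < loss_of \<theta> z} else UNIV) \<in> sets borel" (is "?A \<in> _")
    using I by (intro sets.Int sets.finite_INT) auto
  moreover have "?A = active \<theta> i" by (auto simp: active_def split: if_splits)
  ultimately show ?thesis by simp
qed

lemma sum_indicator_active: "(\<Sum>i\<in>{1..I}. indicator (active \<theta> i) z) = (1::real)"
proof -
  define i0 where "i0 = (LEAST i. i \<in> {1..I} \<and> u i \<theta> z = loss_of \<theta> z)"
  have "loss_of \<theta> z \<in> (\<lambda>i. u i \<theta> z) ` {1..I}" unfolding loss_of_def using I by (intro Max_in) auto
  then have ex: "\<exists>i. i \<in> {1..I} \<and> u i \<theta> z = loss_of \<theta> z" by force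
  have i0: "i0 \<in> {1..I}" "u i0 \<theta> z = loss_of \<theta> z" using LeastI_ex[OF ex] by (auto simp: i0_def)
  have least: "i0 \<le> i" if "i \<in> {1..I}" "u i \<theta> z = loss_of \<theta> z" for i
    unfolding i0_def using that by (intro Least_le) auto
  have "z \<in> active \<theta> i \<longleftrightarrow> i = i0" if i: "i \<in> {1..I}" for i
  proof
    assume "z \<in> active \<theta> i"
    then have "u i \<theta> z = loss_of \<theta> z" "\<not> i0 < i" using i0 by (auto simp: active_def)
    then show "i = i0" using least[OF i] by simp
  next
    assume "i = i0"
    moreover have "u k \<theta> z < loss_of \<theta> z" if "k \<in> {1..I}" "k < i0" for k
      using u_le_loss_of[OF that(1), of \<theta> z] least[OF that(1)] that(2) by force
    ultimately show "z \<in> active \<theta> i" using i0 by (auto simp: active_def)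
  qed
  then have "(\<Sum>i\<in>{1..I}. indicator (active \<theta> i) z) = (\<Sum>i\<in>{1..I}. if i = i0 then 1 else (0::real))"
    by (intro sum.cong) (auto simp: indicator_def)
  then show ?thesis using i0 by simp
qed

end

text \<open>Holds for all signs because \<open>ennreal\<close> truncates negative reals to
  0.\<close>

lemma ennreal_add_le: "ennreal (x + y) \<le> ennreal x + ennreal y"
proof -
  have "ennreal (x + y) \<le> ennreal (max 0 x + max 0 y)" by (intro ennreal_leI) auto
  also have "\<dots> = ennreal (max 0 x) + ennreal (max 0 y)" by (intro ennreal_plus) auto
  also have "\<dots> = ennreal x + ennreal y" by (simp add: max_def ennreal_neg)
  finally show ?thesis .
qed

context dro_data begin

lemma ennreal_mult_e2ennreal_mono:
  assumes "0 \<le> w" "ereal a \<le> c"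
  shows "ennreal (w * a) \<le> ennreal w * e2ennreal c"
proof -
  have "ennreal (w * a) = ennreal w * e2ennreal (ereal a)" using assms(1) by (simp add: ennreal_mult')
  also have "\<dots> \<le> ennreal w * e2ennreal c" using assms(2) by (intro mult_left_mono e2ennreal_mono) auto
  finally show ?thesis .
qed

text \<open>A coupling is replaced by the plan of barycenters of its restrictions to atoms of the second
  marginal and to activity regions of the loss: Jensen's inequality lowers the cost and raises the
  expected loss. Atoms \<open>zh j\<close> need not be distinct, so \<open>P j\<close> is the total weight at \<open>zh j\<close>.\<close>

lemma plan_of_coupling:
  fixes \<pi> :: "('d \<times> 'd) measure"
  assumes pi: "prob_space \<pi>" "sets \<pi> = sets borel" and snd: "distr \<pi> borel snd = discrete_dist {1..J} p zh"
    and k: "AE w in \<pi>. \<forall>j\<in>{1..J}. snd w = zh j \<longrightarrow> e2ennreal (C j (fst w)) \<le> k w"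
    and cost: "(\<integral>\<^sup>+w. k w \<partial>\<pi>) \<le> ennreal e" and e: "0 \<le> e"
  shows "\<exists>x\<in>plans e. eexpect (distr \<pi> borel fst) (\<lambda>z. ereal (loss_of \<theta> z)) \<le> ereal (val x \<theta>)"
proof -
  interpret prob_space \<pi> by fact
  have [measurable_cong]: "sets \<pi> = sets (borel :: ('d \<times> 'd) measure)" by fact
  have space: "space \<pi> = UNIV" using sets_eq_imp_space_eq[OF pi(2)] by simp
  have [measurable]: "fst \<in> measurable \<pi> (borel :: 'd measure)" "snd \<in> measurable \<pi> (borel :: 'd measure)"
    by (auto simp: measurable_cong_sets[OF pi(2) refl] borel_measurable_continuous_onI continuous_on_fst continuous_on_snd)
  define P where "P j = (\<Sum>k\<in>{1..J}. if zh k = zh j then p k else 0)" for j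
  have P: "P j > 0" if "j \<in> {1..J}" for j
  proof -
    have "p j \<le> P j" unfolding P_def using that p by (intro order_trans[OF _ member_le_sum[of j]]) (auto intro: less_imp_le)
    then show ?thesis using p[OF that] by simp
  qed
  have em_snd: "emeasure \<pi> (snd -` B) = (\<Sum>j\<in>{1..J}. ennreal (p j) * indicator B (zh j))" if "B \<in> sets borel" for B
  proof -
    have "emeasure \<pi> (snd -` B) = emeasure (distr \<pi> borel snd) B"
      using that by (subst emeasure_distr) (auto simp: space)
    then show ?thesis using that by (simp add: snd emeasure_discrete_dist)
  qed
  have atom: "measure \<pi> (snd -` {zh j}) = P j" for j
  proof -
    have "emeasure \<pi> (snd -` {zh j}) = (\<Sum>k\<in>{1..J}. ennreal (if zh k = zh j then p k else 0))"
      by (subst em_snd, simp) (rule sum.cong, auto simp: indicator_def)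
    also have "\<dots> = ennreal (P j)" unfolding P_def using p by (intro sum_ennreal) (auto intro: less_imp_le)
    finally have "emeasure \<pi> (snd -` {zh j}) = ennreal (P j)" .
    moreover have "0 \<le> P j" unfolding P_def using p by (intro sum_nonneg) (auto intro: less_imp_le)
    ultimately show ?thesis by (simp add: measure_def)
  qed
  have ae_snd: "AE w in \<pi>. snd w \<in> zh ` {1..J}"
  proof (rule AE_I')
    have "closed (zh ` {1..J})" by (intro finite_imp_closed) auto
    then have b: "- zh ` {1..J} \<in> sets borel" by (intro borel_open) auto
    have "emeasure \<pi> (snd -` (- zh ` {1..J})) = 0"
      by (subst em_snd[OF b]) (auto simp: indicator_def)
    then show "snd -` (- zh ` {1..J}) \<in> null_sets \<pi>"
      using measurable_sets[of snd \<pi> borel, OF _ b] by (simp add: null_sets_def space)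
  qed auto
  \<comment> \<open>A partition of unity over pieces and atoms: indices that share an atom divide
    its mass in proportion to their \<open>p j\<close>.\<close>
  define W where "W i j w = p j / P j * (indicator {zh j} (snd w) * indicator (active \<theta> i) (fst w))" for i j and w :: "'d \<times> 'd"
  have W0: "0 \<le> W i j w" if "j \<in> {1..J}" for i j w
    using p[OF that] P[OF that] by (auto simp: W_def indicator_def)
  have Wm [measurable]: "W i j \<in> borel_measurable \<pi>" if "i \<in> {1..I}" for i j
    unfolding W_def[abs_def] using active_borel[OF that, of \<theta>] by measurable
  have W_bdd: "norm (W i j w) \<le> p j / P j" if "j \<in> {1..J}" for i j w
    using p[OF that] P[OF that] by (auto simp: W_def indicator_def)
  have W_int: "integrable \<pi> (W i j)" if "i \<in> {1..I}" "j \<in> {1..J}" for i j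
    using W_bdd[OF that(2)] Wm[OF that(1)] by (intro integrable_const_bound[of _ "p j / P j"]) auto
  have W_sum_i: "(\<Sum>i\<in>{1..I}. W i j w) = p j / P j * indicator {zh j} (snd w)" for j w
    unfolding W_def sum_distrib_left[symmetric] sum_indicator_active by simp
  have W_sum: "(\<Sum>i\<in>{1..I}. \<Sum>j\<in>{1..J}. W i j w) = 1" if w: "snd w \<in> zh ` {1..J}" for w
  proof -
    obtain j0 where j0: "j0 \<in> {1..J}" "snd w = zh j0" using w by auto
    have "(\<Sum>i\<in>{1..I}. \<Sum>j\<in>{1..J}. W i j w) = (\<Sum>j\<in>{1..J}. p j / P j * indicator {zh j} (snd w))"
      by (subst sum.swap) (simp only: W_sum_i)
    also have "\<dots> = (\<Sum>j\<in>{1..J}. (if zh j = zh j0 then p j else 0) / P j0)"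
    proof (intro sum.cong refl)
      fix j
      have "P j = P j0" if "zh j = zh j0" using that by (simp add: P_def)
      then show "p j / P j * indicator {zh j} (snd w) = (if zh j = zh j0 then p j else 0) / P j0"
        using j0 by (auto simp: indicator_def)
    qed
    also have "\<dots> = 1" using P[OF j0(1)] by (simp add: P_def flip: sum_divide_distrib)
    finally show ?thesis .
  qed
  define q where "q i j = (\<integral>w. W i j w \<partial>\<pi>)" for i j
  define \<Gamma> where "\<Gamma> i j = (\<integral>\<^sup>+w. ennreal (W i j w) * e2ennreal (C j (fst w)) \<partial>\<pi>)" for i j
  have [measurable]: "(\<lambda>w. C j (fst w)) \<in> borel_measurable \<pi>" if "j \<in> {1..J}" for j
    using C_measurable[OF that] by measurable
  have Gm: "(\<lambda>w. ennreal (W i j w) * e2ennreal (C j (fst w))) \<in> borel_measurable \<pi>" if "i \<in> {1..I}" "j \<in> {1..J}" for i j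
    using that by measurable
  have "(\<Sum>i\<in>{1..I}. \<Sum>j\<in>{1..J}. \<Gamma> i j) = (\<integral>\<^sup>+w. (\<Sum>i\<in>{1..I}. \<Sum>j\<in>{1..J}. ennreal (W i j w) * e2ennreal (C j (fst w))) \<partial>\<pi>)"
  proof -
    have "(\<Sum>i\<in>{1..I}. \<Sum>j\<in>{1..J}. \<Gamma> i j) = (\<Sum>i\<in>{1..I}. \<integral>\<^sup>+w. (\<Sum>j\<in>{1..J}. ennreal (W i j w) * e2ennreal (C j (fst w))) \<partial>\<pi>)"
      unfolding \<Gamma>_def by (intro sum.cong refl nn_integral_sum[symmetric] Gm)
    also have "\<dots> = (\<integral>\<^sup>+w. (\<Sum>i\<in>{1..I}. \<Sum>j\<in>{1..J}. ennreal (W i j w) * e2ennreal (C j (fst w))) \<partial>\<pi>)"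
      by (intro nn_integral_sum[symmetric] borel_measurable_sum Gm)
    finally show ?thesis .
  qed
  \<comment> \<open>Where \<open>W i j w\<close> is positive, \<open>snd w\<close> is the atom
    \<open>zh j\<close>, so each cost is at most \<open>k w\<close>; almost everywhere the weights
    sum to 1.\<close>
  also have "\<dots> \<le> (\<integral>\<^sup>+w. k w \<partial>\<pi>)"
  proof (rule nn_integral_mono_AE)
    show "AE w in \<pi>. (\<Sum>i\<in>{1..I}. \<Sum>j\<in>{1..J}. ennreal (W i j w) * e2ennreal (C j (fst w))) \<le> k w"
      using k ae_snd
    proof eventually_elim
    case (elim w)
    have "(\<Sum>i\<in>{1..I}. \<Sum>j\<in>{1..J}. ennreal (W i j w) * e2ennreal (C j (fst w))) \<le> (\<Sum>i\<in>{1..I}. \<Sum>j\<in>{1..J}. ennreal (W i j w) * k w)"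
    proof (intro sum_mono)
      fix i j assume "i \<in> {1..I}" "j \<in> {1..J}"
      then show "ennreal (W i j w) * e2ennreal (C j (fst w)) \<le> ennreal (W i j w) * k w"
        using elim(1) by (cases "snd w = zh j") (auto simp: W_def intro: mult_left_mono)
    qed
    also have "\<dots> = ennreal (\<Sum>i\<in>{1..I}. \<Sum>j\<in>{1..J}. W i j w) * k w"
    proof -
      have 1: "(\<Sum>j\<in>{1..J}. ennreal (W i j w)) = ennreal (\<Sum>j\<in>{1..J}. W i j w)" for i
        by (intro sum_ennreal W0)
      have 2: "(\<Sum>i\<in>{1..I}. ennreal (\<Sum>j\<in>{1..J}. W i j w)) = ennreal (\<Sum>i\<in>{1..I}. \<Sum>j\<in>{1..J}. W i j w)"
        by (intro sum_ennreal sum_nonneg W0)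
      show ?thesis by (simp only: sum_distrib_right[symmetric] 1 2)
    qed
    also have "\<dots> = k w" using W_sum[OF elim(2)] by simp
    finally show ?case .
    qed
  qed
  finally have \<Gamma>_sum: "(\<Sum>i\<in>{1..I}. \<Sum>j\<in>{1..J}. \<Gamma> i j) \<le> ennreal e" using cost by (rule order_trans)
  have \<Gamma>_fin: "\<Gamma> i j < \<infinity>" if "i \<in> {1..I}" "j \<in> {1..J}" for i j
  proof -
    have "\<Gamma> i j \<le> (\<Sum>j\<in>{1..J}. \<Gamma> i j)" using that by (intro member_le_sum) auto
    also have "\<dots> \<le> (\<Sum>i\<in>{1..I}. \<Sum>j\<in>{1..J}. \<Gamma> i j)" using that by (intro member_le_sum) auto
    also have "\<dots> \<le> ennreal e" by (rule \<Gamma>_sum)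
    finally show ?thesis by (rule le_less_trans) simp
  qed
  define \<gamma> where "\<gamma> i j = enn2real (\<Gamma> i j)" for i j
  have \<gamma>_sum: "(\<Sum>i\<in>{1..I}. \<Sum>j\<in>{1..J}. \<gamma> i j) \<le> e"
  proof -
    have "ennreal (\<Sum>i\<in>{1..I}. \<Sum>j\<in>{1..J}. \<gamma> i j) = (\<Sum>i\<in>{1..I}. \<Sum>j\<in>{1..J}. ennreal (\<gamma> i j))"
      by (simp add: \<gamma>_def sum_nonneg flip: sum_ennreal)
    also have "\<dots> = (\<Sum>i\<in>{1..I}. \<Sum>j\<in>{1..J}. \<Gamma> i j)"
      using \<Gamma>_fin by (intro sum.cong refl) (simp add: \<gamma>_def)
    finally have "ennreal (\<Sum>i\<in>{1..I}. \<Sum>j\<in>{1..J}. \<gamma> i j) \<le> ennreal e" using \<Gamma>_sum by simp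
    then show ?thesis using e by simp
  qed
  \<comment> \<open>Linear growth of the cost turns the finite cost \<open>\<Gamma> i j\<close> into
    a finite first moment, so barycenters exist.\<close>
  have M_int: "integrable \<pi> (\<lambda>w. W i j w *\<^sub>R fst w)" if ij: "i \<in> {1..I}" "j \<in> {1..J}" for i j
  proof (rule integrableI_bounded)
    show "(\<lambda>w. W i j w *\<^sub>R fst w) \<in> borel_measurable \<pi>" using Wm[OF ij(1)] by measurable
    obtain \<kappa> where \<kappa>: "0 < \<kappa>" "\<And>z. ereal (\<kappa> * (norm (z - zh j) - 1)) \<le> C j z" using cost_linear_growth[OF ij(2)] by blast
    define b where "b = norm (zh j) + 1"
    have "ennreal (norm (W i j w *\<^sub>R fst w)) \<le> ennreal (b * W i j w) + ennreal (1 / \<kappa>) * (ennreal (W i j w) * e2ennreal (C j (fst w)))" for w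
    proof -
      have "norm (fst w) \<le> b + (norm (fst w - zh j) - 1)"
        using norm_triangle_ineq[of "fst w - zh j" "zh j"] by (simp add: b_def)
      then have "W i j w * norm (fst w) \<le> W i j w * (b + (norm (fst w - zh j) - 1))"
        using W0[OF ij(2), of i w] by (rule mult_left_mono)
      then have "norm (W i j w *\<^sub>R fst w) \<le> W i j w * (b + (norm (fst w - zh j) - 1))"
        using W0[OF ij(2), of i w] by simp
      also have "\<dots> = b * W i j w + 1 / \<kappa> * (W i j w * (\<kappa> * (norm (fst w - zh j) - 1)))"
        using \<kappa>(1) by (simp add: algebra_simps)
      finally have "ennreal (norm (W i j w *\<^sub>R fst w)) \<le> ennreal (b * W i j w + 1 / \<kappa> * (W i j w * (\<kappa> * (norm (fst w - zh j) - 1))))"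
        by (rule ennreal_leI)
      also have "\<dots> \<le> ennreal (b * W i j w) + ennreal (1 / \<kappa> * (W i j w * (\<kappa> * (norm (fst w - zh j) - 1))))"
        by (rule ennreal_add_le)
      also have "ennreal (1 / \<kappa> * (W i j w * (\<kappa> * (norm (fst w - zh j) - 1)))) = ennreal (1 / \<kappa>) * ennreal (W i j w * (\<kappa> * (norm (fst w - zh j) - 1)))"
        using \<kappa>(1) by (intro ennreal_mult') simp
      finally show ?thesis
        using ennreal_mult_e2ennreal_mono[OF W0[OF ij(2)] \<kappa>(2)]
        by (meson add_left_mono mult_left_mono order_trans zero_le)
    qed
    then have "(\<integral>\<^sup>+w. ennreal (norm (W i j w *\<^sub>R fst w)) \<partial>\<pi>) \<le>
        (\<integral>\<^sup>+w. ennreal (b * W i j w) + ennreal (1 / \<kappa>) * (ennreal (W i j w) * e2ennreal (C j (fst w))) \<partial>\<pi>)"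
      by (rule nn_integral_mono)
    also have "\<dots> = (\<integral>\<^sup>+w. ennreal (b * W i j w) \<partial>\<pi>) + ennreal (1 / \<kappa>) * \<Gamma> i j"
      unfolding \<Gamma>_def using Gm[OF ij] Wm[OF ij(1), of j] by (simp add: nn_integral_add nn_integral_cmult)
    also have "\<dots> < \<infinity>"
    proof -
      have "integrable \<pi> (\<lambda>w. b * W i j w)" using W_int[OF ij] by simp
      then have "(\<integral>\<^sup>+w. ennreal (b * W i j w) \<partial>\<pi>) \<noteq> \<infinity>" unfolding real_integrable_def by blast
      then have "(\<integral>\<^sup>+w. ennreal (b * W i j w) \<partial>\<pi>) < \<infinity>" by (simp add: less_top)
      then show ?thesis using \<Gamma>_fin[OF ij] by (simp add: ennreal_mult_less_top)
    qed
    finally show "(\<integral>\<^sup>+w. ennreal (norm (W i j w *\<^sub>R fst w)) \<partial>\<pi>) < \<infinity>" .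
  qed
  define m where "m i j = (\<integral>w. W i j w *\<^sub>R fst w \<partial>\<pi>)" for i j
  define z where "z i j = (if q i j = 0 then zh j else m i j /\<^sub>R q i j)" for i j
  have q0: "0 \<le> q i j" if "j \<in> {1..J}" for i j unfolding q_def using W0[OF that] by (intro Bochner_Integration.integral_nonneg) auto
  have m_eq: "m i j = q i j *\<^sub>R z i j" if ij: "i \<in> {1..I}" "j \<in> {1..J}" for i j
  proof (cases "q i j = 0")
    case True
    then have "AE w in \<pi>. W i j w = 0"
      using integral_nonneg_eq_0_iff_AE[OF W_int[OF ij]] W0[OF ij(2)] by (simp add: q_def)
    then have "m i j = (\<integral>w. 0 \<partial>\<pi>)" unfolding m_def
      using Wm[OF ij(1), of j] by (intro integral_cong_AE) auto
    then show ?thesis using True by simp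
  qed (simp add: z_def)
  \<comment> \<open>Integrals of affine functions see only mass and barycenter. Jensen's inequality
    follows by applying this to affine minorants of the cost and to supporting functions of the
    pieces.\<close>
  have aff_int: "integrable \<pi> (\<lambda>w. W i j w * (v \<bullet> fst w + b))"
    and aff: "(\<integral>w. W i j w * (v \<bullet> fst w + b) \<partial>\<pi>) = q i j * (v \<bullet> z i j + b)"
    if ij: "i \<in> {1..I}" "j \<in> {1..J}" for i j v b
  proof -
    have eq: "W i j w * (v \<bullet> fst w + b) = v \<bullet> (W i j w *\<^sub>R fst w) + b * W i j w" for w by (simp add: algebra_simps)
    show "integrable \<pi> (\<lambda>w. W i j w * (v \<bullet> fst w + b))"
      unfolding eq using M_int[OF ij] W_int[OF ij] by (intro Bochner_Integration.integrable_add integrable_inner_right integrable_mult_right) auto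
    have "(\<integral>w. W i j w * (v \<bullet> fst w + b) \<partial>\<pi>) = (\<integral>w. v \<bullet> (W i j w *\<^sub>R fst w) \<partial>\<pi>) + (\<integral>w. b * W i j w \<partial>\<pi>)"
      unfolding eq using M_int[OF ij] W_int[OF ij]
      by (intro Bochner_Integration.integral_add integrable_inner_right integrable_mult_right) auto
    also have "(\<integral>w. v \<bullet> (W i j w *\<^sub>R fst w) \<partial>\<pi>) = v \<bullet> m i j"
      unfolding m_def using M_int[OF ij] by (intro integral_inner_right)
    also have "(\<integral>w. b * W i j w \<partial>\<pi>) = b * q i j" unfolding q_def by simp
    also have "v \<bullet> m i j + b * q i j = q i j * (v \<bullet> z i j + b)" by (simp add: m_eq[OF ij] algebra_simps)
    finally show "(\<integral>w. W i j w * (v \<bullet> fst w + b) \<partial>\<pi>) = q i j * (v \<bullet> z i j + b)" .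
  qed
  have "(q, z, \<gamma>) \<in> plans e"
  proof -
    have "0 \<le> q i j \<and> ereal (q i j) * C j (z i j) \<le> ereal (\<gamma> i j)" if ij: "i \<in> {1..I}" "j \<in> {1..J}" for i j
    proof
      show "0 \<le> q i j" by (rule q0[OF ij(2)])
      show "ereal (q i j) * C j (z i j) \<le> ereal (\<gamma> i j)"
      proof (rule cost_le_of_minorants[OF ij(2) q0[OF ij(2)]])
        show "0 \<le> \<gamma> i j" by (simp add: \<gamma>_def)
        fix v b assume *: "\<And>w. ereal (v \<bullet> w + b) \<le> C j w"
        have "(\<integral>w. W i j w * (v \<bullet> fst w + b) \<partial>\<pi>) \<le> \<gamma> i j"
          unfolding \<gamma>_def \<Gamma>_def
          using aff_int[OF ij] \<Gamma>_fin[OF ij] ennreal_mult_e2ennreal_mono[OF W0[OF ij(2)] *]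
          by (intro integral_le_nn_integral) (auto simp: \<Gamma>_def)
        then show "q i j * (v \<bullet> z i j + b) \<le> \<gamma> i j" by (simp add: aff[OF ij])
      qed
    qed
    moreover have "(\<Sum>i\<in>{1..I}. q i j) = p j" if j: "j \<in> {1..J}" for j
    proof -
      have "(\<Sum>i\<in>{1..I}. q i j) = (\<integral>w. (\<Sum>i\<in>{1..I}. W i j w) \<partial>\<pi>)"
        unfolding q_def using W_int[OF _ j] by (intro Bochner_Integration.integral_sum[symmetric]) auto
      also have "\<dots> = (\<integral>w. p j / P j * indicator (snd -` {zh j}) w \<partial>\<pi>)"
        unfolding W_sum_i by (intro Bochner_Integration.integral_cong) (auto simp: indicator_def)
      also have "\<dots> = p j / P j * measure \<pi> (snd -` {zh j})" by (simp add: space)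
      also have "\<dots> = p j" using P[OF j] by (simp add: atom)
      finally show ?thesis .
    qed
    ultimately show ?thesis using \<gamma>_sum by (auto simp: plans_def)
  qed
  moreover have "eexpect (distr \<pi> borel fst) (\<lambda>z. ereal (loss_of \<theta> z)) \<le> ereal (val (q, z, \<gamma>) \<theta>)"
  proof -
    have "\<exists>s. \<forall>x. u i \<theta> x \<le> u i \<theta> (z i j) + s \<bullet> (x - z i j)" if "i \<in> {1..I}" for i j
      by (rule convex_supergradient[OF u_concave[OF that]]) blast
    then obtain s where s: "\<And>i j x. i \<in> {1..I} \<Longrightarrow> u i \<theta> x \<le> u i \<theta> (z i j) + s i j \<bullet> (x - z i j)" by metis
    define b where "b i j = u i \<theta> (z i j) - s i j \<bullet> z i j" for i j
    have sb: "u i \<theta> x \<le> s i j \<bullet> x + b i j" if "i \<in> {1..I}" for i j x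
      using s[OF that, of x j] by (simp add: b_def inner_diff_right)
    have "eexpect (distr \<pi> borel fst) (\<lambda>z. ereal (loss_of \<theta> z)) \<le>
        ereal (\<integral>w. (\<Sum>i\<in>{1..I}. \<Sum>j\<in>{1..J}. W i j w * (s i j \<bullet> fst w + b i j)) \<partial>\<pi>)"
    proof (rule eexpect_distr_le)
      show "(\<lambda>z. ereal (loss_of \<theta> z)) \<in> borel_measurable borel" using loss_of_measurable by measurable
      show "integrable \<pi> (\<lambda>w. \<Sum>i\<in>{1..I}. \<Sum>j\<in>{1..J}. W i j w * (s i j \<bullet> fst w + b i j))"
        using aff_int by (intro Bochner_Integration.integrable_sum)
      show "AE w in \<pi>. ereal (loss_of \<theta> (fst w)) \<le> ereal (\<Sum>i\<in>{1..I}. \<Sum>j\<in>{1..J}. W i j w * (s i j \<bullet> fst w + b i j))"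
        using ae_snd
      proof eventually_elim
        case (elim w)
        have "loss_of \<theta> (fst w) = (\<Sum>i\<in>{1..I}. \<Sum>j\<in>{1..J}. W i j w) * loss_of \<theta> (fst w)"
          using W_sum[OF elim] by simp
        also have "\<dots> = (\<Sum>i\<in>{1..I}. \<Sum>j\<in>{1..J}. W i j w * loss_of \<theta> (fst w))"
          by (simp add: sum_distrib_right)
        also have "\<dots> \<le> (\<Sum>i\<in>{1..I}. \<Sum>j\<in>{1..J}. W i j w * (s i j \<bullet> fst w + b i j))"
        proof (intro sum_mono)
          fix i j assume ij: "i \<in> {1..I}" "j \<in> {1..J}"
          show "W i j w * loss_of \<theta> (fst w) \<le> W i j w * (s i j \<bullet> fst w + b i j)"
          proof (cases "fst w \<in> active \<theta> i")
            case True
            then have "loss_of \<theta> (fst w) = u i \<theta> (fst w)" by (simp add: active_def)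
            then show ?thesis using sb[OF ij(1)] W0[OF ij(2)] by (simp add: mult_left_mono)
          qed (simp add: W_def)
        qed
        finally show ?case by simp
      qed
    qed simp
    also have "(\<integral>w. (\<Sum>i\<in>{1..I}. \<Sum>j\<in>{1..J}. W i j w * (s i j \<bullet> fst w + b i j)) \<partial>\<pi>) =
        (\<Sum>i\<in>{1..I}. \<Sum>j\<in>{1..J}. \<integral>w. W i j w * (s i j \<bullet> fst w + b i j) \<partial>\<pi>)"
    proof -
      have "(\<integral>w. (\<Sum>i\<in>{1..I}. \<Sum>j\<in>{1..J}. W i j w * (s i j \<bullet> fst w + b i j)) \<partial>\<pi>) =
          (\<Sum>i\<in>{1..I}. \<integral>w. (\<Sum>j\<in>{1..J}. W i j w * (s i j \<bullet> fst w + b i j)) \<partial>\<pi>)"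
        by (intro Bochner_Integration.integral_sum Bochner_Integration.integrable_sum aff_int)
      also have "\<dots> = (\<Sum>i\<in>{1..I}. \<Sum>j\<in>{1..J}. \<integral>w. W i j w * (s i j \<bullet> fst w + b i j) \<partial>\<pi>)"
        by (intro sum.cong refl Bochner_Integration.integral_sum aff_int)
      finally show ?thesis .
    qed
    also have "\<dots> = val (q, z, \<gamma>) \<theta>"
      unfolding val_def prod.case by (intro sum.cong refl) (simp add: aff b_def)
    finally show ?thesis .
  qed
  ultimately show ?thesis by blast
qed

end

section \<open>Worst-case risk as a supremum over plans\<close>

text \<open>Almost everywhere f agrees with a finite combination of indicators of atoms, which is
  measurable whatever f is. The integrand will be the cost, which is constrained only on Z x
  Z.\<close>

lemma nn_integral_discrete_dist:
  fixes x :: "'i \<Rightarrow> 'a::{second_countable_topology, t2_space}"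
  assumes A: "finite A"
  shows "(\<integral>\<^sup>+y. f y \<partial>discrete_dist A w x) = (\<Sum>a\<in>A. ennreal (w a) * f (x a))"
proof -
  define f' where "f' y = (\<Sum>s\<in>x ` A. f s * indicator {s} y)" for y
  have f': "f' y = f y" if "y \<in> x ` A" for y
  proof -
    have "f' y = (\<Sum>s\<in>x ` A. if s = y then f s else 0)"
      unfolding f'_def by (intro sum.cong) (auto simp: indicator_def)
    then show ?thesis using that A by simp
  qed
  have "AE y in discrete_dist A w x. y \<in> x ` A"
  proof (rule AE_I')
    have "closed (x ` A)" using A by (intro finite_imp_closed) auto
    then have "- x ` A \<in> sets borel" by auto
    moreover have "emeasure (discrete_dist A w x) (- x ` A) = 0"
      using A \<open>- x ` A \<in> sets borel\<close> by (subst emeasure_discrete_dist) (auto simp: indicator_def)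
    ultimately show "- x ` A \<in> null_sets (discrete_dist A w x)"
      by (simp add: null_sets_def discrete_dist_def)
  qed auto
  then have "(\<integral>\<^sup>+y. f y \<partial>discrete_dist A w x) = (\<integral>\<^sup>+y. f' y \<partial>discrete_dist A w x)"
    by (intro nn_integral_cong_AE) (auto elim!: eventually_mono simp: f')
  also have "\<dots> = (\<integral>\<^sup>+a. f' (x a) \<partial>point_measure A (\<lambda>a. ennreal (w a)))"
    unfolding discrete_dist_def
  proof (rule nn_integral_distr)
    show "x \<in> measurable (point_measure A (\<lambda>a. ennreal (w a))) borel"
      by (auto simp: measurable_def space_point_measure sets_point_measure)
    show "f' \<in> borel_measurable (distr (point_measure A (\<lambda>a. ennreal (w a))) borel x)"
      unfolding f'_def[abs_def] measurable_distr_eq1 by (intro borel_measurable_sum borel_measurable_times borel_measurable_indicator) auto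
  qed
  also have "\<dots> = (\<Sum>a\<in>A. ennreal (w a) * f' (x a))"
    using A by (rule nn_integral_point_measure_finite)
  also have "\<dots> = (\<Sum>a\<in>A. ennreal (w a) * f (x a))" by (intro sum.cong refl) (simp add: f')
  finally show ?thesis .
qed

lemma distr_discrete_dist:
  assumes "g \<in> measurable borel borel"
  shows "distr (discrete_dist A w x) borel g = discrete_dist A w (\<lambda>a. g (x a))"
  unfolding discrete_dist_def using assms
  by (subst distr_distr) (auto simp: comp_def measurable_def space_point_measure sets_point_measure)

section \<open>Plans as distributions in the transport ball\<close>

locale dro_problem = dro_data I J p zh C u T eps
  for I J :: nat and p :: "nat \<Rightarrow> real" and zh :: "nat \<Rightarrow> 'd::euclidean_space"
    and C :: "nat \<Rightarrow> 'd \<Rightarrow> ereal" and u :: "nat \<Rightarrow> 'm::euclidean_space \<Rightarrow> 'd \<Rightarrow> real"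
    and T :: "'m set" and eps :: real +
  fixes Z :: "'d set" and c :: "'d \<Rightarrow> 'd \<Rightarrow> ennreal" and l :: "nat \<Rightarrow> 'm \<Rightarrow> 'd \<Rightarrow> ereal"
    and K :: nat and f :: "nat \<Rightarrow> 'd \<Rightarrow> ereal" and L :: nat and g :: "nat \<Rightarrow> 'm \<Rightarrow> ereal"
  assumes Z_closed: "closed Z" and C_eq: "\<And>j. C j = cost_ext Z c (zh j)"
    and sum_p: "(\<Sum>j\<in>{1..J}. p j) = 1"
    and l_eq: "\<And>i \<theta> z. i \<in> {1..I} \<Longrightarrow> l i \<theta> z = ereal (u i \<theta> z)"
    and Z_eq: "Z = {z. \<forall>k\<in>{1..K}. f k z \<le> 0}"
    and T_eq: "T = {\<theta>. \<forall>k\<in>{1..L}. g k \<theta> \<le> 0}"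
    and g_pcl: "\<And>k. k \<in> {1..L} \<Longrightarrow> proper_convex_lsc (g k)"
    and g_slater: "\<exists>\<theta>. slater_point {1..L} g \<theta>"
begin

definition Phat :: "'d measure" where "Phat = discrete_dist {1..J} p zh"

definition support :: "(nat \<Rightarrow> nat \<Rightarrow> real) \<Rightarrow> (nat \<times> nat) set" where
  "support q = {(i, j). i \<in> {1..I} \<and> j \<in> {1..J} \<and> q i j > 0}"

text \<open>Pairs without mass are dropped: their positions are arbitrary, and the index set then
  matches the one in the theorem.\<close>

definition plan_dist :: "(nat \<Rightarrow> nat \<Rightarrow> real) \<Rightarrow> (nat \<Rightarrow> nat \<Rightarrow> 'd) \<Rightarrow> 'd measure" where
  "plan_dist q z = discrete_dist (support q) (\<lambda>(i, j). q i j) (\<lambda>(i, j). z i j)"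

lemma finite_support: "finite (support q)"
  by (rule finite_subset[of _ "{1..I} \<times> {1..J}"]) (auto simp: support_def)

lemma sum_support:
  fixes h :: "nat \<Rightarrow> nat \<Rightarrow> 'b::comm_monoid_add"
  assumes "\<And>i j. i \<in> {1..I} \<Longrightarrow> j \<in> {1..J} \<Longrightarrow> \<not> 0 < q i j \<Longrightarrow> h i j = 0"
  shows "(\<Sum>(i, j)\<in>support q. h i j) = (\<Sum>i\<in>{1..I}. \<Sum>j\<in>{1..J}. h i j)"
proof -
  have "(\<Sum>(i, j)\<in>support q. h i j) = (\<Sum>(i, j)\<in>{1..I} \<times> {1..J}. h i j)"
    using assms by (intro sum.mono_neutral_left) (fastforce simp: support_def)+
  then show ?thesis by (simp add: sum.cartesian_product)
qed

text \<open>A real bound on a positive multiple of the cost makes the cost finite, and the extended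
  cost is infinite off Z.\<close>

lemma plan_cost_finite:
  assumes "(q, z, \<gamma>) \<in> plans e" "(i, j) \<in> support q"
  shows "z i j \<in> Z" "\<exists>r. C j (z i j) = ereal r \<and> 0 \<le> r \<and> q i j * r \<le> \<gamma> i j"
proof -
  have *: "i \<in> {1..I}" "j \<in> {1..J}" "0 < q i j" "ereal (q i j) * C j (z i j) \<le> ereal (\<gamma> i j)"
    using assms by (auto simp: support_def plans_def)
  then show "\<exists>r. C j (z i j) = ereal r \<and> 0 \<le> r \<and> q i j * r \<le> \<gamma> i j"
    using C_nonneg[OF *(2), of "z i j"] by (cases "C j (z i j)") auto
  then show "z i j \<in> Z" by (auto simp: C_eq cost_ext_def split: if_splits)
qed

lemma plan_dist_in_ball:
  assumes x: "(q, z, \<gamma>) \<in> plans eps"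
  shows "plan_dist q z \<in> ot_ball Z c eps Phat"
proof -
  let ?w = "\<lambda>(i, j). q i j" and ?y = "\<lambda>(i, j). (z i j, zh j)"
  have q0: "0 \<le> q i j" if "i \<in> {1..I}" "j \<in> {1..J}" for i j using x that by (auto simp: plans_def)
  have qs: "(\<Sum>i\<in>{1..I}. q i j) = p j" if "j \<in> {1..J}" for j using x that by (auto simp: plans_def)
  have marg: "(\<Sum>a\<in>support q. ennreal (?w a) * indicator B (case a of (i, j) \<Rightarrow> zh j)) = (\<Sum>j\<in>{1..J}. ennreal (p j) * indicator B (zh j))" for B
  proof -
    have "(\<Sum>a\<in>support q. ennreal (?w a) * indicator B (case a of (i, j) \<Rightarrow> zh j)) = (\<Sum>(i, j)\<in>support q. ennreal (q i j) * indicator B (zh j))"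
      by (intro sum.cong) auto
    also have "\<dots> = (\<Sum>i\<in>{1..I}. \<Sum>j\<in>{1..J}. ennreal (q i j) * indicator B (zh j))"
      by (rule sum_support) (simp add: ennreal_neg)
    also have "\<dots> = (\<Sum>j\<in>{1..J}. (\<Sum>i\<in>{1..I}. ennreal (q i j)) * indicator B (zh j))"
      by (subst sum.swap) (simp add: sum_distrib_right)
    also have "\<dots> = (\<Sum>j\<in>{1..J}. ennreal (p j) * indicator B (zh j))"
    proof (intro sum.cong refl)
      fix j assume j: "j \<in> {1..J}"
      have "(\<Sum>i\<in>{1..I}. ennreal (q i j)) = ennreal (\<Sum>i\<in>{1..I}. q i j)"
        using q0 j by (intro sum_ennreal) auto
      then show "(\<Sum>i\<in>{1..I}. ennreal (q i j)) * indicator B (zh j) = ennreal (p j) * indicator B (zh j)"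
        by (simp only: qs[OF j])
    qed
    finally show ?thesis .
  qed
  have total: "(\<Sum>a\<in>support q. ennreal (?w a)) = 1"
  proof -
    have "(\<Sum>j\<in>{1..J}. ennreal (p j)) = ennreal (\<Sum>j\<in>{1..J}. p j)"
      using p by (intro sum_ennreal) (auto intro: less_imp_le)
    then show ?thesis using marg[of UNIV] by (simp only: sum_p) simp
  qed
  have prob: "prob_space (discrete_dist (support q) ?w v)" for v :: "nat \<times> nat \<Rightarrow> 'e::topological_space"
  proof (rule prob_spaceI)
    have sp: "space (discrete_dist (support q) ?w v) = UNIV" by (simp add: discrete_dist_def)
    show "emeasure (discrete_dist (support q) ?w v) (space (discrete_dist (support q) ?w v)) = 1"
      unfolding sp by (subst emeasure_discrete_dist[OF finite_support]) (auto simp: total)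
  qed
  have "emeasure (plan_dist q z) Z = (\<Sum>a\<in>support q. ennreal (?w a) * indicator Z (case a of (i, j) \<Rightarrow> z i j))"
    unfolding plan_dist_def using Z_closed by (intro emeasure_discrete_dist finite_support) auto
  also have "\<dots> = (\<Sum>a\<in>support q. ennreal (?w a))"
    using plan_cost_finite(1)[OF x] by (intro sum.cong refl) auto
  finally have probs: "plan_dist q z \<in> probs_on Z"
    unfolding probs_on_def using prob by (auto simp: plan_dist_def total) (simp add: discrete_dist_def)+
  \<comment> \<open>The coupling is the plan itself, pairing each position with its atom;
    \<open>marg\<close> computes the second marginal.\<close>
  have "discrete_dist (support q) ?w ?y \<in> couplings (plan_dist q z) Phat"
    unfolding couplings_def
  proof (intro CollectI conjI prob)
    show "sets (discrete_dist (support q) ?w ?y) = sets borel" by (simp add: discrete_dist_def)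
    have "distr (discrete_dist (support q) ?w ?y) borel fst = discrete_dist (support q) ?w (\<lambda>a. fst (?y a))"
      by (intro distr_discrete_dist borel_measurable_continuous_onI continuous_on_fst continuous_on_id)
    then show "distr (discrete_dist (support q) ?w ?y) borel fst = plan_dist q z"
      by (simp add: plan_dist_def case_prod_beta')
    have "distr (discrete_dist (support q) ?w ?y) borel snd = discrete_dist (support q) ?w (\<lambda>a. snd (?y a))"
      by (intro distr_discrete_dist borel_measurable_continuous_onI continuous_on_snd continuous_on_id)
    also have "(\<lambda>a. snd (?y a)) = (\<lambda>(i, j). zh j)" by auto
    also have "discrete_dist (support q) ?w (\<lambda>(i, j). zh j) = Phat"
    proof (rule measure_eqI)
      fix B assume "B \<in> sets (discrete_dist (support q) ?w (\<lambda>(i, j). zh j))"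
      then have B: "B \<in> sets borel" by (simp add: discrete_dist_def)
      show "emeasure (discrete_dist (support q) ?w (\<lambda>(i, j). zh j)) B = emeasure Phat B"
        unfolding Phat_def using marg[of B] B by (simp add: emeasure_discrete_dist finite_support)
    qed (simp add: Phat_def discrete_dist_def)
    finally show "distr (discrete_dist (support q) ?w ?y) borel snd = Phat" .
  qed
  then have "transport_cost c (plan_dist q z) Phat \<le> (\<integral>\<^sup>+w. c (fst w) (snd w) \<partial>discrete_dist (support q) ?w ?y)"
    unfolding transport_cost_def by (rule INF_lower)
  also have "\<dots> = (\<Sum>a\<in>support q. ennreal (?w a) * c (fst (?y a)) (snd (?y a)))"
    by (rule nn_integral_discrete_dist[OF finite_support])
  also have "\<dots> \<le> (\<Sum>a\<in>support q. ennreal (case a of (i, j) \<Rightarrow> \<gamma> i j))"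
  proof (rule sum_mono, clarify)
    fix i j assume ij: "(i, j) \<in> support q"
    obtain r where r: "C j (z i j) = ereal r" "0 \<le> r" "q i j * r \<le> \<gamma> i j" using plan_cost_finite(2)[OF x ij] by blast
    have "c (z i j) (zh j) = e2ennreal (C j (z i j))"
      using plan_cost_finite(1)[OF x ij] by (simp add: C_eq cost_ext_def)
    then have "ennreal (q i j) * c (z i j) (zh j) = ennreal (q i j * r)"
      using r ij by (simp add: ennreal_mult support_def)
    then show "ennreal (q i j) * c (fst (z i j, zh j)) (snd (z i j, zh j)) \<le> ennreal (\<gamma> i j)"
      using r(3) by (simp add: ennreal_leI)
  qed
  also have "\<dots> = ennreal (\<Sum>(i, j)\<in>support q. \<gamma> i j)"
    using plans_gamma_nonneg[OF x] by (subst sum_ennreal) (auto simp: support_def intro!: arg_cong[where f=ennreal] sum.cong)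
  also have "\<dots> \<le> ennreal eps"
  proof (rule ennreal_leI)
    have "(\<Sum>(i, j)\<in>support q. \<gamma> i j) \<le> (\<Sum>(i, j)\<in>{1..I} \<times> {1..J}. \<gamma> i j)"
      using plans_gamma_nonneg[OF x] by (intro sum_mono2) (auto simp: support_def)
    also have "\<dots> \<le> eps" using x by (simp add: plans_def flip: sum.cartesian_product)
    finally show "(\<Sum>(i, j)\<in>support q. \<gamma> i j) \<le> eps" .
  qed
  finally show ?thesis using probs by (simp add: ot_ball_def)
qed

text \<open>Only an inequality: a plan credits mass to piece i even where another piece attains the
  maximum.\<close>

lemma val_le_expect_plan_dist:
  assumes x: "(q, z, \<gamma>) \<in> plans e"
  shows "ereal (val (q, z, \<gamma>) \<theta>) \<le> eexpect (plan_dist q z) (\<lambda>z. ereal (loss_of \<theta> z))"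
proof -
  have "eexpect (plan_dist q z) (\<lambda>z. ereal (loss_of \<theta> z)) =
      ereal (\<Sum>a\<in>support q. (case a of (i, j) \<Rightarrow> q i j) * loss_of \<theta> (case a of (i, j) \<Rightarrow> z i j))"
    unfolding plan_dist_def using loss_of_measurable
    by (intro eexpect_discrete_dist finite_support) (auto simp: support_def)
  moreover have "val (q, z, \<gamma>) \<theta> = (\<Sum>(i, j)\<in>support q. q i j * u i \<theta> (z i j))"
    unfolding val_def prod.case
    by (rule sum_support[symmetric]) (use x in \<open>force simp: plans_def\<close>)
  moreover have "\<dots> \<le> (\<Sum>a\<in>support q. (case a of (i, j) \<Rightarrow> q i j) * loss_of \<theta> (case a of (i, j) \<Rightarrow> z i j))"
    using u_le_loss_of by (intro sum_mono) (auto simp: support_def intro!: mult_left_mono)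
  ultimately show ?thesis by simp
qed

text \<open>The optimal transport cost is an infimum that may not be attained, so a coupling is only
  known to cost at most \<open>eps + \<delta>\<close>; mixing its plan with the free plan restores the budget.\<close>

lemma expect_ball_le_worst:
  assumes Q: "Q \<in> ot_ball Z c eps Phat"
  shows "eexpect Q (\<lambda>z. ereal (loss_of \<theta> z)) \<le> worst \<theta>" (is "?E \<le> _")
proof (cases "worst \<theta>")
  case (real W)
  define x0 where "x0 = ((\<lambda>(i::nat) j. if i = 1 then p j else 0), (\<lambda>i::nat. zh), (\<lambda>(i::nat) (j::nat). 0::real))"
  have x0: "x0 \<in> plans 0" using stay_plan by (simp add: x0_def)
  define v0 where "v0 = val x0 \<theta>"
  have bound: "?E \<le> ereal (W + (W - v0) * (\<delta> / eps))" if \<delta>: "0 < \<delta>" for \<delta>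
  proof -
    have "transport_cost c Q Phat < ennreal (eps + \<delta>)"
      using Q eps \<delta> by (auto simp: ot_ball_def intro: le_less_trans ennreal_lessI)
    then obtain \<pi> where \<pi>: "\<pi> \<in> couplings Q Phat" and cost: "(\<integral>\<^sup>+w. c (fst w) (snd w) \<partial>\<pi>) < ennreal (eps + \<delta>)"
      unfolding transport_cost_def by (auto simp: INF_less_iff)
    have pi: "prob_space \<pi>" "sets \<pi> = sets borel" "distr \<pi> borel fst = Q" "distr \<pi> borel snd = discrete_dist {1..J} p zh"
      using \<pi> by (auto simp: couplings_def Phat_def)
    have fstm: "fst \<in> measurable \<pi> (borel :: 'd measure)"
      by (simp add: measurable_cong_sets[OF pi(2) refl] borel_measurable_continuous_onI continuous_on_fst)
    \<comment> \<open>Q is concentrated on Z, so the first coordinate of the coupling lies in Z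
      almost surely, where the extended cost agrees with c.\<close>
    have "prob_space Q" "sets Q = sets borel" "emeasure Q Z = 1" using Q by (auto simp: ot_ball_def probs_on_def)
    then have "AE z in Q. z \<in> Z"
      using Z_closed by (intro prob_space.AE_prob_1) (auto simp: measure_def)
    then have "AE w in \<pi>. fst w \<in> Z"
      unfolding pi(3)[symmetric] using fstm Z_closed by (subst (asm) AE_distr_iff) auto
    then have "AE w in \<pi>. \<forall>j\<in>{1..J}. snd w = zh j \<longrightarrow> e2ennreal (C j (fst w)) \<le> c (fst w) (snd w)"
      by (auto elim!: eventually_mono simp: C_eq cost_ext_def)
    then have "\<exists>x\<in>plans (eps + \<delta>). eexpect (distr \<pi> borel fst) (\<lambda>z. ereal (loss_of \<theta> z)) \<le> ereal (val x \<theta>)"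
      using eps \<delta> by (intro plan_of_coupling[OF pi(1,2,4) _ less_imp_le[OF cost]]) auto
    then obtain x where x: "x \<in> plans (eps + \<delta>)" "?E \<le> ereal (val x \<theta>)" unfolding pi(3) by blast
    \<comment> \<open>The weight for which the mixed budget \<open>t * (eps + \<delta>)\<close> is
      exactly \<open>eps\<close>.\<close>
    define t where "t = eps / (eps + \<delta>)"
    have t: "0 < t" "t \<le> 1" using eps \<delta> by (auto simp: t_def)
    obtain w where w: "w \<in> plans (t * (eps + \<delta>) + (1 - t) * 0)" "t * val x \<theta> + (1 - t) * v0 \<le> val w \<theta>"
      using plans_mix[OF x(1) x0, of t] t by (auto simp: v0_def)
    have "t * (eps + \<delta>) + (1 - t) * 0 = eps" using eps \<delta> by (simp add: t_def)
    then have "ereal (val w \<theta>) \<le> ereal W" using val_le_worst[of w \<theta>] w(1) real by simp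
    then have "t * val x \<theta> + (1 - t) * v0 \<le> W" using w(2) by simp
    moreover have "1 - t = \<delta> / (eps + \<delta>)" using eps \<delta> by (simp add: t_def field_simps)
    then have "t * val x \<theta> + (1 - t) * v0 = (eps * val x \<theta> + \<delta> * v0) / (eps + \<delta>)"
      by (simp add: t_def add_divide_distrib)
    ultimately have "eps * val x \<theta> + \<delta> * v0 \<le> W * (eps + \<delta>)"
      using eps \<delta> by (simp add: pos_divide_le_eq)
    then have "val x \<theta> \<le> W + (W - v0) * (\<delta> / eps)" using eps by (simp add: field_simps)
    then show ?thesis using x(2) by (meson ereal_less_eq(3) order_trans)
  qed
  show ?thesis
    unfolding real
  proof (rule ereal_le_epsilon2)
    fix e :: real assume e: "0 < e"
    \<comment> \<open>Chosen to make the error \<open>\<bar>W - v0\<bar> * (\<delta> / eps)\<close>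
      at most e; the added 1 avoids division by 0.\<close>
    define \<delta> where "\<delta> = eps * (e / (\<bar>W - v0\<bar> + 1))"
    have \<delta>: "0 < \<delta>" using eps e by (simp add: \<delta>_def)
    have "\<delta> / eps = e / (\<bar>W - v0\<bar> + 1)" using eps by (simp add: \<delta>_def)
    then have "(W - v0) * (\<delta> / eps) \<le> \<bar>W - v0\<bar> * (e / (\<bar>W - v0\<bar> + 1))"
      using e by (simp only:) (intro mult_right_mono, auto)
    also have "\<dots> \<le> e" using e by (simp add: field_simps)
    finally show "?E \<le> ereal W + ereal e" using bound[OF \<delta>] by (auto intro: order_trans)
  qed
qed (use worst_not_MInf in auto)

lemma worst_risk_eq:
  assumes "\<And>z. loss \<theta> z = ereal (loss_of \<theta> z)"
  shows "worst_risk (ot_ball Z c eps Phat) loss \<theta> = worst \<theta>"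
proof (rule antisym)
  have l: "loss \<theta> = (\<lambda>z. ereal (loss_of \<theta> z))" using assms by auto
  show "worst_risk (ot_ball Z c eps Phat) loss \<theta> \<le> worst \<theta>"
    unfolding worst_risk_def l by (intro SUP_least expect_ball_le_worst)
  show "worst \<theta> \<le> worst_risk (ot_ball Z c eps Phat) loss \<theta>"
    unfolding worst_def
  proof (rule SUP_least)
    fix x assume x: "x \<in> plans eps"
    obtain q z \<gamma> where xe: "x = (q, z, \<gamma>)" by (cases x)
    have "eexpect (plan_dist q z) (loss \<theta>) \<le> worst_risk (ot_ball Z c eps Phat) loss \<theta>"
      unfolding worst_risk_def using plan_dist_in_ball x by (intro SUP_upper) (simp add: xe)
    then show "ereal (val x \<theta>) \<le> worst_risk (ot_ball Z c eps Phat) loss \<theta>"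
      using val_le_expect_plan_dist[of q z \<gamma> eps \<theta>] x by (auto simp: xe l intro: order_trans)
  qed
qed

end

section \<open>Duality for the finite programs\<close>

lemma affine_bounded_below_slope:
  fixes w :: "'a::real_inner"
  assumes "\<And>x. M \<le> w \<bullet> x + s"
  shows "w = 0"
proof (rule ccontr)
  assume "w \<noteq> 0"
  then have p: "w \<bullet> w > 0" by simp
  have "M \<le> w \<bullet> (((M - s - 1) / (w \<bullet> w)) *\<^sub>R w) + s" by (rule assms)
  also have "\<dots> = M - 1" using p by simp
  finally show False by simp
qed

text \<open>The choices for different j are independent, so a bound for all selections passes to the
  sum of suprema; varying one coordinate alone shows that each set is bounded.\<close>

lemma sum_Sup_le:
  fixes A :: "'j \<Rightarrow> real set" and p :: "'j \<Rightarrow> real"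
  assumes "finite S" and p: "\<And>j. j \<in> S \<Longrightarrow> 0 < p j" and ne: "\<And>j. j \<in> S \<Longrightarrow> A j \<noteq> {}"
    and le: "\<And>a. (\<And>j. j \<in> S \<Longrightarrow> a j \<in> A j) \<Longrightarrow> (\<Sum>j\<in>S. p j * a j) \<le> M"
  shows "\<And>j. j \<in> S \<Longrightarrow> bdd_above (A j)" and "(\<Sum>j\<in>S. p j * Sup (A j)) \<le> M"
proof -
  have "\<forall>j\<in>S. \<exists>x. x \<in> A j" using ne by blast
  then obtain a0 where a0: "\<And>j. j \<in> S \<Longrightarrow> a0 j \<in> A j" by metis
  show bdd: "bdd_above (A j)" if j: "j \<in> S" for j
  proof (rule bdd_aboveI)
    fix x assume x: "x \<in> A j"
    have "(\<Sum>k\<in>S. p k * (a0(j := x)) k) \<le> M" using x a0 by (intro le) auto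
    also have "(\<Sum>k\<in>S. p k * (a0(j := x)) k) = p j * x + (\<Sum>k\<in>S - {j}. p k * a0 k)"
      using assms(1) j by (subst sum.remove[of _ j]) (auto intro!: sum.cong)
    finally show "x \<le> (M - (\<Sum>k\<in>S - {j}. p k * a0 k)) / p j" using p[OF j] by (simp add: field_simps)
  qed
  show "(\<Sum>j\<in>S. p j * Sup (A j)) \<le> M"
  proof (rule field_le_epsilon)
    fix e :: real assume e: "0 < e"
    define P where "P = (\<Sum>j\<in>S. p j) + 1"
    have P: "0 < P" unfolding P_def using p by (intro add_nonneg_pos sum_nonneg) (auto intro: less_imp_le)
    have "\<exists>x\<in>A j. Sup (A j) - e / P < x" if "j \<in> S" for j
      using less_cSup_iff[OF ne[OF that] bdd[OF that], of "Sup (A j) - e / P"] e P by auto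
    then obtain a where a: "\<And>j. j \<in> S \<Longrightarrow> a j \<in> A j" "\<And>j. j \<in> S \<Longrightarrow> Sup (A j) - e / P < a j" by metis
    have "(\<Sum>j\<in>S. p j * Sup (A j)) \<le> (\<Sum>j\<in>S. p j * a j + p j * (e / P))"
    proof (rule sum_mono)
      fix j assume j: "j \<in> S"
      have "Sup (A j) \<le> a j + e / P" using a(2)[OF j] by simp
      then have "p j * Sup (A j) \<le> p j * (a j + e / P)" using p[OF j] by (intro mult_left_mono) auto
      then show "p j * Sup (A j) \<le> p j * a j + p j * (e / P)" by (simp add: distrib_left)
    qed
    also have "\<dots> = (\<Sum>j\<in>S. p j * a j) + (\<Sum>j\<in>S. p j) * (e / P)" by (simp only: sum.distrib sum_distrib_right)
    also have "\<dots> \<le> M + e"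
    proof (rule add_mono)
      show "(\<Sum>j\<in>S. p j * a j) \<le> M" using a(1) by (rule le)
      have "(\<Sum>j\<in>S. p j) * (e / P) \<le> P * (e / P)" using e P by (intro mult_right_mono) (auto simp: P_def)
      then show "(\<Sum>j\<in>S. p j) * (e / P) \<le> e" using P by simp
    qed
    finally show "(\<Sum>j\<in>S. p j * Sup (A j)) \<le> M + e" .
  qed
qed

context dro_problem begin

text \<open>Weak duality, pair by pair: at \<open>z i j\<close> the Fenchel-Young inequalities for
  piece, cost and constraints are added, the linear terms cancel because the slopes sum to 0, and
  the result is weighted with \<open>q i j\<close>.\<close>

lemma worst_le_primal_objective:
  assumes "primal_feasible I J K T Z c l f zh (\<theta>, lam, s, zl, zc, tau, zf)"
  shows "worst \<theta> \<le> ereal (primal_objective J eps p (\<theta>, lam, s, zl, zc, tau, zf))"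
  unfolding worst_def
proof (rule SUP_least)
  fix x assume x: "x \<in> plans eps"
  obtain q z \<gamma> where xe: "x = (q, z, \<gamma>)" by (cases x)
  have feas: "0 \<le> lam" "\<And>i j k. i \<in> {1..I} \<Longrightarrow> j \<in> {1..J} \<Longrightarrow> k \<in> {1..K} \<Longrightarrow> 0 \<le> tau i j k"
    "\<And>i j. i \<in> {1..I} \<Longrightarrow> j \<in> {1..J} \<Longrightarrow> fenchel_conj (\<lambda>z. - l i \<theta> z) (zl i j)
        + persp (fenchel_conj (cost_ext Z c (zh j))) lam (zc i j)
        + (\<Sum>k\<in>{1..K}. persp (fenchel_conj (f k)) (tau i j k) (zf i j k)) \<le> ereal (s j)"
    "\<And>i j. i \<in> {1..I} \<Longrightarrow> j \<in> {1..J} \<Longrightarrow> zl i j + zc i j + (\<Sum>k\<in>{1..K}. zf i j k) = 0"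
    using assms by (auto simp: primal_feasible_def)
  have summand: "q i j * u i \<theta> (z i j) \<le> q i j * s j + lam * \<gamma> i j" if ij: "i \<in> {1..I}" "j \<in> {1..J}" for i j
  proof (cases "q i j > 0")
    case False
    then have "q i j = 0" using x ij by (force simp: xe plans_def)
    then show ?thesis using plans_gamma_nonneg[OF x[unfolded xe] ij] feas(1) by simp
  next
    case True
    then have sup: "(i, j) \<in> support q" using ij by (simp add: support_def)
    obtain r where r: "C j (z i j) = ereal r" "0 \<le> r" "q i j * r \<le> \<gamma> i j"
      using plan_cost_finite(2)[OF x[unfolded xe] sup] by blast
    have zZ: "z i j \<in> Z" by (rule plan_cost_finite(1)[OF x[unfolded xe] sup])
    let ?z = "z i j"
    have 1: "ereal (zl i j \<bullet> ?z + u i \<theta> ?z) \<le> fenchel_conj (\<lambda>z. - l i \<theta> z) (zl i j)"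
      using fenchel_conj_ge[of "zl i j" ?z "\<lambda>z. - l i \<theta> z"] by (simp add: l_eq[OF ij(1)])
    have 2: "ereal (zc i j \<bullet> ?z - lam * r) \<le> persp (fenchel_conj (cost_ext Z c (zh j))) lam (zc i j)"
      using r(1) by (intro persp_conj_ge feas(1)) (simp add: C_eq)
    have "ereal (\<Sum>k\<in>{1..K}. zf i j k \<bullet> ?z) = (\<Sum>k\<in>{1..K}. ereal (zf i j k \<bullet> ?z - tau i j k * 0))" by simp
    also have "\<dots> \<le> (\<Sum>k\<in>{1..K}. persp (fenchel_conj (f k)) (tau i j k) (zf i j k))"
      using zZ ij feas(2) by (intro sum_mono persp_conj_ge) (auto simp: Z_eq zero_ereal_def)
    finally have 3: "ereal (\<Sum>k\<in>{1..K}. zf i j k \<bullet> ?z) \<le> (\<Sum>k\<in>{1..K}. persp (fenchel_conj (f k)) (tau i j k) (zf i j k))" .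
    have "ereal (zl i j \<bullet> ?z + u i \<theta> ?z) + ereal (zc i j \<bullet> ?z - lam * r) + ereal (\<Sum>k\<in>{1..K}. zf i j k \<bullet> ?z) \<le> ereal (s j)"
      by (rule order_trans[OF _ feas(3)[OF ij]]) (intro add_mono 1 2 3)
    then have le: "zl i j \<bullet> ?z + u i \<theta> ?z + (zc i j \<bullet> ?z - lam * r) + (\<Sum>k\<in>{1..K}. zf i j k \<bullet> ?z) \<le> s j" by simp
    have "(zl i j + zc i j + (\<Sum>k\<in>{1..K}. zf i j k)) \<bullet> ?z = 0" by (simp only: feas(4)[OF ij] inner_zero_left)
    then have "zl i j \<bullet> ?z + zc i j \<bullet> ?z + (\<Sum>k\<in>{1..K}. zf i j k \<bullet> ?z) = 0" by (simp add: inner_add_left inner_sum_left)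
    then have "u i \<theta> ?z \<le> s j + lam * r" using le by linarith
    then have "q i j * u i \<theta> ?z \<le> q i j * (s j + lam * r)" using True by (intro mult_left_mono) auto
    also have "\<dots> = q i j * s j + lam * (q i j * r)" by (simp add: algebra_simps)
    also have "\<dots> \<le> q i j * s j + lam * \<gamma> i j" using r(3) feas(1) by (intro add_left_mono mult_left_mono)
    finally show ?thesis .
  qed
  have "val x \<theta> \<le> (\<Sum>i\<in>{1..I}. \<Sum>j\<in>{1..J}. q i j * s j + lam * \<gamma> i j)"
    unfolding xe val_def prod.case by (intro sum_mono summand)
  also have "\<dots> = (\<Sum>i\<in>{1..I}. \<Sum>j\<in>{1..J}. q i j * s j) + lam * (\<Sum>i\<in>{1..I}. \<Sum>j\<in>{1..J}. \<gamma> i j)"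
    by (simp add: sum.distrib sum_distrib_left)
  also have "(\<Sum>i\<in>{1..I}. \<Sum>j\<in>{1..J}. q i j * s j) = (\<Sum>j\<in>{1..J}. (\<Sum>i\<in>{1..I}. q i j) * s j)"
    by (subst sum.swap) (simp add: sum_distrib_right)
  also have "(\<Sum>j\<in>{1..J}. (\<Sum>i\<in>{1..I}. q i j) * s j) = (\<Sum>j\<in>{1..J}. p j * s j)"
    using x by (intro sum.cong refl) (auto simp: xe plans_def)
  also have "(\<Sum>j\<in>{1..J}. p j * s j) + lam * (\<Sum>i\<in>{1..I}. \<Sum>j\<in>{1..J}. \<gamma> i j) \<le> (\<Sum>j\<in>{1..J}. p j * s j) + lam * eps"
    using x feas(1) by (intro add_left_mono mult_left_mono) (auto simp: xe plans_def)
  finally show "ereal (val x \<theta>) \<le> ereal (primal_objective J eps p (\<theta>, lam, s, zl, zc, tau, zf))"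
    by (simp add: primal_objective_def)
qed

text \<open>The two-function alternative for value and budget, with the budget as part of the
  variable. The stay plan has budget 0 below \<open>eps\<close>, so the value keeps a positive
  weight.\<close>

lemma budget_multiplier:
  assumes W: "worst \<theta> = ereal W"
  obtains lam where "0 \<le> lam" "\<And>x e. x \<in> plans e \<Longrightarrow> val x \<theta> + lam * eps \<le> W + lam * e"
proof -
  define X where "X = {(x, e). x \<in> plans e}"
  have "\<exists>w\<in>X. W - val (fst w) \<theta> \<le> t * (W - val (fst x) \<theta>) + (1 - t) * (W - val (fst y) \<theta>) \<and>
      snd w - eps \<le> t * (snd x - eps) + (1 - t) * (snd y - eps)"
    if xyX: "x \<in> X" "y \<in> X" and t: "0 \<le> t" "t \<le> 1" for x y and t :: real
  proof -
    have xy: "fst x \<in> plans (snd x)" "fst y \<in> plans (snd y)" using xyX by (auto simp: X_def)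
    obtain w where w: "w \<in> plans (t * snd x + (1 - t) * snd y)" "t * val (fst x) \<theta> + (1 - t) * val (fst y) \<theta> \<le> val w \<theta>"
      using plans_mix[OF xy t] by blast
    have "(w, t * snd x + (1 - t) * snd y) \<in> X" using w(1) by (simp add: X_def)
    then show ?thesis using w(2) by (intro bexI[of _ "(w, t * snd x + (1 - t) * snd y)"]) (auto simp: algebra_simps)
  qed
  moreover have "0 \<le> W - val (fst x) \<theta> \<or> 0 \<le> snd x - eps" if "x \<in> X" for x
  proof (cases "snd x \<le> eps")
    case True
    then have "fst x \<in> plans eps" using that plans_mono[OF True] by (auto simp: X_def)
    then show ?thesis using val_le_worst[of "fst x" \<theta>] W by simp
  qed simp
  ultimately obtain t where t: "0 \<le> t" "t \<le> 1"
    "\<And>x. x \<in> X \<Longrightarrow> 0 \<le> t * (W - val (fst x) \<theta>) + (1 - t) * (snd x - eps)"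
    using convexlike_alternative[of X "\<lambda>x. W - val (fst x) \<theta>" "\<lambda>x. snd x - eps"] by blast
  have "t > 0"
  proof (rule ccontr)
    assume "\<not> t > 0"
    then have "t = 0" using t by simp
    moreover have "(((\<lambda>i j. if i = 1 then p j else 0), (\<lambda>i. zh), (\<lambda>i j. 0)), 0) \<in> X"
      using stay_plan by (simp add: X_def)
    ultimately show False using t(3) eps by fastforce
  qed
  show thesis
  proof (rule that[of "(1 - t) / t"])
    show "0 \<le> (1 - t) / t" using t by simp
    fix x e assume "x \<in> plans e"
    then have "0 \<le> t * (W - val x \<theta>) + (1 - t) * (e - eps)" using t(3)[of "(x, e)"] by (simp add: X_def)
    then have "0 \<le> (t * (W - val x \<theta>) + (1 - t) * (e - eps)) / t" using \<open>t > 0\<close> by simp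
    also have "\<dots> = W - val x \<theta> + (1 - t) / t * (e - eps)" using \<open>t > 0\<close> by (simp add: add_divide_distrib)
    finally show "val x \<theta> + (1 - t) / t * eps \<le> W + (1 - t) / t * e" by (simp add: right_diff_distrib)
  qed
qed

text \<open>The cost is infinite outside \<open>Z\<close>, so the multipliers \<open>tau\<close> of the constraints \<open>f k \<le> 0\<close> may
  be taken to be zero; \<open>lam\<close> is kept positive at the price \<open>\<delta>\<close>.\<close>

lemma primal_near_optimal:
  assumes \<theta>: "\<theta> \<in> T" and W: "worst \<theta> = ereal W" and \<delta>: "0 < \<delta>"
  obtains lam s zl zc tau zf where "primal_feasible I J K T Z c l f zh (\<theta>, lam, s, zl, zc, tau, zf)"
    "primal_objective J eps p (\<theta>, lam, s, zl, zc, tau, zf) \<le> W + \<delta>"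
proof -
  obtain lam0 where lam0: "0 \<le> lam0" "\<And>x e. x \<in> plans e \<Longrightarrow> val x \<theta> + lam0 * eps \<le> W + lam0 * e"
    using budget_multiplier[OF W] by blast
  \<comment> \<open>With a positive multiplier the perspective is an ordinary scaled conjugate of
    the cost and not a support function.\<close>
  define lam where "lam = lam0 + \<delta> / eps"
  have lam: "0 < lam" using lam0(1) \<delta> eps by (simp add: lam_def add_nonneg_pos)
  \<comment> \<open>The possible losses from atom j after the cost is charged at price
    \<open>lam\<close>; \<open>s j\<close> is their supremum, the inner maximum of the
    Lagrangian.\<close>
  define A where "A j = {u i \<theta> z - lam * r | i z r. i \<in> {1..I} \<and> C j z = ereal r}" for j
  define s where "s j = Sup (A j)" for j
  have ne: "A j \<noteq> {}" if "j \<in> {1..J}" for j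
  proof -
    have "C j (zh j) = ereal 0" using C_zero[OF that, of "zh j"] by (simp add: zero_ereal_def)
    then have "u 1 \<theta> (zh j) - lam * 0 \<in> A j" using I unfolding A_def by (intro CollectI exI conjI refl) auto
    then show ?thesis by blast
  qed
  \<comment> \<open>One value per atom is realised by the plan that sends the whole mass
    \<open>p j\<close> to a single position and piece, so the multiplier inequality applies to
    it.\<close>
  have le: "(\<Sum>j\<in>{1..J}. p j * a j) \<le> W + \<delta> - lam * eps" if a: "\<And>j. j \<in> {1..J} \<Longrightarrow> a j \<in> A j" for a
  proof -
    have "\<forall>j\<in>{1..J}. \<exists>i z r. a j = u i \<theta> z - lam * r \<and> i \<in> {1..I} \<and> C j z = ereal r"
      using a by (auto simp: A_def)
    then obtain ii zz rr where c: "\<And>j. j \<in> {1..J} \<Longrightarrow> a j = u (ii j) \<theta> (zz j) - lam * rr j"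
      "\<And>j. j \<in> {1..J} \<Longrightarrow> ii j \<in> {1..I}" "\<And>j. j \<in> {1..J} \<Longrightarrow> C j (zz j) = ereal (rr j)" by metis
    have rr: "0 \<le> rr j" if "j \<in> {1..J}" for j using C_nonneg[OF that, of "zz j"] c(3)[OF that] by simp
    define q where "q i j = (if i = ii j then p j else 0)" for i j
    define g where "g i j = q i j * rr j" for i j
    define e where "e = (\<Sum>j\<in>{1..J}. p j * rr j)"
    have qsum: "(\<Sum>i\<in>{1..I}. q i j * h i) = p j * h (ii j)" if "j \<in> {1..J}" for j and h :: "nat \<Rightarrow> real"
      using c(2)[OF that] by (simp add: q_def if_distrib[where f="\<lambda>x. x * _"] cong: if_cong)
    have "(q, (\<lambda>i. zz), g) \<in> plans e"
    proof -
      have "0 \<le> q i j \<and> ereal (q i j) * C j (zz j) \<le> ereal (g i j)" if "i \<in> {1..I}" "j \<in> {1..J}" for i j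
        using that p[OF that(2)] c(3)[OF that(2)] by (simp add: q_def g_def)
      moreover have "(\<Sum>i\<in>{1..I}. q i j) = p j" if "j \<in> {1..J}" for j using qsum[OF that, of "\<lambda>_. 1"] by simp
      moreover have "(\<Sum>i\<in>{1..I}. \<Sum>j\<in>{1..J}. g i j) = e"
        unfolding e_def g_def by (subst sum.swap) (intro sum.cong refl qsum)
      ultimately show ?thesis by (auto simp: plans_def)
    qed
    from lam0(2)[OF this] have 1: "val (q, (\<lambda>i. zz), g) \<theta> + lam0 * eps \<le> W + lam0 * e" .
    have e0: "0 \<le> e" unfolding e_def using rr p by (intro sum_nonneg mult_nonneg_nonneg) (auto intro: less_imp_le)
    have "val (q, (\<lambda>i. zz), g) \<theta> = (\<Sum>j\<in>{1..J}. p j * u (ii j) \<theta> (zz j))"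
      unfolding val_def prod.case by (subst sum.swap) (intro sum.cong refl qsum)
    moreover have "(\<Sum>j\<in>{1..J}. p j * a j) = (\<Sum>j\<in>{1..J}. p j * u (ii j) \<theta> (zz j)) - lam * e"
      unfolding e_def sum_distrib_left sum_subtractf[symmetric] by (intro sum.cong refl) (simp only: c(1), simp add: algebra_simps)
    moreover have "lam * e = lam0 * e + \<delta> / eps * e" "lam * eps = lam0 * eps + \<delta>"
      using eps by (auto simp: lam_def algebra_simps)
    moreover have "0 \<le> \<delta> / eps * e" using e0 \<delta> eps by simp
    ultimately show ?thesis using 1 by linarith
  qed
  have bdd: "bdd_above (A j)" if "j \<in> {1..J}" for j
    by (rule sum_Sup_le(1)[of "{1..J}" p A "W + \<delta> - lam * eps" j]) (use p ne le that in blast)+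
  have sum_s: "(\<Sum>j\<in>{1..J}. p j * s j) \<le> W + \<delta> - lam * eps"
    unfolding s_def by (rule sum_Sup_le(2)) (use p ne le in blast)+
  \<comment> \<open>By the choice of \<open>s j\<close>, the concave function
    \<open>- lam * C j - s j\<close> lies below the convex function \<open>- u i \<theta>\<close>.
    An affine function between them has slope \<open>zl\<close>, and \<open>zc\<close> is the
    negative of that slope.\<close>
  have "\<exists>v b. (\<forall>z. v \<bullet> z + b \<le> - u i \<theta> z) \<and> (\<forall>z r. C j z = ereal r \<longrightarrow> - lam * r - s j \<le> v \<bullet> z + b)"
    if ij: "i \<in> {1..I}" "j \<in> {1..J}" for i j
  proof -
    have Cproper: "proper (C j)" using C_edom[OF ij(2)] C_nonneg[OF ij(2)] by (fastforce simp: proper_def)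
    define h where "h z = - lam * real_of_ereal (C j z) - s j" for z
    have "convex_on (edom (C j)) (\<lambda>z. lam * real_of_ereal (C j z))"
      using lam econvex_convex_on_edom[OF Cproper C_convex[OF ij(2)]] by (intro convex_on_cmul) auto
    moreover have "convex_on (edom (C j)) (\<lambda>z. s j)"
      using econvex_convex_on_edom[OF Cproper C_convex[OF ij(2)]] by (simp add: convex_on_const convex_on_imp_convex)
    ultimately have "convex_on (edom (C j)) (\<lambda>z. lam * real_of_ereal (C j z) + s j)" by (rule convex_on_add)
    then have hc: "convex_on (edom (C j)) (\<lambda>z. - h z)" by (simp add: h_def add.commute)
    have hu: "h z \<le> - u i \<theta> z" if "z \<in> edom (C j)" for z
    proof -
      have "C j z = ereal (real_of_ereal (C j z))" using edom_real[OF Cproper that] .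
      then have "u i \<theta> z - lam * real_of_ereal (C j z) \<in> A j" using ij by (auto simp: A_def)
      then have "u i \<theta> z - lam * real_of_ereal (C j z) \<le> s j" unfolding s_def using bdd[OF ij(2)] by (rule cSup_upper)
      then show ?thesis by (simp add: h_def)
    qed
    obtain a where a: "affine_real a" "\<And>x. a x \<le> - u i \<theta> x" "\<And>x. x \<in> edom (C j) \<Longrightarrow> h x \<le> a x"
      using convex_sandwich[OF u_concave[OF ij(1)] hc C_edom[OF ij(2)] hu] by blast
    obtain v b where vb: "\<And>x. a x = v \<bullet> x + b" using a(1) unfolding affine_real_def by blast
    have "- lam * r - s j \<le> v \<bullet> z + b" if "C j z = ereal r" for z r
      using a(3)[of z] that by (simp add: h_def edom_def vb)
    then show ?thesis using a(2) vb by metis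
  qed
  then obtain v b where v: "\<And>i j z. i \<in> {1..I} \<Longrightarrow> j \<in> {1..J} \<Longrightarrow> v i j \<bullet> z + b i j \<le> - u i \<theta> z"
    "\<And>i j z r. i \<in> {1..I} \<Longrightarrow> j \<in> {1..J} \<Longrightarrow> C j z = ereal r \<Longrightarrow> - lam * r - s j \<le> v i j \<bullet> z + b i j"
    by metis
  show thesis
  proof (rule that[of lam s v "\<lambda>i j. - v i j" "\<lambda>i j k. 0" "\<lambda>i j k. 0"])
    show "primal_objective J eps p (\<theta>, lam, s, v, \<lambda>i j. - v i j, \<lambda>i j k. 0, \<lambda>i j k. 0) \<le> W + \<delta>"
      using sum_s by (simp add: primal_objective_def)
    have "fenchel_conj (\<lambda>z. - l i \<theta> z) (v i j) + persp (fenchel_conj (cost_ext Z c (zh j))) lam (- v i j)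
        + (\<Sum>k\<in>{1..K}. persp (fenchel_conj (f k)) 0 0) \<le> ereal (s j)" if ij: "i \<in> {1..I}" "j \<in> {1..J}" for i j
    proof -
      have 1: "fenchel_conj (\<lambda>z. - l i \<theta> z) (v i j) \<le> ereal (- b i j)"
        using v(1)[OF ij] by (intro fenchel_conj_affine_minorant) (simp add: l_eq[OF ij(1)])
      have "fenchel_conj (C j) (- v i j /\<^sub>R lam) \<le> ereal (- (- (b i j + s j) / lam))"
      proof (rule fenchel_conj_affine_minorant)
        fix z show "ereal ((- v i j /\<^sub>R lam) \<bullet> z + (- (b i j + s j) / lam)) \<le> C j z"
        proof (cases "C j z")
          case (real r)
          have "- v i j \<bullet> z - (b i j + s j) \<le> lam * r" using v(2)[OF ij real] by simp
          then have "(- v i j \<bullet> z - (b i j + s j)) / lam \<le> r" using lam by (simp add: field_simps)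
          then show ?thesis using real by (simp add: diff_divide_distrib add_divide_distrib divide_inverse mult.commute algebra_simps)
        qed (use C_nonneg[OF ij(2), of z] in auto)
      qed
      then have "ereal lam * fenchel_conj (C j) (- v i j /\<^sub>R lam) \<le> ereal lam * ereal (- (- (b i j + s j) / lam))"
        using lam by (intro ereal_mult_left_mono) auto
      then have 2: "persp (fenchel_conj (cost_ext Z c (zh j))) lam (- v i j) \<le> ereal (b i j + s j)"
        using lam by (simp add: persp_def C_eq add.commute)
      have 3: "(\<Sum>k\<in>{1..K}. persp (fenchel_conj (f k)) 0 0) \<le> 0" by (intro sum_nonpos persp_zero_le)
      have "fenchel_conj (\<lambda>z. - l i \<theta> z) (v i j) + persp (fenchel_conj (cost_ext Z c (zh j))) lam (- v i j)
        + (\<Sum>k\<in>{1..K}. persp (fenchel_conj (f k)) 0 0) \<le> ereal (- b i j) + ereal (b i j + s j) + 0"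
        by (intro add_mono 1 2 3)
      then show ?thesis by simp
    qed
    then show "primal_feasible I J K T Z c l f zh (\<theta>, lam, s, v, \<lambda>i j. - v i j, \<lambda>i j k. 0, \<lambda>i j k. 0)"
      using \<theta> lam by (auto simp: primal_feasible_def)
  qed
qed


text \<open>For q > 0 this is the Fenchel-Young inequality. For q = 0 a point of the domain of the
  joint conjugate with first component \<theta> is required: a supergradient s at the atom gives
  \<open>(\<theta>, - s)\<close>, whose second component meets only
  \<open>\<xi> = 0\<close>.\<close>

lemma persp_loss_conj_ge:
  assumes ij: "i \<in> {1..I}" and q: "0 \<le> q" and inf: "q = 0 \<Longrightarrow> \<xi> = 0"
  shows "ereal (\<alpha> \<bullet> \<theta> - q * u i \<theta> (zh j + \<xi> /\<^sub>R q))
    \<le> persp (\<lambda>(a, x). fenchel_conj (\<lambda>\<theta>. l i \<theta> (zh j + x)) a) q (\<alpha>, \<xi>)"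
proof (cases "q = 0")
  case False
  then have q: "0 < q" using q by simp
  let ?z = "zh j + \<xi> /\<^sub>R q"
  have "ereal ((\<alpha> /\<^sub>R q) \<bullet> \<theta>) - l i \<theta> ?z \<le> fenchel_conj (\<lambda>\<theta>. l i \<theta> ?z) (\<alpha> /\<^sub>R q)"
    by (rule fenchel_conj_ge)
  then have "ereal q * ereal ((\<alpha> /\<^sub>R q) \<bullet> \<theta> - u i \<theta> ?z) \<le> ereal q * fenchel_conj (\<lambda>\<theta>. l i \<theta> ?z) (\<alpha> /\<^sub>R q)"
    using q by (intro ereal_mult_left_mono) (auto simp: l_eq[OF ij])
  moreover have "q * ((\<alpha> /\<^sub>R q) \<bullet> \<theta> - u i \<theta> ?z) = \<alpha> \<bullet> \<theta> - q * u i \<theta> ?z" using q by (simp add: right_diff_distrib)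
  ultimately show ?thesis using q by (simp add: persp_def)
next
  case True
  then have \<xi>: "\<xi> = 0" by (rule inf)
  obtain s where s: "\<And>x. u i \<theta> x \<le> u i \<theta> (zh j) + s \<bullet> (x - zh j)"
    using convex_supergradient[OF u_concave[OF ij], of \<theta> "zh j"] by blast
  define \<phi> where "\<phi> = (\<lambda>(a, x). fenchel_conj (\<lambda>\<theta>. l i \<theta> (zh j + x)) a)"
  have "fenchel_conj \<phi> (\<theta>, - s) \<le> ereal (u i \<theta> (zh j))"
  proof (rule fenchel_conj_leI)
    fix ax :: "'m \<times> 'd"
    obtain a x where ax: "ax = (a, x)" by (cases ax)
    have "ereal (a \<bullet> \<theta> - u i \<theta> (zh j + x)) \<le> \<phi> (a, x)"
      using fenchel_conj_ge[of a \<theta> "\<lambda>\<theta>. l i \<theta> (zh j + x)"] by (simp add: \<phi>_def l_eq[OF ij])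
    then have "ereal ((\<theta>, - s) \<bullet> ax) - \<phi> ax \<le> ereal ((\<theta>, - s) \<bullet> ax) - ereal (a \<bullet> \<theta> - u i \<theta> (zh j + x))"
      unfolding ax by (intro ereal_minus_mono) auto
    also have "\<dots> \<le> ereal (u i \<theta> (zh j))"
      using s[of "zh j + x"] by (simp add: ax inner_commute)
    finally show "ereal ((\<theta>, - s) \<bullet> ax) - \<phi> ax \<le> ereal (u i \<theta> (zh j))" .
  qed
  then have "(\<theta>, - s) \<in> edom (fenchel_conj \<phi>)" by (auto simp: edom_def)
  then have "ereal ((\<alpha>, \<xi>) \<bullet> (\<theta>, - s)) \<le> (SUP y\<in>edom (fenchel_conj \<phi>). ereal ((\<alpha>, \<xi>) \<bullet> y))"
    by (intro SUP_upper)
  then show ?thesis using True \<xi> by (simp add: persp_def \<phi>_def)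
qed

text \<open>Weak duality for the dual program: the slopes sum to 0 and leave the value of the plan.
  Where mass and \<xi> both vanish, the cost perspective is 0 and not minus infinity, because the
  conjugate of a nonnegative cost is finite at 0 or below.\<close>

lemma dual_feasible_plan:
  assumes feas: "dual_feasible I J K L Z c f zh p eps (\<beta>, \<nu>, q, \<xi>, \<alpha>)"
    and inf: "\<And>i j. i \<in> {1..I} \<Longrightarrow> j \<in> {1..J} \<Longrightarrow> q i j = 0 \<Longrightarrow> \<xi> i j = 0"
  defines "z \<equiv> \<lambda>i j. zh j + \<xi> i j /\<^sub>R q i j"
  obtains \<gamma> where "(q, z, \<gamma>) \<in> plans eps"
    "\<And>\<theta>. \<theta> \<in> T \<Longrightarrow> dual_objective I J L l g zh (\<beta>, \<nu>, q, \<xi>, \<alpha>) \<le> ereal (val (q, z, \<gamma>) \<theta>)"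
proof -
  have F: "\<And>i j. i \<in> {1..I} \<Longrightarrow> j \<in> {1..J} \<Longrightarrow> 0 \<le> q i j" "\<And>k. k \<in> {1..L} \<Longrightarrow> 0 \<le> \<nu> k"
    "\<And>j. j \<in> {1..J} \<Longrightarrow> (\<Sum>i\<in>{1..I}. q i j) = p j"
    "(\<Sum>i\<in>{1..I}. \<Sum>j\<in>{1..J}. \<alpha> i j) + (\<Sum>k\<in>{1..L}. \<beta> k) = 0"
    "(\<Sum>i\<in>{1..I}. \<Sum>j\<in>{1..J}. persp (\<lambda>x. cost_ext Z c (zh j) (zh j + x)) (q i j) (\<xi> i j)) \<le> ereal eps"
    using feas by (auto simp: dual_feasible_def)
  have t: "persp (\<lambda>x. cost_ext Z c (zh j) (zh j + x)) (q i j) (\<xi> i j) = ereal (q i j) * C j (z i j)"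
    if ij: "i \<in> {1..I}" "j \<in> {1..J}" for i j
  proof (cases "q i j = 0")
    case True
    have "fenchel_conj (\<lambda>x. cost_ext Z c (zh j) (zh j + x)) 0 \<le> 0"
    proof (rule fenchel_conj_leI)
      fix x
      show "ereal (0 \<bullet> x) - cost_ext Z c (zh j) (zh j + x) \<le> 0"
        using C_nonneg[OF ij(2), of "zh j + x"]
        by (cases "cost_ext Z c (zh j) (zh j + x)") (auto simp: C_eq zero_ereal_def)
    qed
    then have "0 \<in> edom (fenchel_conj (\<lambda>x. cost_ext Z c (zh j) (zh j + x)))" by (auto simp: edom_def)
    then have "edom (fenchel_conj (\<lambda>x. cost_ext Z c (zh j) (zh j + x))) \<noteq> {}" by blast
    then show ?thesis using True inf[OF ij True] by (simp add: persp_def zero_ereal_def[symmetric])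
  qed (simp add: persp_def z_def C_eq)
  define t' where "t' i j = ereal (q i j) * C j (z i j)" for i j
  have t'0: "0 \<le> t' i j" if "i \<in> {1..I}" "j \<in> {1..J}" for i j
    using F(1)[OF that] C_nonneg[OF that(2)] by (simp add: t'_def)
  have t'sum: "(\<Sum>i\<in>{1..I}. \<Sum>j\<in>{1..J}. t' i j) \<le> ereal eps" using F(5) t by (simp add: t'_def)
  have t'r: "t' i j = ereal (real_of_ereal (t' i j))" if ij: "i \<in> {1..I}" "j \<in> {1..J}" for i j
  proof -
    have "t' i j = (\<Sum>j\<in>{j}. t' i j)" by simp
    also have "\<dots> \<le> (\<Sum>j\<in>{1..J}. t' i j)" using ij t'0 by (intro sum_mono2) auto
    also have "\<dots> = (\<Sum>i\<in>{i}. \<Sum>j\<in>{1..J}. t' i j)" by simp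
    also have "\<dots> \<le> (\<Sum>i\<in>{1..I}. \<Sum>j\<in>{1..J}. t' i j)" using ij t'0 by (intro sum_mono2 sum_nonneg) auto
    also have "\<dots> \<le> ereal eps" by (rule t'sum)
    finally show ?thesis using t'0[OF ij] by (cases "t' i j") auto
  qed
  define \<gamma> where "\<gamma> i j = real_of_ereal (t' i j)" for i j
  have "ereal (\<Sum>i\<in>{1..I}. \<Sum>j\<in>{1..J}. \<gamma> i j) = (\<Sum>i\<in>{1..I}. \<Sum>j\<in>{1..J}. ereal (\<gamma> i j))" by simp
  also have "\<dots> = (\<Sum>i\<in>{1..I}. \<Sum>j\<in>{1..J}. t' i j)" by (intro sum.cong refl) (simp add: \<gamma>_def flip: t'r)
  finally have "(\<Sum>i\<in>{1..I}. \<Sum>j\<in>{1..J}. \<gamma> i j) \<le> eps" using t'sum by (metis ereal_less_eq(3))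
  moreover have "ereal (q i j) * C j (z i j) \<le> ereal (\<gamma> i j)" if "i \<in> {1..I}" "j \<in> {1..J}" for i j
    using t'r[OF that] by (simp add: \<gamma>_def t'_def)
  ultimately have plan: "(q, z, \<gamma>) \<in> plans eps" using F(1,3) by (auto simp: plans_def)
  show thesis
  proof (rule that[OF plan])
    fix \<theta> assume \<theta>: "\<theta> \<in> T"
    have 1: "ereal (\<Sum>i\<in>{1..I}. \<Sum>j\<in>{1..J}. \<alpha> i j \<bullet> \<theta> - q i j * u i \<theta> (z i j)) \<le>
        (\<Sum>i\<in>{1..I}. \<Sum>j\<in>{1..J}. persp (\<lambda>(a, x). fenchel_conj (\<lambda>\<theta>. l i \<theta> (zh j + x)) a) (q i j) (\<alpha> i j, \<xi> i j))"
      unfolding sum_ereal[symmetric] z_def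
      by (intro sum_mono persp_loss_conj_ge F(1) inf)
    have "ereal (\<Sum>k\<in>{1..L}. \<beta> k \<bullet> \<theta> - \<nu> k * 0) \<le> (\<Sum>k\<in>{1..L}. persp (fenchel_conj (g k)) (\<nu> k) (\<beta> k))"
      unfolding sum_ereal[symmetric] using \<theta> by (intro sum_mono persp_conj_ge F(2)) (auto simp: T_eq zero_ereal_def)
    then have 2: "ereal (\<Sum>k\<in>{1..L}. \<beta> k \<bullet> \<theta>) \<le> (\<Sum>k\<in>{1..L}. persp (fenchel_conj (g k)) (\<nu> k) (\<beta> k))" by simp
    have "dual_objective I J L l g zh (\<beta>, \<nu>, q, \<xi>, \<alpha>) \<le>
        - ereal (\<Sum>i\<in>{1..I}. \<Sum>j\<in>{1..J}. \<alpha> i j \<bullet> \<theta> - q i j * u i \<theta> (z i j)) - ereal (\<Sum>k\<in>{1..L}. \<beta> k \<bullet> \<theta>)"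
      unfolding dual_objective_def prod.case using 1 2
      unfolding sum_ereal by (intro ereal_minus_mono) (simp_all only: ereal_minus_le_minus)
    also have "\<dots> = ereal (val (q, z, \<gamma>) \<theta>)"
    proof -
      have "((\<Sum>i\<in>{1..I}. \<Sum>j\<in>{1..J}. \<alpha> i j) + (\<Sum>k\<in>{1..L}. \<beta> k)) \<bullet> \<theta> = 0" by (simp only: F(4) inner_zero_left)
      then have "(\<Sum>i\<in>{1..I}. \<Sum>j\<in>{1..J}. \<alpha> i j \<bullet> \<theta>) + (\<Sum>k\<in>{1..L}. \<beta> k \<bullet> \<theta>) = 0"
        by (simp add: inner_add_left inner_sum_left)
      then show ?thesis by (simp add: val_def sum_subtractf)
    qed
    finally show "dual_objective I J L l g zh (\<beta>, \<nu>, q, \<xi>, \<alpha>) \<le> ereal (val (q, z, \<gamma>) \<theta>)" .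
  qed
qed

text \<open>Strong duality for a fixed plan: q and \<xi> come from the plan, \<alpha> from the
  slopes of the minorants of its weighted pieces, \<beta> and \<nu> from the multipliers of the
  constraints on \<theta>.\<close>

lemma dual_objective_attains:
  assumes plan: "(q, z, \<gamma>) \<in> plans eps" and M: "\<And>\<theta>. \<theta> \<in> T \<Longrightarrow> M \<le> val (q, z, \<gamma>) \<theta>"
  obtains \<beta> \<nu> \<xi> \<alpha> where "dual_feasible I J K L Z c f zh p eps (\<beta>, \<nu>, q, \<xi>, \<alpha>)"
    "ereal M \<le> dual_objective I J L l g zh (\<beta>, \<nu>, q, \<xi>, \<alpha>)"
proof -
  have q0: "0 \<le> q i j" if "i \<in> {1..I}" "j \<in> {1..J}" for i j using plan that by (auto simp: plans_def)
  obtain \<theta>s where \<theta>s: "slater_point {1..L} g \<theta>s" using g_slater by blast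
  have val_sum: "val (q, z, \<gamma>) \<theta> = (\<Sum>a\<in>support q. (case a of (i, j) \<Rightarrow> q i j * u i \<theta> (z i j)))" for \<theta>
    unfolding val_def prod.case by (rule sum_support[symmetric]) (use q0 in force)
  have "\<exists>a b \<nu>. (\<forall>i\<in>support q. affine_real (a i) \<and> (\<forall>x. a i x \<le> (case i of (i, j) \<Rightarrow> q i j * u i x (z i j))))
    \<and> (\<forall>k\<in>{1..L}. affine_real (b k) \<and> 0 \<le> \<nu> k \<and> (\<forall>x\<in>edom (g k). b k x \<le> \<nu> k * real_of_ereal (g k x)))
    \<and> (\<forall>x. M \<le> (\<Sum>i\<in>support q. a i x) + (\<Sum>k\<in>{1..L}. b k x))"
  proof (rule lagrange_multipliers[OF _ finite_support _ _ \<theta>s])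
    show "convex_on UNIV (\<lambda>x. case i of (i, j) \<Rightarrow> q i j * u i x (z i j))" if "i \<in> support q" for i
      using that u_convex by (auto simp: support_def intro!: convex_on_cmul)
    show "M \<le> (\<Sum>i\<in>support q. case i of (i, j) \<Rightarrow> q i j * u i x (z i j))" if "\<And>k. k \<in> {1..L} \<Longrightarrow> g k x \<le> 0" for x
      using M[of x] that by (simp add: val_sum T_eq)
  qed (use g_pcl in \<open>auto simp: proper_convex_lsc_def\<close>)
  then obtain a b \<nu> where a: "\<forall>i\<in>support q. affine_real (a i) \<and> (\<forall>x. a i x \<le> (case i of (i, j) \<Rightarrow> q i j * u i x (z i j)))"
    and b: "\<forall>k\<in>{1..L}. affine_real (b k) \<and> 0 \<le> \<nu> k \<and> (\<forall>x\<in>edom (g k). b k x \<le> \<nu> k * real_of_ereal (g k x))"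
    and le: "\<forall>x. M \<le> (\<Sum>i\<in>support q. a i x) + (\<Sum>k\<in>{1..L}. b k x)" by blast
  have "\<forall>s\<in>support q. \<exists>v r. \<forall>x. a s x = v \<bullet> x + r" using a by (auto simp: affine_real_def)
  then obtain v r where vr: "\<And>s x. s \<in> support q \<Longrightarrow> a s x = v s \<bullet> x + r s" by metis
  have "\<forall>k\<in>{1..L}. \<exists>v r. \<forall>x. b k x = v \<bullet> x + r" using b by (auto simp: affine_real_def)
  then obtain \<beta> t where \<beta>t: "\<And>k x. k \<in> {1..L} \<Longrightarrow> b k x = \<beta> k \<bullet> x + t k" by metis
  define \<alpha> where "\<alpha> i j = (if 0 < q i j then v (i, j) else 0)" for i j
  define R where "R i j = (if 0 < q i j then r (i, j) else 0)" for i j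
  define \<xi> where "\<xi> i j = q i j *\<^sub>R (z i j - zh j)" for i j
  have \<alpha>s: "(\<Sum>s\<in>support q. v s) = (\<Sum>i\<in>{1..I}. \<Sum>j\<in>{1..J}. \<alpha> i j)"
  proof -
    have "(\<Sum>s\<in>support q. v s) = (\<Sum>(i, j)\<in>support q. \<alpha> i j)" by (intro sum.cong refl) (auto simp: \<alpha>_def support_def)
    then show ?thesis by (subst (asm) sum_support) (auto simp: \<alpha>_def)
  qed
  have Rs: "(\<Sum>s\<in>support q. r s) = (\<Sum>i\<in>{1..I}. \<Sum>j\<in>{1..J}. R i j)"
  proof -
    have "(\<Sum>s\<in>support q. r s) = (\<Sum>(i, j)\<in>support q. R i j)" by (intro sum.cong refl) (auto simp: R_def support_def)
    then show ?thesis by (subst (asm) sum_support) (auto simp: R_def)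
  qed
  let ?w = "(\<Sum>i\<in>{1..I}. \<Sum>j\<in>{1..J}. \<alpha> i j) + (\<Sum>k\<in>{1..L}. \<beta> k)"
  let ?s = "(\<Sum>i\<in>{1..I}. \<Sum>j\<in>{1..J}. R i j) + (\<Sum>k\<in>{1..L}. t k)"
  have low: "M \<le> ?w \<bullet> x + ?s" for x
  proof -
    have "(\<Sum>i\<in>support q. a i x) = (\<Sum>s\<in>support q. v s) \<bullet> x + (\<Sum>s\<in>support q. r s)"
      by (simp add: vr sum.distrib inner_sum_left)
    moreover have "(\<Sum>k\<in>{1..L}. b k x) = (\<Sum>k\<in>{1..L}. \<beta> k) \<bullet> x + (\<Sum>k\<in>{1..L}. t k)"
      by (simp add: \<beta>t sum.distrib inner_sum_left)
    ultimately show ?thesis using le[rule_format, of x] by (simp add: \<alpha>s Rs inner_add_left)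
  qed
  \<comment> \<open>An affine function bounded below is constant: this is the balance equation of
    the dual program, and the constant term carries the bound M.\<close>
  have w0: "?w = 0" using low by (rule affine_bounded_below_slope)
  have Ms: "M \<le> ?s" using low[of 0] by simp
  have zq: "zh j + \<xi> i j /\<^sub>R q i j = z i j" if "q i j \<noteq> 0" for i j using that by (simp add: \<xi>_def)
  have \<xi>0: "\<xi> i j = 0" if "q i j = 0" for i j using that by (simp add: \<xi>_def)
  have feas: "dual_feasible I J K L Z c f zh p eps (\<beta>, \<nu>, q, \<xi>, \<alpha>)"
    unfolding dual_feasible_def prod.case
  proof (intro conjI ballI)
    show "0 \<le> \<nu> k" if "k \<in> {1..L}" for k using b that by auto
    show "0 \<le> q i j" if "i \<in> {1..I}" "j \<in> {1..J}" for i j by (rule q0[OF that])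
    show "persp (\<lambda>x. f k (zh j + x)) (q i j) (\<xi> i j) \<le> 0" if "i \<in> {1..I}" "j \<in> {1..J}" "k \<in> {1..K}" for i j k
    proof (cases "q i j = 0")
      case True
      then show ?thesis using persp_zero_le by (simp add: \<xi>0)
    next
      case False
      then have "(i, j) \<in> support q" using that q0[of i j] by (auto simp: support_def)
      then have "f k (z i j) \<le> 0" using plan_cost_finite(1)[OF plan] that(3) by (auto simp: Z_eq)
      then have "ereal (q i j) * f k (z i j) \<le> ereal (q i j) * 0"
        using q0[OF that(1,2)] by (intro ereal_mult_left_mono) auto
      then show ?thesis using False by (simp add: persp_def zq)
    qed
    show "(\<Sum>i\<in>{1..I}. q i j) = p j" if "j \<in> {1..J}" for j using plan that by (auto simp: plans_def)
    show "?w = 0" by (rule w0)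
    have "(\<Sum>i\<in>{1..I}. \<Sum>j\<in>{1..J}. persp (\<lambda>x. cost_ext Z c (zh j) (zh j + x)) (q i j) (\<xi> i j)) \<le> (\<Sum>i\<in>{1..I}. \<Sum>j\<in>{1..J}. ereal (\<gamma> i j))"
    proof (intro sum_mono)
      fix i j assume ij: "i \<in> {1..I}" "j \<in> {1..J}"
      show "persp (\<lambda>x. cost_ext Z c (zh j) (zh j + x)) (q i j) (\<xi> i j) \<le> ereal (\<gamma> i j)"
      proof (cases "q i j = 0")
        case True
        have "persp (\<lambda>x. cost_ext Z c (zh j) (zh j + x)) 0 0 \<le> 0" by (rule persp_zero_le)
        also have "0 \<le> ereal (\<gamma> i j)" using plans_gamma_nonneg[OF plan ij] by simp
        finally show ?thesis using True by (simp add: \<xi>0)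
      next
        case False
        then show ?thesis using plan ij by (simp add: persp_def zq plans_def C_eq)
      qed
    qed
    also have "\<dots> \<le> ereal eps" using plan by (simp add: plans_def)
    finally show "(\<Sum>i\<in>{1..I}. \<Sum>j\<in>{1..J}. persp (\<lambda>x. cost_ext Z c (zh j) (zh j + x)) (q i j) (\<xi> i j)) \<le> ereal eps" .
  qed
  have 1: "(\<Sum>i\<in>{1..I}. \<Sum>j\<in>{1..J}. persp (\<lambda>(a, x). fenchel_conj (\<lambda>\<theta>. l i \<theta> (zh j + x)) a) (q i j) (\<alpha> i j, \<xi> i j))
      \<le> (\<Sum>i\<in>{1..I}. \<Sum>j\<in>{1..J}. ereal (- R i j))"
  proof (intro sum_mono)
    fix i j assume ij: "i \<in> {1..I}" "j \<in> {1..J}"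
    show "persp (\<lambda>(a, x). fenchel_conj (\<lambda>\<theta>. l i \<theta> (zh j + x)) a) (q i j) (\<alpha> i j, \<xi> i j) \<le> ereal (- R i j)"
    proof (cases "q i j = 0")
      case True
      then show ?thesis using persp_zero_le[where 'a="'m \<times> 'd"] by (simp add: \<xi>0 \<alpha>_def R_def zero_prod_def zero_ereal_def)
    next
      case False
      then have qp: "0 < q i j" using q0[OF ij] by simp
      then have s: "(i, j) \<in> support q" using ij by (simp add: support_def)
      have "fenchel_conj (\<lambda>\<theta>. l i \<theta> (z i j)) (\<alpha> i j /\<^sub>R q i j) \<le> ereal (- (R i j / q i j))"
      proof (rule fenchel_conj_affine_minorant)
        fix \<theta>
        have "a (i, j) \<theta> \<le> q i j * u i \<theta> (z i j)" using bspec[OF a s] by simp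
        then have "v (i, j) \<bullet> \<theta> + r (i, j) \<le> q i j * u i \<theta> (z i j)" by (simp only: vr[OF s])
        then show "ereal ((\<alpha> i j /\<^sub>R q i j) \<bullet> \<theta> + R i j / q i j) \<le> l i \<theta> (z i j)"
          using qp by (simp add: l_eq[OF ij(1)] \<alpha>_def R_def field_simps)
      qed
      then have "ereal (q i j) * fenchel_conj (\<lambda>\<theta>. l i \<theta> (z i j)) (\<alpha> i j /\<^sub>R q i j) \<le> ereal (q i j) * ereal (- (R i j / q i j))"
        using qp by (intro ereal_mult_left_mono) auto
      then show ?thesis using qp zq[OF False] by (simp add: persp_def)
    qed
  qed
  have 2: "(\<Sum>k\<in>{1..L}. persp (fenchel_conj (g k)) (\<nu> k) (\<beta> k)) \<le> (\<Sum>k\<in>{1..L}. ereal (- t k))"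
    using b \<beta>t by (intro sum_mono persp_conj_le g_pcl) auto
  have "ereal M \<le> - ereal (\<Sum>i\<in>{1..I}. \<Sum>j\<in>{1..J}. - R i j) - ereal (\<Sum>k\<in>{1..L}. - t k)"
    using Ms by (simp add: sum_negf)
  also have "\<dots> \<le> dual_objective I J L l g zh (\<beta>, \<nu>, q, \<xi>, \<alpha>)"
    unfolding dual_objective_def prod.case using 1 2
      unfolding sum_ereal by (intro ereal_minus_mono) (simp_all only: ereal_minus_le_minus)
  finally show thesis using that feas by blast
qed

end

section \<open>From the stated hypotheses to the abstract data\<close>

lemma lsc_on_section_closed:
  fixes c :: "'a::metric_space \<Rightarrow> 'a \<Rightarrow> ennreal"
  assumes "closed Z" "zh \<in> Z" and lsc: "lsc_on (Z \<times> Z) (\<lambda>(z, zhat). enn2ereal (c z zhat))"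
  shows "closed {z. cost_ext Z c zh z \<le> ereal t}"
proof -
  have "open (- {z. cost_ext Z c zh z \<le> ereal t})"
  proof (subst open_subopen, rule ballI)
    fix x assume "x \<in> - {z. cost_ext Z c zh z \<le> ereal t}"
    then have x: "\<not> cost_ext Z c zh x \<le> ereal t" by simp
    show "\<exists>S. open S \<and> x \<in> S \<and> S \<subseteq> - {z. cost_ext Z c zh z \<le> ereal t}"
    \<comment> \<open>Off the closed set Z the extension is infinite on a whole neighbourhood; on Z,
      semicontinuity on Z x Z is restricted to the slice at \<open>zh\<close>.\<close>
    proof (cases "x \<in> Z")
      case False
      then show ?thesis using \<open>closed Z\<close>
        by (intro exI[of _ "- Z"]) (auto simp: cost_ext_def)
    next
      case True
      let ?F = "\<lambda>(z, zhat). enn2ereal (c z zhat)"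
      have "ereal t < ?F (x, zh)" using x True by (simp add: cost_ext_def)
      also have "\<dots> \<le> Liminf (at (x, zh) within Z \<times> Z) ?F"
        using lsc True assms(2) unfolding lsc_on_def by blast
      finally have "\<forall>\<^sub>F w in at (x, zh) within Z \<times> Z. ereal t < ?F w" by (rule less_LiminfD)
      then obtain S where S: "open S" "(x, zh) \<in> S" "\<And>w. w \<in> S \<Longrightarrow> w \<noteq> (x, zh) \<Longrightarrow> w \<in> Z \<times> Z \<Longrightarrow> ereal t < ?F w"
        unfolding eventually_at_topological by blast
      have "continuous_on UNIV (\<lambda>z. (z, zh))" by (intro continuous_intros)
      then have "open ((\<lambda>z. (z, zh)) -` S)" using S(1) by (intro open_vimage)
      moreover have "ereal t < cost_ext Z c zh z" if "(z, zh) \<in> S" for z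
        using S(3)[OF that] x assms(2) by (cases "z = x") (auto simp: cost_ext_def not_le)
      ultimately show ?thesis using S(2) by (intro exI[of _ "(\<lambda>z. (z, zh)) -` S"]) (auto simp flip: not_le)
    qed
  qed
  then show ?thesis by (simp add: closed_def)
qed

lemma discrete_dist_total_weight:
  assumes "discrete_dist S p x \<in> probs_on Z" "finite S" "closed Z" "\<And>j. j \<in> S \<Longrightarrow> 0 \<le> p j \<and> x j \<in> Z"
  shows "(\<Sum>j\<in>S. p j) = 1"
proof -
  have "1 = emeasure (discrete_dist S p x) Z" using assms(1) by (simp add: probs_on_def)
  also have "\<dots> = (\<Sum>j\<in>S. ennreal (p j) * indicator Z (x j))"
    using assms by (intro emeasure_discrete_dist) auto
  also have "\<dots> = (\<Sum>j\<in>S. ennreal (p j))" using assms(4) by (intro sum.cong) auto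
  also have "\<dots> = ennreal (\<Sum>j\<in>S. p j)" using assms(4) by (intro sum_ennreal) auto
  finally show ?thesis by (metis ennreal_eq_1)
qed

lemma superlinear_cost_growth:
  assumes "compact Z \<or> ((\<lambda>z. cost_ext Z c zh z / ereal (norm z)) \<longlongrightarrow> \<infinity>) at_infinity"
  shows "\<exists>R. \<forall>z. R \<le> norm z \<longrightarrow> ereal (N * norm z) \<le> cost_ext Z c zh z"
  using assms
proof
  \<comment> \<open>Beyond a bound on Z the extended cost is infinite, so compactness is a case of
    superlinear growth.\<close>
  assume "compact Z"
  then obtain B where "\<And>z. z \<in> Z \<Longrightarrow> norm z < B" using compact_imp_bounded bounded_pos_less by metis
  then show ?thesis by (intro exI[of _ B]) (force simp: cost_ext_def)
next
  assume "((\<lambda>z. cost_ext Z c zh z / ereal (norm z)) \<longlongrightarrow> \<infinity>) at_infinity"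
  then have "\<forall>\<^sub>F z in at_infinity. ereal N < cost_ext Z c zh z / ereal (norm z)" by (simp add: tendsto_PInfty)
  then obtain B where B: "\<And>z. B \<le> norm z \<Longrightarrow> ereal N < cost_ext Z c zh z / ereal (norm z)"
    by (auto simp: eventually_at_infinity)
  have "ereal (N * norm z) \<le> cost_ext Z c zh z" if z: "max B 1 \<le> norm z" for z
  proof (cases "cost_ext Z c zh z")
    case (real s)
    have "1 \<le> norm z" using z by simp
    then have "norm z > 0" by linarith
    moreover have "N < s / norm z" using B[of z] z real \<open>norm z > 0\<close> by simp
    ultimately show ?thesis using real by (simp add: field_simps)
  next
    case MInf
    moreover have "0 \<le> cost_ext Z c zh z" by (simp add: cost_ext_def)
    ultimately show ?thesis by simp
  qed simp
  then show ?thesis by blast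
qed

theorem theorem2:
  fixes \<Theta> :: "(real ^ 'm) set" and Z :: "(real ^ 'd) set"
    and c :: "real ^ 'd \<Rightarrow> real ^ 'd \<Rightarrow> ennreal" and eps :: real
    and Phat :: "(real ^ 'd) measure" and p :: "nat \<Rightarrow> real" and zh :: "nat \<Rightarrow> real ^ 'd"
    and loss :: "real ^ 'm \<Rightarrow> real ^ 'd \<Rightarrow> ereal" and l :: "nat \<Rightarrow> real ^ 'm \<Rightarrow> real ^ 'd \<Rightarrow> ereal"
    and f :: "nat \<Rightarrow> real ^ 'd \<Rightarrow> ereal" and g :: "nat \<Rightarrow> real ^ 'm \<Rightarrow> ereal"
    and I J K L :: nat
  assumes "\<Theta> \<noteq> {}" and "closed \<Theta>" and "Z \<noteq> {}" and "closed Z"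
    and cost_zero: "\<forall>z\<in>Z. \<forall>zhat\<in>Z. c z zhat = 0 \<longleftrightarrow> z = zhat"
    and eps: "eps > 0"
    \<comment> \<open>discrete reference distribution\<close>
    and "Phat \<in> probs_on Z"
    and "Phat = discrete_dist {1..J} p zh"
    and "\<forall>j\<in>{1..J}. p j > 0 \<and> zh j \<in> Z"
    \<comment> \<open>convexity\<close>
    and "lsc_on (Z \<times> Z) (\<lambda>(z, zhat). enn2ereal (c z zhat))"
    and "\<forall>zhat\<in>Z. econvex (cost_ext Z c zhat)"
    and "I \<ge> 1"
    and "\<forall>\<theta> z. loss \<theta> z = Max ((\<lambda>i. l i \<theta> z) ` {1..I})"
    and "\<forall>i\<in>{1..I}. \<forall>z. proper_convex_lsc (\<lambda>\<theta>. l i \<theta> z)"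
    and "\<forall>i\<in>{1..I}. \<forall>\<theta>. proper_convex_lsc (\<lambda>z. - l i \<theta> z)"
    and "Z = {z. \<forall>k\<in>{1..K}. f k z \<le> 0}" and "\<forall>k\<in>{1..K}. proper_convex_lsc (f k)"
    and "\<Theta> = {\<theta>. \<forall>k\<in>{1..L}. g k \<theta> \<le> 0}" and "\<forall>k\<in>{1..L}. proper_convex_lsc (g k)"
    \<comment> \<open>Slater conditions\<close>
    and "\<forall>j\<in>{1..J}. zh j \<in> rel_interior (edom (cost_ext Z c (zh j))) \<and> slater_point {1..K} f (zh j)"
    and "\<exists>\<theta>. slater_point {1..L} g \<theta>"
    \<comment> \<open>local uniform integrability of the negative part of the loss\<close>
    and "\<forall>Q\<in>ot_ball Z c eps Phat. \<forall>\<theta>\<in>\<Theta>. \<exists>U. open U \<and> \<theta> \<in> U \<and>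
           unif_integrable Q (neg_part loss ` (U \<inter> \<Theta>))"
    and "\<exists>\<theta>\<in>\<Theta>. worst_risk (ot_ball Z c eps Phat) loss \<theta> < \<infinity>"
    and "(\<exists>Q\<in>ot_ball Z c eps Phat. \<forall>a::real. compact {\<theta>\<in>\<Theta>. eexpect Q (loss \<theta>) \<le> ereal a})
       \<or> compact Z
       \<or> (\<forall>zhat\<in>Z. ((\<lambda>z. cost_ext Z c zhat z / ereal (norm z)) \<longlongrightarrow> \<infinity>) at_infinity)"
  shows
    "(INF \<theta>\<in>\<Theta>. worst_risk (ot_ball Z c eps Phat) loss \<theta>)
       = (SUP Q\<in>ot_ball Z c eps Phat. best_risk \<Theta> loss Q)
     \<and> (\<forall>\<theta> lam s zl zc tau zf.
          is_arg_min (primal_objective J eps p) (primal_feasible I J K \<Theta> Z c l f zh)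
            (\<theta>, lam, s, zl, zc, tau, zf)
          \<longrightarrow> is_arg_min (worst_risk (ot_ball Z c eps Phat) loss) (\<lambda>\<theta>. \<theta> \<in> \<Theta>) \<theta>)
     \<and> (\<forall>\<beta> \<nu> q \<xi> \<alpha>.
          is_arg_max (dual_objective I J L l g zh) (dual_feasible I J K L Z c f zh p eps)
            (\<beta>, \<nu>, q, \<xi>, \<alpha>)
          \<and> (\<forall>j\<in>{1..J}. {i\<in>{1..I}. q i j = 0 \<and> \<xi> i j \<noteq> 0} = {})
          \<longrightarrow> is_arg_max (best_risk \<Theta> loss) (\<lambda>Q. Q \<in> ot_ball Z c eps Phat)
                (discrete_dist {(i, j). i \<in> {1..I} \<and> j \<in> {1..J} \<and> q i j > 0}
                  (\<lambda>(i, j). q i j) (\<lambda>(i, j). zh j + \<xi> i j /\<^sub>R q i j)))"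
proof -
  define u where "u i \<theta> z = real_of_ereal (l i \<theta> z)" for i \<theta> z
  define C where "C j = cost_ext Z c (zh j)" for j
  have l_fin: "l i \<theta> z = ereal (u i \<theta> z)" if "i \<in> {1..I}" for i \<theta> z
  proof -
    have "l i \<theta> z \<noteq> -\<infinity>" "- l i \<theta> z \<noteq> -\<infinity>"
      using assms(14,15) that by (auto simp: proper_convex_lsc_def proper_def)
    then show ?thesis by (cases "l i \<theta> z") (auto simp: u_def)
  qed
  have cvx: "convex_on UNIV (\<lambda>x. r x)" if "proper_convex_lsc (\<lambda>x. ereal (r x))" for r :: "'x::real_normed_vector \<Rightarrow> real"
  proof -
    have "edom (\<lambda>x. ereal (r x)) = UNIV" by (auto simp: edom_def)
    then show ?thesis using econvex_convex_on_edom[of "\<lambda>x. ereal (r x)"] that by (simp add: proper_convex_lsc_def)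
  qed
  interpret P: dro_problem I J p zh C u \<Theta> eps Z c l K f L g
  proof
    show "1 \<le> I" by fact
    show "0 < p j" if "j \<in> {1..J}" for j using assms(9) that by blast
    show "0 \<le> C j z" for j z by (simp add: C_def cost_ext_def)
    show "econvex (C j)" if "j \<in> {1..J}" for j using assms(9,11) that by (simp add: C_def)
    show "closed {z. C j z \<le> ereal t}" if "j \<in> {1..J}" for j t
      unfolding C_def using assms(4,9,10) that by (intro lsc_on_section_closed) auto
    show "C j z = 0 \<longleftrightarrow> z = zh j" if "j \<in> {1..J}" for j z
    proof -
      have "enn2ereal x = 0 \<longleftrightarrow> x = 0" for x by (metis enn2ereal_inject zero_ennreal.rep_eq)
      then show ?thesis using cost_zero assms(9) that by (auto simp: C_def cost_ext_def)
    qed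
    show "convex_on UNIV (\<lambda>z. - u i \<theta> z)" if "i \<in> {1..I}" for i \<theta>
      using assms(15) that by (intro cvx) (simp add: l_fin flip: uminus_ereal.simps)
    show "convex_on UNIV (\<lambda>\<theta>. u i \<theta> z)" if "i \<in> {1..I}" for i z
      using assms(14) that by (intro cvx) (simp add: l_fin)
    have "\<Theta> = (\<Inter>k\<in>{1..L}. {\<theta>. g k \<theta> \<le> 0})" using assms(18) by auto
    then show "convex \<Theta>" using assms(19) by (auto intro!: convex_INT econvex_convex_level simp: proper_convex_lsc_def)
    show "C j = cost_ext Z c (zh j)" for j by (rule C_def)
    show "(\<Sum>j\<in>{1..J}. p j) = 1"
      using assms(4,7,8,9) by (intro discrete_dist_total_weight[of _ _ zh Z]) (auto intro: less_imp_le)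
  qed (use assms l_fin in auto)
  let ?B = "ot_ball Z c eps Phat"
  have Phat: "P.Phat = Phat" using assms(8) by (simp add: P.Phat_def)
  have loss: "loss \<theta> z = ereal (P.loss_of \<theta> z)" for \<theta> z
  proof -
    have "ereal (Max ((\<lambda>i. u i \<theta> z) ` {1..I})) = Max (ereal ` (\<lambda>i. u i \<theta> z) ` {1..I})"
      using \<open>I \<ge> 1\<close> by (intro mono_Max_commute) (auto simp: mono_def)
    also have "ereal ` (\<lambda>i. u i \<theta> z) ` {1..I} = (\<lambda>i. l i \<theta> z) ` {1..I}"
      unfolding image_image by (intro image_cong refl) (simp add: l_fin)
    finally show ?thesis using assms(13) by (simp add: P.loss_of_def)
  qed
  have risk: "worst_risk ?B loss \<theta> = P.worst \<theta>" for \<theta>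
    using P.worst_risk_eq[of loss \<theta>, OF loss] by (simp add: Phat)
  let ?V = "INF \<theta>\<in>\<Theta>. worst_risk ?B loss \<theta>"
  obtain \<theta>0 where \<theta>0: "\<theta>0 \<in> \<Theta>" "P.worst \<theta>0 < \<infinity>" using assms(23) by (auto simp: risk)
  \<comment> \<open>Strictness of a below the value is what the open covers in the minimax lemmas
    require.\<close>
  have minimax: "\<exists>x\<in>P.plans eps. \<forall>\<theta>\<in>\<Theta>. a \<le> P.val x \<theta>" if a: "ereal a < ?V" for a
  proof -
    have aw: "ereal a < P.worst \<theta>" if "\<theta> \<in> \<Theta>" for \<theta>
      using a INF_lower[OF that, of "worst_risk ?B loss"] by (auto simp: risk intro: less_le_trans)
    consider (inf_compact) Q where "Q \<in> ?B" "\<And>b::real. compact {\<theta>\<in>\<Theta>. eexpect Q (loss \<theta>) \<le> ereal b}"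
      | (growth) "compact Z \<or> (\<forall>zhat\<in>Z. ((\<lambda>z. cost_ext Z c zhat z / ereal (norm z)) \<longlongrightarrow> \<infinity>) at_infinity)"
      using assms(24) by blast
    then show ?thesis
    proof cases
      case inf_compact
      have bdd: "bounded {\<theta>\<in>\<Theta>. P.worst \<theta> \<le> ereal b}" for b
      proof (rule bounded_subset[OF compact_imp_bounded[OF inf_compact(2)[of b]]])
        have "eexpect Q (loss \<theta>) \<le> P.worst \<theta>" for \<theta>
          unfolding risk[symmetric] worst_risk_def using inf_compact(1) by (rule SUP_upper)
        then show "{\<theta>\<in>\<Theta>. P.worst \<theta> \<le> ereal b} \<subseteq> {\<theta>\<in>\<Theta>. eexpect Q (loss \<theta>) \<le> ereal b}"
          by (auto intro: order_trans)
      qed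
      obtain x where "x \<in> P.plans eps" "\<And>\<theta>. \<theta> \<in> \<Theta> \<Longrightarrow> a \<le> P.val x \<theta>"
        by (rule P.minimax_bounded[OF \<theta>0 bdd aw]) (assumption | rule that)+
      then show ?thesis by blast
    next
      case growth
      have gr: "\<exists>R. \<forall>z. R \<le> norm z \<longrightarrow> ereal (N * norm z) \<le> C j z" if "j \<in> {1..J}" for j N
        unfolding C_def using growth assms(9) that by (intro superlinear_cost_growth) auto
      obtain x where "x \<in> P.plans eps" "\<And>\<theta>. \<theta> \<in> \<Theta> \<Longrightarrow> a \<le> P.val x \<theta>"
        by (rule P.minimax_superlinear[OF gr \<theta>0 aw]) (assumption | rule that)+
      then show ?thesis by blast
    qed
  qed
  have best_le: "best_risk \<Theta> loss Q \<le> ?V" if Q: "Q \<in> ?B" for Q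
    unfolding best_risk_def worst_risk_def using Q by (intro INF_mono) (auto intro: SUP_upper)
  have plan_le_best: "ereal a \<le> best_risk \<Theta> loss (P.plan_dist q z)"
    if "(q, z, \<gamma>) \<in> P.plans eps" "\<And>\<theta>. \<theta> \<in> \<Theta> \<Longrightarrow> ereal a \<le> ereal (P.val (q, z, \<gamma>) \<theta>)" for a q z \<gamma>
    unfolding best_risk_def
  proof (rule INF_greatest)
    fix \<theta> assume "\<theta> \<in> \<Theta>"
    then have "ereal a \<le> ereal (P.val (q, z, \<gamma>) \<theta>)" by (rule that(2))
    also have "\<dots> \<le> eexpect (P.plan_dist q z) (\<lambda>z. ereal (P.loss_of \<theta> z))"
      by (rule P.val_le_expect_plan_dist[OF that(1)])
    finally show "ereal a \<le> eexpect (P.plan_dist q z) (loss \<theta>)" by (simp add: loss[abs_def])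
  qed
  have "?V = (SUP Q\<in>?B. best_risk \<Theta> loss Q)"
  proof (rule antisym)
    show "(SUP Q\<in>?B. best_risk \<Theta> loss Q) \<le> ?V" using best_le by (rule SUP_least)
    show "?V \<le> (SUP Q\<in>?B. best_risk \<Theta> loss Q)"
    proof (rule ccontr)
      assume "\<not> ?thesis"
      then obtain a where a: "(SUP Q\<in>?B. best_risk \<Theta> loss Q) < ereal a" "ereal a < ?V"
        unfolding not_le by (blast dest: ereal_dense2)
      then obtain x where x: "x \<in> P.plans eps" "\<forall>\<theta>\<in>\<Theta>. a \<le> P.val x \<theta>" using minimax by blast
      obtain q z \<gamma> where xe: "x = (q, z, \<gamma>)" by (cases x)
      have "ereal a \<le> best_risk \<Theta> loss (P.plan_dist q z)"
        using x by (intro plan_le_best[of q z \<gamma>]) (auto simp: xe)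
      also have "\<dots> \<le> (SUP Q\<in>?B. best_risk \<Theta> loss Q)"
        using P.plan_dist_in_ball[of q z \<gamma>] x by (intro SUP_upper) (simp add: xe Phat)
      finally show False using a(1) by simp
    qed
  qed
  moreover have "is_arg_min (worst_risk ?B loss) (\<lambda>\<theta>. \<theta> \<in> \<Theta>) \<theta>"
    if "is_arg_min (primal_objective J eps p) (primal_feasible I J K \<Theta> Z c l f zh) (\<theta>, lam, s, zl, zc, tau, zf)"
    for \<theta> lam s zl zc tau zf
    unfolding is_arg_min_def risk
  proof (intro conjI notI)
    let ?y = "(\<theta>, lam, s, zl, zc, tau, zf)"
    have feas: "primal_feasible I J K \<Theta> Z c l f zh ?y"
      and opt: "\<And>y. primal_feasible I J K \<Theta> Z c l f zh y \<Longrightarrow> \<not> primal_objective J eps p y < primal_objective J eps p ?y"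
      using that by (auto simp: is_arg_min_def)
    show "\<theta> \<in> \<Theta>" using feas by (simp add: primal_feasible_def)
    assume "\<exists>y. y \<in> \<Theta> \<and> P.worst y < P.worst \<theta>"
    then obtain \<theta>' where \<theta>': "\<theta>' \<in> \<Theta>" "P.worst \<theta>' < P.worst \<theta>" by blast
    have "P.worst \<theta>' < ereal (primal_objective J eps p ?y)"
      using \<theta>'(2) P.worst_le_primal_objective[OF feas] by (rule less_le_trans)
    then obtain W where W: "P.worst \<theta>' = ereal W" "W < primal_objective J eps p ?y"
      using P.worst_not_MInf[of \<theta>'] by (cases "P.worst \<theta>'") auto
    \<comment> \<open>Half the gap, so that a point within \<delta> of the risk of
      \<open>\<theta>'\<close> still beats the assumed optimum.\<close>
    define \<delta> where "\<delta> = (primal_objective J eps p ?y - W) / 2"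
    have \<delta>: "0 < \<delta>" using W(2) by (simp add: \<delta>_def)
    obtain lam' s' zl' zc' tau' zf' where y': "primal_feasible I J K \<Theta> Z c l f zh (\<theta>', lam', s', zl', zc', tau', zf')"
      "primal_objective J eps p (\<theta>', lam', s', zl', zc', tau', zf') \<le> W + \<delta>"
      by (rule P.primal_near_optimal[OF \<theta>'(1) W(1) \<delta>]) (rule that)
    have "W + \<delta> < primal_objective J eps p ?y" using W(2) by (simp add: \<delta>_def field_simps)
    then show False using opt[OF y'(1)] y'(2) by simp
  qed
  moreover have "is_arg_max (best_risk \<Theta> loss) (\<lambda>Q. Q \<in> ?B)
      (discrete_dist {(i, j). i \<in> {1..I} \<and> j \<in> {1..J} \<and> q i j > 0}
        (\<lambda>(i, j). q i j) (\<lambda>(i, j). zh j + \<xi> i j /\<^sub>R q i j))"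
    if opt: "is_arg_max (dual_objective I J L l g zh) (dual_feasible I J K L Z c f zh p eps) (\<beta>, \<nu>, q, \<xi>, \<alpha>)"
      and fin: "\<forall>j\<in>{1..J}. {i\<in>{1..I}. q i j = 0 \<and> \<xi> i j \<noteq> 0} = {}" for \<beta> \<nu> q \<xi> \<alpha>
  proof -
    let ?y = "(\<beta>, \<nu>, q, \<xi>, \<alpha>)"
    define z where "z = (\<lambda>i j. zh j + \<xi> i j /\<^sub>R q i j)"
    have feas: "dual_feasible I J K L Z c f zh p eps ?y"
      and opt': "\<And>y. dual_feasible I J K L Z c f zh p eps y \<Longrightarrow> \<not> dual_objective I J L l g zh ?y < dual_objective I J L l g zh y"
      using opt by (auto simp: is_arg_max_def)
    have \<xi>0: "\<xi> i j = 0" if "i \<in> {1..I}" "j \<in> {1..J}" "q i j = 0" for i j using fin that by blast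
    obtain \<gamma> where \<gamma>: "(q, z, \<gamma>) \<in> P.plans eps"
      "\<And>\<theta>. \<theta> \<in> \<Theta> \<Longrightarrow> dual_objective I J L l g zh ?y \<le> ereal (P.val (q, z, \<gamma>) \<theta>)"
      by (rule P.dual_feasible_plan[OF feas \<xi>0, folded z_def]) (assumption | rule that)+
    \<comment> \<open>Otherwise a plan with value at least some a strictly between the two would
      give, by duality over \<Theta>, a feasible point that beats the assumed maximum.\<close>
    have V: "?V \<le> dual_objective I J L l g zh ?y"
    proof (rule ccontr)
      assume "\<not> ?thesis"
      then obtain a where a: "dual_objective I J L l g zh ?y < ereal a" "ereal a < ?V"
        unfolding not_le by (blast dest: ereal_dense2)
      then obtain x where x: "x \<in> P.plans eps" "\<forall>\<theta>\<in>\<Theta>. a \<le> P.val x \<theta>" using minimax by blast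
      obtain q' z' \<gamma>' where xe: "x = (q', z', \<gamma>')" by (cases x)
      have "(q', z', \<gamma>') \<in> P.plans eps" "\<And>\<theta>. \<theta> \<in> \<Theta> \<Longrightarrow> a \<le> P.val (q', z', \<gamma>') \<theta>"
        using x by (auto simp: xe)
      then obtain \<beta>' \<nu>' \<xi>' \<alpha>' where "dual_feasible I J K L Z c f zh p eps (\<beta>', \<nu>', q', \<xi>', \<alpha>')"
        "ereal a \<le> dual_objective I J L l g zh (\<beta>', \<nu>', q', \<xi>', \<alpha>')"
        by (rule P.dual_objective_attains) (assumption | rule that)+
      then show False using opt' a(1) by (meson less_le_trans)
    qed
    have "dual_objective I J L l g zh ?y \<le> best_risk \<Theta> loss (P.plan_dist q z)"
      unfolding best_risk_def
    proof (rule INF_greatest)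
      fix \<theta> assume "\<theta> \<in> \<Theta>"
      then have "dual_objective I J L l g zh ?y \<le> ereal (P.val (q, z, \<gamma>) \<theta>)" by (rule \<gamma>(2))
      also have "\<dots> \<le> eexpect (P.plan_dist q z) (\<lambda>z. ereal (P.loss_of \<theta> z))"
        by (rule P.val_le_expect_plan_dist[OF \<gamma>(1)])
      finally show "dual_objective I J L l g zh ?y \<le> eexpect (P.plan_dist q z) (loss \<theta>)" by (simp add: loss[abs_def])
    qed
    \<comment> \<open>No distribution in the ball exceeds \<open>?V\<close>, which is at most the
      dual optimum, which the distribution of the plan reaches.\<close>
    then have "best_risk \<Theta> loss Q \<le> best_risk \<Theta> loss (P.plan_dist q z)" if "Q \<in> ?B" for Q
      using V best_le[OF that] by (meson order_trans)
    moreover have "P.plan_dist q z \<in> ?B" using P.plan_dist_in_ball[OF \<gamma>(1)] by (simp add: Phat)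
    moreover have "P.plan_dist q z = discrete_dist {(i, j). i \<in> {1..I} \<and> j \<in> {1..J} \<and> q i j > 0}
        (\<lambda>(i, j). q i j) (\<lambda>(i, j). zh j + \<xi> i j /\<^sub>R q i j)"
      by (simp add: P.plan_dist_def P.support_def z_def)
    ultimately show ?thesis unfolding is_arg_max_def by (metis not_le)
  qed
  ultimately show ?thesis by blast
qed

end
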